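(* Let $n\ge2$, $U\subseteq\mathbb{R}^n$ a domain and $\gamma\in C^1(U,\mathbb{R}^n)$ locally invertible with $J_\gamma$ of constant sign. (i) If for some $K>0$, every relatively compact domain $A\subseteq U$ and every nowhere constant $a\in C^1(\gamma(U))$ one has $\mu_1(\gamma(A),a)\le K^2\mu_1(A,a\circ\gamma)$, then $\gamma$ is a map with bounded distortion. (ii) If moreover $\gamma$ is invertible and for some $K>0$, every relatively compact domain $A\subseteq U$ and every nowhere constant $a\in C^1(\gamma(U))$ one has $K^{-2}\mu_1(\gamma(A),a)\le\mu_1(A,a\circ\gamma)\le K^2\mu_1(\gamma(A),a)$, then $\gamma$ is quasiconformal.
   Context: A domain is a connected open set. For a domain $W$: $\mathcal{D}[b]=\int_W|\nabla b|^2dx$; $H^{1,2}(W)$ the Sobolev space; $H^{1,2}_e(W)$ the extended Dirichlet space (a.e. limits of $\mathcal{D}$-Cauchy sequences in $H^{1,2}(W)$). Restrictions of $C^1$ functions on $\gamma(U)$ (resp. $U$) to relatively compact subdomains are regarded as multipliers of $H^{1,2}$ of those subdomains. $\Gamma[a]=|\nabla a|^2dx$; $a$ is nowhere constant on $W$ if $\mathrm{supp}(\Gamma[a])=W$. Then $\mathcal{F}^a=H^{1,2}_e(W)\cap L^2(W,\Gamma[a])$, $(\mathcal{D},\mathcal{F}^a)$ is a closed form on $L^2(W,\Gamma[a])$, and $\mu_1(W,a)=\inf(\mathrm{Sp}(\mathcal{D},\mathcal{F}^a)\setminus\{0\})$. Bounded distortion: $\gamma\in H^{1,1}_{\rm loc}$,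 $J_\gamma\in L^1_{\rm loc}$ of constant sign, $\|\gamma'(x)\|\le K'|J_\gamma(x)|^{1/n}$ a.e. for some $K'$; quasiconformal: homeomorphism with bounded distortion. *)

theory Defs
  imports "HOL-Analysis.Analysis"
begin

definition domain :: "'a::topological_space set \<Rightarrow> bool" where
  "domain W \<longleftrightarrow> open W \<and> connected W"

definition rel_compact_subdomain :: "'a::metric_space set \<Rightarrow> 'a set \<Rightarrow> bool" where
  "rel_compact_subdomain A U \<longleftrightarrow> domain A \<and> compact (closure A) \<and> closure A \<subseteq> U"

definition C1_on :: "'a::euclidean_space set \<Rightarrow> ('a \<Rightarrow> 'b::euclidean_space) \<Rightarrow> bool" where
  "C1_on S f \<longleftrightarrow> (\<exists>f'. (\<forall>x\<in>S. (f has_derivative blinfun_apply (f' x)) (at x)) \<and> continuous_on S f')"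

definition jac :: "(real^'n \<Rightarrow> real^'n) \<Rightarrow> real^'n \<Rightarrow> real" where
  "jac \<gamma> x = det (matrix (frechet_derivative \<gamma> (at x)))"

definition locally_invertible :: "'a::topological_space set \<Rightarrow> ('a \<Rightarrow> 'b::topological_space) \<Rightarrow> bool" where
  "locally_invertible U \<gamma> \<longleftrightarrow> (\<forall>x\<in>U. \<exists>V. open V \<and> x \<in> V \<and> V \<subseteq> U \<and> open (\<gamma> ` V) \<and>
       inj_on \<gamma> V \<and> continuous_on (\<gamma> ` V) (inv_into V \<gamma>))"

definition grad :: "(real^'n \<Rightarrow> real) \<Rightarrow> real^'n \<Rightarrow> real^'n" where
  "grad a x = (\<chi> i. frechet_derivative a (at x) (axis i 1))"

definition partial :: "(real^'n \<Rightarrow> real) \<Rightarrow> 'n \<Rightarrow> real^'n \<Rightarrow> real" where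
  "partial \<phi> i x = frechet_derivative \<phi> (at x) (axis i 1)"

fun Ck :: "nat \<Rightarrow> (real^'n \<Rightarrow> real) \<Rightarrow> bool" where
  "Ck 0 \<phi> \<longleftrightarrow> continuous_on UNIV \<phi>"
| "Ck (Suc k) \<phi> \<longleftrightarrow> continuous_on UNIV \<phi> \<and> (\<forall>x. \<phi> differentiable at x) \<and> (\<forall>i. Ck k (partial \<phi> i))"

definition smooth :: "(real^'n \<Rightarrow> real) \<Rightarrow> bool" where
  "smooth \<phi> \<longleftrightarrow> (\<forall>k. Ck k \<phi>)"

definition test_fun :: "(real^'n) set \<Rightarrow> (real^'n \<Rightarrow> real) \<Rightarrow> bool" where
  "test_fun W \<phi> \<longleftrightarrow> smooth \<phi> \<and> compact (closure {x. \<phi> x \<noteq> 0}) \<and> closure {x. \<phi> x \<noteq> 0} \<subseteq> W"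

definition L1loc :: "(real^'n) set \<Rightarrow> (real^'n \<Rightarrow> real) \<Rightarrow> bool" where
  "L1loc W f \<longleftrightarrow> f \<in> borel_measurable (lebesgue_on W) \<and>
     (\<forall>K. compact K \<and> K \<subseteq> W \<longrightarrow> integrable (lebesgue_on K) f)"

definition L2 :: "(real^'n) set \<Rightarrow> (real^'n \<Rightarrow> real) \<Rightarrow> bool" where
  "L2 W f \<longleftrightarrow> f \<in> borel_measurable (lebesgue_on W) \<and> integrable (lebesgue_on W) (\<lambda>x. (f x)\<^sup>2)"

definition weak_grad :: "(real^'n) set \<Rightarrow> (real^'n \<Rightarrow> real) \<Rightarrow> (real^'n \<Rightarrow> real^'n) \<Rightarrow> bool" where
  "weak_grad W f G \<longleftrightarrow> L1loc W f \<and> (\<forall>i. L1loc W (\<lambda>x. G x $ i)) \<and>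
     (\<forall>\<phi>. test_fun W \<phi> \<longrightarrow> (\<forall>i.
        integral\<^sup>L (lebesgue_on W) (\<lambda>x. f x * partial \<phi> i x)
        = - integral\<^sup>L (lebesgue_on W) (\<lambda>x. G x $ i * \<phi> x)))"

definition H12 :: "(real^'n) set \<Rightarrow> (real^'n \<Rightarrow> real) \<Rightarrow> bool" where
  "H12 W f \<longleftrightarrow> L2 W f \<and> (\<exists>G. weak_grad W f G \<and> (\<forall>i. L2 W (\<lambda>x. G x $ i)))"

definition wgrad :: "(real^'n) set \<Rightarrow> (real^'n \<Rightarrow> real) \<Rightarrow> real^'n \<Rightarrow> real^'n" where
  "wgrad W f = (SOME G. weak_grad W f G \<and> (\<forall>i. L2 W (\<lambda>x. G x $ i)))"

definition Dir :: "(real^'n) set \<Rightarrow> (real^'n \<Rightarrow> real) \<Rightarrow> real" where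
  "Dir W f = integral\<^sup>L (lebesgue_on W) (\<lambda>x. (norm (wgrad W f x))\<^sup>2)"

definition approx_seq :: "(real^'n) set \<Rightarrow> (real^'n \<Rightarrow> real) \<Rightarrow> (nat \<Rightarrow> real^'n \<Rightarrow> real) \<Rightarrow> bool" where
  "approx_seq W f s \<longleftrightarrow> (\<forall>k. H12 W (s k)) \<and>
     (\<forall>e>0. \<exists>N. \<forall>m\<ge>N. \<forall>k\<ge>N. Dir W (\<lambda>x. s m x - s k x) < e) \<and>
     (AE x in lebesgue_on W. (\<lambda>k. s k x) \<longlonglongrightarrow> f x)"

definition H12e :: "(real^'n) set \<Rightarrow> (real^'n \<Rightarrow> real) \<Rightarrow> bool" where
  "H12e W f \<longleftrightarrow> (\<exists>s. approx_seq W f s)"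

definition DirE :: "(real^'n) set \<Rightarrow> (real^'n \<Rightarrow> real) \<Rightarrow> real" where
  "DirE W f = lim (\<lambda>k. Dir W ((SOME s. approx_seq W f s) k))"

definition DirE2 :: "(real^'n) set \<Rightarrow> (real^'n \<Rightarrow> real) \<Rightarrow> (real^'n \<Rightarrow> real) \<Rightarrow> real" where
  "DirE2 W f h = (DirE W (\<lambda>x. f x + h x) - DirE W (\<lambda>x. f x - h x)) / 4"

definition Gamma :: "(real^'n) set \<Rightarrow> (real^'n \<Rightarrow> real) \<Rightarrow> (real^'n) measure" where
  "Gamma W a = density (lebesgue_on W) (\<lambda>x. ennreal ((norm (grad a x))\<^sup>2))"

definition nowhere_constant :: "(real^'n) set \<Rightarrow> (real^'n \<Rightarrow> real) \<Rightarrow> bool" where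
  "nowhere_constant W a \<longleftrightarrow>
     {x\<in>W. \<forall>e>0. emeasure (Gamma W a) (ball x e \<inter> W) > 0} = W"

definition L2G :: "(real^'n) set \<Rightarrow> (real^'n \<Rightarrow> real) \<Rightarrow> (real^'n \<Rightarrow> real) \<Rightarrow> bool" where
  "L2G W a f \<longleftrightarrow> f \<in> borel_measurable (Gamma W a) \<and> integrable (Gamma W a) (\<lambda>x. (f x)\<^sup>2)"

definition Fa :: "(real^'n) set \<Rightarrow> (real^'n \<Rightarrow> real) \<Rightarrow> (real^'n \<Rightarrow> real) set" where
  "Fa W a = {f. H12e W f \<and> L2G W a f}"

definition ipG :: "(real^'n) set \<Rightarrow> (real^'n \<Rightarrow> real) \<Rightarrow> (real^'n \<Rightarrow> real) \<Rightarrow> (real^'n \<Rightarrow> real) \<Rightarrow> real" where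
  "ipG W a f h = integral\<^sup>L (Gamma W a) (\<lambda>x. f x * h x)"

text \<open>f solves (L - lam) f = g, L the self-adjoint operator associated with the form (D, F^a)
  on L^2(W, Gamma[a]) (weak formulation: f in F^a and D(f,h) - lam <f,h> = <g,h> for all h in F^a).\<close>
definition solves :: "(real^'n) set \<Rightarrow> (real^'n \<Rightarrow> real) \<Rightarrow> real \<Rightarrow> (real^'n \<Rightarrow> real) \<Rightarrow> (real^'n \<Rightarrow> real) \<Rightarrow> bool" where
  "solves W a lam g f \<longleftrightarrow> f \<in> Fa W a \<and>
     (\<forall>h\<in>Fa W a. DirE2 W f h - lam * ipG W a f h = ipG W a g h)"

text \<open>Real resolvent set: L - lam is a bijection from its domain onto L^2 (modulo Gamma-a.e. equality)
  with bounded inverse.\<close>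
definition resolvent :: "(real^'n) set \<Rightarrow> (real^'n \<Rightarrow> real) \<Rightarrow> real set" where
  "resolvent W a = {lam. (\<forall>g. L2G W a g \<longrightarrow> (\<exists>f. solves W a lam g f)) \<and>
     (\<forall>g f1 f2. L2G W a g \<and> solves W a lam g f1 \<and> solves W a lam g f2 \<longrightarrow>
                 (AE x in Gamma W a. f1 x = f2 x)) \<and>
     (\<exists>C. \<forall>g f. L2G W a g \<and> solves W a lam g f \<longrightarrow>
                 (integral\<^sup>L (Gamma W a) (\<lambda>x. (f x)\<^sup>2)) \<le> C * (integral\<^sup>L (Gamma W a) (\<lambda>x. (g x)\<^sup>2)))}"

text \<open>Spectrum Sp(D, F^a) (it is a subset of the reals since the operator is self-adjoint).\<close>
definition spec :: "(real^'n) set \<Rightarrow> (real^'n \<Rightarrow> real) \<Rightarrow> real set" where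
  "spec W a = - resolvent W a"

text \<open>mu_1(W,a) = inf (Sp \ {0}), valued in the extended reals (inf of the empty set = +infinity).\<close>
definition mu1 :: "(real^'n) set \<Rightarrow> (real^'n \<Rightarrow> real) \<Rightarrow> ereal" where
  "mu1 W a = Inf (ereal ` (spec W a - {0}))"

text \<open>Dg is the weak differential of g (row i = weak gradient of the i-th component),
  so g in H^{1,1}_loc(U); J_g = det Dg in L^1_loc of constant sign; and
  ||g'(x)|| <= K' |J_g(x)|^(1/n) a.e.\<close>
definition bounded_distortion :: "(real^'n) set \<Rightarrow> (real^'n \<Rightarrow> real^'n) \<Rightarrow> bool" where
  "bounded_distortion U g \<longleftrightarrow> (\<exists>Dg :: real^'n \<Rightarrow> real^'n^'n.
     (\<forall>i. weak_grad U (\<lambda>x. g x $ i) (\<lambda>x. Dg x $ i)) \<and>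
     L1loc U (\<lambda>x. det (Dg x)) \<and>
     ((AE x in lebesgue_on U. det (Dg x) \<ge> 0) \<or> (AE x in lebesgue_on U. det (Dg x) \<le> 0)) \<and>
     (\<exists>K'. AE x in lebesgue_on U.
        onorm (\<lambda>v. Dg x *v v) \<le> K' * \<bar>det (Dg x)\<bar> powr (1 / real CARD('n))))"

definition quasiconformal :: "(real^'n) set \<Rightarrow> (real^'n \<Rightarrow> real^'n) \<Rightarrow> bool" where
  "quasiconformal U g \<longleftrightarrow> (\<exists>h. homeomorphism U (g ` U) g h) \<and> bounded_distortion U g"

end

(* The map \<gamma> is a local homeomorphism, so by Sard's theorem the points where J_\<gamma> does not vanish are
   dense, and by continuity it suffices to compare, at such a point, the norms of \<gamma>'\<^sup>T u and \<gamma>'\<^sup>T z for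
   unit vectors u and z. Take A with \<gamma>(A) a small ball of radius l and a(y) = u \<bullet> y. The Poincare inequality
   gives \<mu>\<^sub>1(\<gamma>(A), a) \<ge> c / l\<^sup>2, so the hypothesis produces a spectral gap of order 1 / l\<^sup>2 for the form on A
   with weight |\<gamma>'\<^sup>T u|\<^sup>2, hence a Poincare inequality on A; the test function z \<bullet> \<gamma> has energy of order
   |\<gamma>'\<^sup>T z|\<^sup>2 |A| and oscillation of order l, which yields |\<gamma>'\<^sup>T u| \<le> C |\<gamma>'\<^sup>T z|. *)

theory Submission
  imports Defs
begin

section \<open>Smooth test functions\<close>

text \<open>The difficulty sits in the word "hence". About \<open>A\<close> only openness,
  boundedness and connectedness are used: no boundary regularity, no compact embedding, no
  discreteness of the spectrum. From a lower bound on \<open>mu1\<close> one learns just that the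
  nonzero reals below it lie in \<open>resolvent\<close>. So the gap is turned into a Poincare
  inequality with resolvents alone. A norm bound at the midpoint of the gap (0, R) gives
  \<open>R * ip y y \<le> D y y\<close> for y in the range of the operator L of the form, and the
  projection to the kernel is reached as the limit of \<delta> (L + \<delta>)^-1 f. That limit has
  zero energy, so it is constant on the connected set \<open>A\<close>.

  A second obstacle is the form itself: \<open>H12e\<close> asks for some approximating sequence and
  \<open>DirE\<close> selects one by choice. Local Poincare inequalities on balls show that every
  such sequence produces the weak gradient of its limit. On a bounded open set with weight pinched
  between positive constants, the form domain is therefore \<open>H12\<close> and the form is the
  usual Dirichlet integral.

  Balls are placed in the image because the explicit spectral bound is needed there; there |grad a|
  = 1, so \<open>Gamma\<close> is Lebesgue measure.\<close>

lemma tendsto_power_poly_exp_at_top: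
  "((\<lambda>s. s ^ k * poly p s * exp (- s)) \<longlongrightarrow> (0::real)) at_top"
proof (induction p arbitrary: k)
  case 0
  then show ?case by simp
next
  case (pCons a p)
  have "((\<lambda>s::real. s ^ k * exp (- s)) \<longlongrightarrow> 0) at_top"
    using tendsto_power_div_exp_0[of k] by (simp add: exp_minus divide_inverse)
  then have "((\<lambda>s. a * (s ^ k * exp (- s)) + s ^ Suc k * poly p s * exp (- s)) \<longlongrightarrow> a * 0 + 0) at_top"
    by (intro tendsto_intros pCons.IH)
  then show ?case
    by (simp add: algebra_simps)
qed

text \<open>Extended by zero to \<open>t \<le> 0\<close>, these functions form a family closed under
  differentiation, so one derivative computation covers all derivatives of exp (-1/t).\<close>

definition flat :: "real poly \<Rightarrow> real \<Rightarrow> real" where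
  "flat p t = (if t > 0 then poly p (1 / t) * exp (- (1 / t)) else 0)"

text \<open>By the chain rule p(1/t) exp(-1/t) has derivative (p - p')(1/t) exp(-1/t) / t^2; the
  factor \<open>[:0, 0, 1:]\<close> is the 1/t^2.\<close>

lemma flat_has_derivative:
  "(flat p has_real_derivative flat ([:0, 0, 1:] * (p - pderiv p)) t) (at t)"
proof (cases t "0::real" rule: linorder_cases)
  case less
  have "((\<lambda>_. 0) has_real_derivative 0) (at t)" by simp
  then have "(flat p has_real_derivative 0) (at t)"
    by (rule has_field_derivative_transform_within_open[where S="{..<0}"]) (use less in \<open>auto simp: flat_def\<close>)
  then show ?thesis using less by (simp add: flat_def)
next
  case equal
  have right: "((\<lambda>h. flat p h / h) \<longlongrightarrow> 0) (at_right 0)"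
  proof -
    \<comment> \<open>With s = 1/h the difference quotient at 0 is s p(s) exp(-s), hence the power
      of \<open>s\<close> in the limit lemma.\<close>
    have "((\<lambda>h. (inverse h) ^ 1 * poly p (inverse h) * exp (- (inverse h))) \<longlongrightarrow> (0::real)) (at_right 0)"
      by (rule filterlim_compose[OF tendsto_power_poly_exp_at_top filterlim_inverse_at_top_right])
    then show ?thesis
      by (rule Lim_transform_eventually)
        (auto simp: flat_def eventually_at_right_less divide_simps eventually_at_filter intro!: always_eventually)
  qed
  have left: "((\<lambda>h. flat p h / h) \<longlongrightarrow> 0) (at_left 0)"
    by (rule tendsto_eventually) (auto simp: flat_def eventually_at_filter)
  have "((\<lambda>h. flat p h / h) \<longlongrightarrow> 0) (at 0)"
    using left right by (simp add: filterlim_split_at)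
  then show ?thesis using equal by (simp add: DERIV_def flat_def)
next
  case greater
  have "((\<lambda>t. poly p (1 / t) * exp (- (1 / t))) has_real_derivative
       flat ([:0, 0, 1:] * (p - pderiv p)) t) (at t)"
    using greater
    by (auto intro!: derivative_eq_intros simp: flat_def field_simps power2_eq_square)
  then show ?thesis
    by (rule has_field_derivative_transform_within_open[where S="{0<..}"]) (use greater in \<open>auto simp: flat_def\<close>)
qed

fun Dk :: "nat \<Rightarrow> (real \<Rightarrow> real) \<Rightarrow> bool" where
  "Dk 0 g \<longleftrightarrow> continuous_on UNIV g"
| "Dk (Suc k) g \<longleftrightarrow> (\<exists>g'. (\<forall>t. (g has_real_derivative g' t) (at t)) \<and> Dk k g')"

lemma Dk_flat: "Dk k (flat p)"
proof (induction k arbitrary: p)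
  case 0
  then show ?case
    using flat_has_derivative DERIV_isCont by (force simp: continuous_on_eq_continuous_at)
next
  case (Suc k)
  then show ?case using flat_has_derivative by auto
qed

lemma Dk_imp_continuous: "Dk k g \<Longrightarrow> continuous_on UNIV g"
  by (cases k) (auto simp: continuous_on_eq_continuous_at intro: DERIV_isCont)

section \<open>Partial derivatives and the stability of the classes \<open>Ck\<close>\<close>

lemma partial_eqI: "(\<phi> has_derivative \<phi>') (at x) \<Longrightarrow> partial \<phi> i x = \<phi>' (axis i 1)"
  unfolding partial_def using frechet_derivative_at by metis

lemma Ck_continuous: "Ck k \<phi> \<Longrightarrow> continuous_on UNIV \<phi>"
  by (cases k) auto

lemma Ck_Suc_imp: "Ck (Suc k) \<phi> \<Longrightarrow> Ck k \<phi>"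
  by (induction k arbitrary: \<phi>) auto

text \<open>The shape \<open>e * g (c * x $ i + d)\<close> is stable: a partial derivative replaces
  \<open>e\<close> by \<open>e * c\<close> or 0 and \<open>g\<close> by its derivative, so the
  induction varies both \<open>g\<close> and \<open>e\<close>.\<close>

lemma Ck_coordinate:
  "Dk k g \<Longrightarrow> Ck k (\<lambda>x::real^'n. e * g (c * x $ i + d))"
proof (induction k arbitrary: g e)
  case 0
  then show ?case
    by (auto intro!: continuous_intros continuous_on_compose2[of UNIV g])
next
  case (Suc k)
  then obtain g' where g': "\<And>t. (g has_real_derivative g' t) (at t)" "Dk k g'" by auto
  have der: "((\<lambda>x::real^'n. e * g (c * x $ i + d)) has_derivative
      (\<lambda>h. e * (g' (c * x $ i + d) * (c * h $ i)))) (at x)" for x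
  proof -
    have 1: "((\<lambda>x::real^'n. c * x $ i + d) has_derivative (\<lambda>h. c * h $ i)) (at x)"
      by (auto intro!: derivative_eq_intros bounded_linear.has_derivative[OF bounded_linear_vec_nth])
    show ?thesis
      using has_derivative_mult_right[OF has_derivative_compose[OF 1 g'(1)[unfolded has_field_derivative_def]]]
      by simp
  qed
  have "partial (\<lambda>x::real^'n. e * g (c * x $ i + d)) j
      = (\<lambda>x. (e * c * (if i = j then 1 else 0)) * g' (c * x $ i + d))" for j
    by (rule ext, subst partial_eqI[OF der]) (auto simp: axis_def)
  then show ?case
    using Suc.IH[OF g'(2)] der Dk_imp_continuous[OF Suc.prems]
    by (auto simp: differentiable_def intro!: continuous_intros continuous_on_compose2[of UNIV g])
qed

lemma Ck_const: "Ck k (\<lambda>x::real^'n. c)"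
proof -
  have "Dk k (\<lambda>_. d)" for d
  proof (induction k arbitrary: d)
    case (Suc k)
    have "\<forall>t. ((\<lambda>_. d) has_real_derivative 0) (at t)" by simp
    then show ?case using Suc[of 0] by (auto intro!: exI[of _ "\<lambda>_. 0"])
  qed auto
  from Ck_coordinate[of k "\<lambda>_. 1" c 0 _ 0, OF this] show ?thesis by simp
qed

lemma has_derivative_partial:
  fixes \<phi> :: "real^'n \<Rightarrow> real"
  assumes "\<phi> differentiable at x"
  shows "(\<phi> has_derivative (\<lambda>h. \<Sum>i\<in>UNIV. h $ i * partial \<phi> i x)) (at x)"
proof -
  have 1: "(\<phi> has_derivative frechet_derivative \<phi> (at x)) (at x)"
    using assms frechet_derivative_works by blast
  have "frechet_derivative \<phi> (at x) h = (\<Sum>i\<in>UNIV. h $ i * partial \<phi> i x)" for h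
  proof -
    have lin: "linear (frechet_derivative \<phi> (at x))" using 1 has_derivative_linear by blast
    have "frechet_derivative \<phi> (at x) h = frechet_derivative \<phi> (at x) (\<Sum>i\<in>UNIV. h $ i *\<^sub>R axis i 1)"
      using basis_expansion[of h] by (simp add: scalar_mult_eq_scaleR)
    also have "\<dots> = (\<Sum>i\<in>UNIV. h $ i *\<^sub>R frechet_derivative \<phi> (at x) (axis i 1))"
      using lin by (simp add: linear_sum linear_cmul o_def)
    finally show ?thesis by (simp add: partial_def)
  qed
  then show ?thesis using 1 by (metis (no_types, lifting) ext)
qed

lemma partial_add:
  assumes "\<phi> differentiable at x" "\<psi> differentiable at x"
  shows "partial (\<lambda>x. \<phi> x + \<psi> x) i x = partial \<phi> i x + partial \<psi> i x"
  using assms unfolding frechet_derivative_works partial_def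
  by (metis has_derivative_add frechet_derivative_at)

lemma partial_mult:
  assumes "\<phi> differentiable at x" "\<psi> differentiable at x"
  shows "partial (\<lambda>x. \<phi> x * \<psi> x) i x = \<phi> x * partial \<psi> i x + partial \<phi> i x * \<psi> x"
  using partial_eqI[OF has_derivative_mult[OF assms[unfolded frechet_derivative_works]]]
  by (simp add: partial_def)

lemma Ck_add: "Ck k \<phi> \<Longrightarrow> Ck k \<psi> \<Longrightarrow> Ck k (\<lambda>x. \<phi> x + \<psi> x)"
proof (induction k arbitrary: \<phi> \<psi>)
  case 0
  then show ?case by (auto intro: continuous_intros)
next
  case (Suc k)
  then have "partial (\<lambda>x. \<phi> x + \<psi> x) i = (\<lambda>x. partial \<phi> i x + partial \<psi> i x)" for i
    by (intro ext partial_add) auto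
  with Suc show ?case by (auto intro: continuous_intros)
qed

lemma Ck_mult: "Ck k \<phi> \<Longrightarrow> Ck k \<psi> \<Longrightarrow> Ck k (\<lambda>x. \<phi> x * \<psi> x)"
proof (induction k arbitrary: \<phi> \<psi>)
  case 0
  then show ?case by (auto intro: continuous_intros)
next
  case (Suc k)
  then have "partial (\<lambda>x. \<phi> x * \<psi> x) i = (\<lambda>x. \<phi> x * partial \<psi> i x + partial \<phi> i x * \<psi> x)" for i
    by (intro ext partial_mult) auto
  moreover have "Ck k \<phi>" "Ck k \<psi>" using Suc.prems Ck_Suc_imp by auto
  ultimately show ?case using Suc by (auto intro: continuous_intros intro!: Ck_add)
qed

lemma Ck_prod: "finite I \<Longrightarrow> (\<And>i. i \<in> I \<Longrightarrow> Ck k (\<phi> i)) \<Longrightarrow> Ck k (\<lambda>x. \<Prod>i\<in>I. \<phi> i x)"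
  by (induction I rule: finite_induct) (auto intro: Ck_const Ck_mult)

lemma partial_translate:
  "partial (\<lambda>x. \<phi> (x - h)) i x = partial \<phi> i (x - h)" if "\<phi> differentiable at (x - h)"
proof -
  have "(\<phi> has_derivative frechet_derivative \<phi> (at (x - h))) (at (x - h))"
    using that frechet_derivative_works by blast
  moreover have "((\<lambda>x. x - h) has_derivative (\<lambda>x. x)) (at x)"
    by (auto intro!: derivative_eq_intros)
  ultimately have "((\<lambda>x. \<phi> (x - h)) has_derivative frechet_derivative \<phi> (at (x - h))) (at x)"
    using has_derivative_compose[of "\<lambda>x. x - h" "\<lambda>x. x" x UNIV \<phi> "frechet_derivative \<phi> (at (x - h))"]
    by simp
  then show ?thesis by (metis partial_def partial_eqI)
qed

lemma Ck_translate: "Ck k \<phi> \<Longrightarrow> Ck k (\<lambda>x. \<phi> (x - h))"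
proof (induction k arbitrary: \<phi>)
  case 0
  then show ?case by (auto intro!: continuous_intros continuous_on_compose2[of UNIV \<phi>])
next
  case (Suc k)
  then have "partial (\<lambda>x. \<phi> (x - h)) i = (\<lambda>x. partial \<phi> i (x - h))" for i
    by (intro ext partial_translate) auto
  moreover have "(\<lambda>x. \<phi> (x - h)) differentiable at x" for x
    using Suc.prems differentiable_chain_at[of "\<lambda>x. x - h" x \<phi>] by (auto simp: o_def)
  ultimately show ?case using Suc
    by (auto intro!: continuous_intros continuous_on_compose2[of UNIV \<phi>])
qed

section \<open>Test functions, their supports and their translates\<close>

lemma test_fun_smooth: "test_fun W \<phi> \<Longrightarrow> Ck k \<phi>"
  by (auto simp: test_fun_def smooth_def)

lemma test_fun_differentiable: "test_fun W \<phi> \<Longrightarrow> \<phi> differentiable at x"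
  using test_fun_smooth[of W \<phi> 1] by simp

lemma test_fun_continuous: "test_fun W \<phi> \<Longrightarrow> continuous_on S \<phi>"
  using Ck_continuous[OF test_fun_smooth[of W \<phi> 0]] continuous_on_subset by blast

lemma test_fun_partial_continuous: "test_fun W \<phi> \<Longrightarrow> continuous_on S (partial \<phi> i)"
  using test_fun_smooth[of W \<phi> 1] continuous_on_subset[of UNIV "partial \<phi> i"] by simp

lemma test_fun_mono: "test_fun V \<phi> \<Longrightarrow> V \<subseteq> W \<Longrightarrow> test_fun W \<phi>"
  by (auto simp: test_fun_def)

lemma test_fun_eq_0: "test_fun W \<phi> \<Longrightarrow> x \<notin> W \<Longrightarrow> \<phi> x = 0"
  using closure_subset[of "{x. \<phi> x \<noteq> 0}"] by (auto simp: test_fun_def)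

lemma partial_eq_0:
  assumes "x \<notin> closure {x. \<phi> x \<noteq> 0}" shows "partial \<phi> i x = 0"
proof -
  have "((\<lambda>_. 0) has_derivative (\<lambda>_. 0)) (at x)" by simp
  then have "(\<phi> has_derivative (\<lambda>_. 0)) (at x)"
    by (rule has_derivative_transform_within_open[where s="- closure {x. \<phi> x \<noteq> 0}"])
      (use assms closure_subset[of "{x. \<phi> x \<noteq> 0}"] in auto)
  then show ?thesis by (simp add: partial_eqI)
qed

lemma test_fun_partial_eq_0: "test_fun W \<phi> \<Longrightarrow> x \<notin> W \<Longrightarrow> partial \<phi> i x = 0"
  by (rule partial_eq_0) (auto simp: test_fun_def)

lemma support_translate:
  "closure {x. \<phi> (x - h) \<noteq> (0::real)} = (\<lambda>x. h + x) ` closure {x::real^'n. \<phi> x \<noteq> 0}"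
proof -
  have "{x. \<phi> (x - h) \<noteq> 0} = (\<lambda>x. h + x) ` {x. \<phi> x \<noteq> 0}"
  proof (intro equalityI subsetI)
    fix x assume "x \<in> {x. \<phi> (x - h) \<noteq> 0}"
    then have "x - h \<in> {x. \<phi> x \<noteq> 0}" "x = h + (x - h)" by auto
    then show "x \<in> (\<lambda>x. h + x) ` {x. \<phi> x \<noteq> 0}" by (rule rev_image_eqI)
  qed auto
  then show ?thesis by (simp add: closure_translation)
qed

lemma test_fun_translate:
  assumes "test_fun V \<phi>" "(\<lambda>x. h + x) ` V \<subseteq> W"
  shows "test_fun W (\<lambda>x. \<phi> (x - h))"
  using assms unfolding test_fun_def support_translate smooth_def
  by (auto intro: Ck_translate compact_translation)

text \<open>Each factor is a smooth cutoff at one face of the box, since \<open>flat 1 t\<close> is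
  exp (-1/t) for positive t. Scaling the argument by \<open>k\<close> pushes the factors to 1
  inside, so the bumps converge pointwise to the indicator of \<open>box a b\<close> while staying
  between 0 and 1.\<close>

definition bump :: "real^'n \<Rightarrow> real^'n \<Rightarrow> nat \<Rightarrow> real^'n \<Rightarrow> real" where
  "bump a b k x = (\<Prod>i\<in>UNIV. flat 1 (k * (x $ i - a $ i)) * flat 1 (k * (b $ i - x $ i)))"

lemma bump_eq_0: "x \<notin> box a b \<Longrightarrow> bump a b k x = 0"
proof -
  assume "x \<notin> box a b"
  then obtain i where "\<not> (a $ i < x $ i \<and> x $ i < b $ i)" by (auto simp: mem_box_cart)
  then show ?thesis unfolding bump_def
    by (intro prod_zero bexI[of _ i]) (auto simp: flat_def zero_less_mult_iff)
qed

lemma bump_bounds: "0 \<le> bump a b k x \<and> bump a b k x \<le> 1"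
proof -
  have "0 \<le> flat 1 t \<and> flat 1 t \<le> 1" for t by (auto simp: flat_def)
  then show ?thesis unfolding bump_def
    by (intro conjI prod_nonneg prod_le_1) (auto intro: mult_le_one)
qed

lemma bump_tendsto: "(\<lambda>k. bump a b k x) \<longlonglongrightarrow> indicator (box a b) x"
proof (cases "x \<in> box a b")
  case True
  have 1: "(\<lambda>k. flat 1 (real k * c)) \<longlonglongrightarrow> 1" if "c > 0" for c
  proof -
    have "(\<lambda>k. exp (- (1 / c * (1 / real k)))) \<longlonglongrightarrow> exp (- (1 / c * 0))"
      by (intro tendsto_intros lim_1_over_n)
    moreover have "\<forall>\<^sub>F k in sequentially. exp (- (1 / c * (1 / real k))) = flat 1 (real k * c)"
      using eventually_gt_at_top[of "0::nat"] by eventually_elim (use that in \<open>auto simp: flat_def field_simps\<close>)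
    ultimately show ?thesis using Lim_transform_eventually by fastforce
  qed
  have "(\<lambda>k. bump a b k x) \<longlonglongrightarrow> (\<Prod>i\<in>(UNIV::'a set). 1 * 1)"
    unfolding bump_def by (intro tendsto_intros 1) (use True in \<open>auto simp: mem_box_cart\<close>)
  then show ?thesis using True by simp
qed (simp add: bump_eq_0)

lemma test_fun_bump: 
  assumes "cbox a b \<subseteq> W" shows "test_fun W (bump a b k)"
proof -
  have "Ck m (bump a b k)" for m
  proof -
    have "Ck m (\<lambda>x. flat 1 (k * (x $ i - a $ i)) * flat 1 (k * (b $ i - x $ i)))" for i
      using Ck_mult[OF Ck_coordinate[OF Dk_flat[of m 1], of 1 k i "- k * a $ i"]
          Ck_coordinate[OF Dk_flat[of m 1], of 1 "-k" i "k * b $ i"]]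
      by (simp add: algebra_simps)
    then show ?thesis unfolding bump_def by (intro Ck_prod) auto
  qed
  moreover have "closure {x. bump a b k x \<noteq> 0} \<subseteq> cbox a b"
    using bump_eq_0 box_subset_cbox by (intro closure_minimal) blast+
  ultimately show ?thesis
    using assms bounded_subset[OF bounded_cbox] by (auto simp: test_fun_def smooth_def compact_eq_bounded_closed)
qed

section \<open>The fundamental lemma of the calculus of variations\<close>

lemma lebesgue_on_integrable:
  fixes f :: "'a::euclidean_space \<Rightarrow> real"
  assumes "S \<in> sets lebesgue"
  shows "integrable (lebesgue_on S) f \<longleftrightarrow> integrable lebesgue (\<lambda>x. indicator S x * f x)"
  using integrable_restrict_space[of S lebesgue f] assms by simp

lemma lebesgue_on_integral:
  fixes f :: "'a::euclidean_space \<Rightarrow> real"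
  assumes "S \<in> sets lebesgue"
  shows "integral\<^sup>L (lebesgue_on S) f = integral\<^sup>L lebesgue (\<lambda>x. indicator S x * f x)"
  using integral_restrict_space[of S lebesgue f] assms by simp

lemma lebesgue_on_measurable:
  fixes f :: "'a::euclidean_space \<Rightarrow> real"
  assumes "S \<in> sets lebesgue"
  shows "f \<in> borel_measurable (lebesgue_on S) \<longleftrightarrow> (\<lambda>x. indicator S x * f x) \<in> borel_measurable lebesgue"
  using borel_measurable_restrict_space_iff[of S lebesgue f] assms by simp

lemma lebesgue_on_AE:
  assumes "S \<in> sets lebesgue"
  shows "(AE x in lebesgue_on S. P x) \<longleftrightarrow> (AE x in lebesgue. x \<in> S \<longrightarrow> P x)"
  using assms by (simp add: AE_restrict_space_iff)

lemma open_sets_lebesgue: "open S \<Longrightarrow> S \<in> sets lebesgue"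
  by (simp add: borel_open)

lemma compact_sets_lebesgue: "compact (S :: 'a::euclidean_space set) \<Longrightarrow> S \<in> sets lebesgue"
  by (simp add: borel_compact)

lemma integrable_lebesgue_on_subset:
  fixes f :: "'a::euclidean_space \<Rightarrow> real"
  assumes "integrable (lebesgue_on T) f" "S \<subseteq> T" "S \<in> sets lebesgue" "T \<in> sets lebesgue"
  shows "integrable (lebesgue_on S) f"
proof -
  have "integrable lebesgue (\<lambda>x. indicator S x *\<^sub>R (indicator T x * f x))"
    using assms by (intro integrable_mult_indicator) (auto simp: lebesgue_on_integrable)
  moreover have "(\<lambda>x. indicator S x *\<^sub>R (indicator T x * f x)) = (\<lambda>x. indicator S x * f x)"
    using assms(2) by (auto simp: indicator_def fun_eq_iff)
  ultimately show ?thesis using assms by (simp add: lebesgue_on_integrable)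
qed

text \<open>The densities given by the positive and the negative part of \<open>F\<close> define two
  measures that agree on boxes. Boxes are stable under intersection and generate the Borel sets, so
  the measures coincide, and then so do their densities.\<close>

lemma AE_zero_if_box_integrals_zero_lborel:
  fixes F :: "'a::euclidean_space \<Rightarrow> real"
  assumes int: "integrable lborel F"
    and zero: "\<And>a b. (\<integral>x. indicator (box a b) x * F x \<partial>lborel) = 0"
  shows "AE x in lborel. F x = 0"
proof -
  have [measurable]: "F \<in> borel_measurable borel" using int by auto
  let ?N = "\<lambda>F. density lborel (\<lambda>x. ennreal (F x))"
  \<comment> \<open>\<open>ennreal\<close> clips negative values, so this density belongs to the
    positive part of \<open>G\<close>.\<close>
  have em: "emeasure (?N G) A = ennreal (\<integral>x. indicator A x * max 0 (G x) \<partial>lborel)"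
    if "integrable lborel G" "A \<in> sets borel" for G :: "'a \<Rightarrow> real" and A
  proof -
    have [measurable]: "G \<in> borel_measurable borel" "A \<in> sets borel" using that by auto
    have i: "integrable lborel (\<lambda>x. indicator A x *\<^sub>R max 0 (G x))"
      by (intro integrable_mult_indicator integrable_max that) auto
    have "emeasure (?N G) A = (\<integral>\<^sup>+x. ennreal (indicator A x * max 0 (G x)) \<partial>lborel)"
      by (subst emeasure_density) (auto intro!: nn_integral_cong split: split_indicator simp: max_def ennreal_neg)
    also have "\<dots> = ennreal (\<integral>x. indicator A x * max 0 (G x) \<partial>lborel)"
      using i by (subst nn_integral_eq_integral) auto
    finally show ?thesis .
  qed
  have "?N F = ?N (\<lambda>x. - F x)"
  proof (rule measure_eqI_generator_eq)
    show "Int_stable (range (\<lambda>(a, b). box a b :: 'a set))"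
      by (auto simp: Int_stable_def box_Int_box)
    show "sets (?N F) = sigma_sets UNIV (range (\<lambda>(a, b). box a b :: 'a set))"
      "sets (?N (\<lambda>x. - F x)) = sigma_sets UNIV (range (\<lambda>(a, b). box a b :: 'a set))"
      by (simp_all add: borel_eq_box)
    fix X assume "X \<in> range (\<lambda>(a, b). box a b :: 'a set)"
    then obtain a b where X: "X = box a b" by auto
    have i1: "integrable lborel (\<lambda>x. indicator X x *\<^sub>R max 0 (F x))"
      and i2: "integrable lborel (\<lambda>x. indicator X x *\<^sub>R max 0 (- F x))"
      unfolding X by (intro integrable_mult_indicator integrable_max int; simp add: int)+
    have "(\<integral>x. indicator X x * max 0 (F x) \<partial>lborel) - (\<integral>x. indicator X x * max 0 (- F x) \<partial>lborel)
       = (\<integral>x. indicator X x * max 0 (F x) - indicator X x * max 0 (- F x) \<partial>lborel)"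
      using i1 i2 by (subst Bochner_Integration.integral_diff) auto
    also have "\<dots> = (\<integral>x. indicator X x * F x \<partial>lborel)"
      by (intro Bochner_Integration.integral_cong) (auto simp: indicator_def max_def)
    finally show "emeasure (?N F) X = emeasure (?N (\<lambda>x. - F x)) X"
      using zero[of a b] int X by (simp add: em)
  next
    show "range (\<lambda>n::nat. box (- (real n *\<^sub>R One)) (real n *\<^sub>R One) :: 'a set) \<subseteq> range (\<lambda>(a, b). box a b)"
      by auto
    show "(\<Union>n::nat. box (- (real n *\<^sub>R One)) (real n *\<^sub>R One)) = (UNIV :: 'a set)"
      by (rule UN_box_eq_UNIV)
    show "emeasure (?N F) (box (- (real n *\<^sub>R One)) (real n *\<^sub>R One)) \<noteq> \<infinity>" for n :: nat
      using int by (simp add: em)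
  qed auto
  then have "AE x in lborel. ennreal (F x) = ennreal (- F x)"
    by (intro sigma_finite_measure.density_unique[OF sigma_finite_lborel]) auto
  \<comment> \<open>At most one of \<open>F x\<close> and \<open>- F x\<close> is positive, so
    equality after clipping forces both clipped values to be 0.\<close>
  then show ?thesis
    by eventually_elim (metis ennreal_eq_0_iff ennreal_neg linorder_le_cases neg_le_0_iff_le order_antisym)
qed

text \<open>Reduction to a Borel representative: the generator argument concerns Borel sets, and a
  change on a null set affects none of the integrals.\<close>

lemma AE_zero_if_box_integrals_zero:
  fixes F :: "'a::euclidean_space \<Rightarrow> real"
  assumes int: "integrable lebesgue F"
    and zero: "\<And>a b. (\<integral>x. indicator (box a b) x * F x \<partial>lebesgue) = 0"
  shows "AE x in lebesgue. F x = 0"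
proof -
  obtain F' where F'[measurable]: "F' \<in> borel_measurable lborel" and eq: "AE x in lborel. F x = F' x"
    using completion_ex_borel_measurable_real[of F lborel] int by auto
  have eq': "AE x in lebesgue. F x = F' x" using eq by (simp add: AE_completion)
  have "integrable lebesgue F'"
    using integrable_cong_AE[OF borel_measurable_integrable[OF int] measurable_completion[OF F'] eq'] int
    by simp
  then have int': "integrable lborel F'" by (simp add: integrable_completion)
  have "(\<integral>x. indicator (box a b) x * F' x \<partial>lborel) = 0" for a b
  proof -
    have m: "F \<in> borel_measurable lebesgue" "F' \<in> borel_measurable lebesgue"
      using int measurable_completion[OF F'] by auto
    have "(\<integral>x. indicator (box a b) x * F' x \<partial>lborel) = (\<integral>x. indicator (box a b) x * F' x \<partial>lebesgue)"
      by (subst integral_completion) auto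
    also have "\<dots> = (\<integral>x. indicator (box a b) x * F x \<partial>lebesgue)"
      using m eq' by (intro integral_cong_AE)
        (auto elim!: eventually_mono intro!: borel_measurable_times borel_measurable_indicator)
    finally show ?thesis using zero by simp
  qed
  from AE_zero_if_box_integrals_zero_lborel[OF int' this]
  have "AE x in lebesgue. F' x = 0" by (simp add: AE_completion)
  with eq' show ?thesis by eventually_elim simp
qed

lemma integrable_L1loc_mult:
  assumes f: "L1loc W f" and K: "compact K" "K \<subseteq> W" and W: "open W"
    and g: "continuous_on UNIV g" "\<And>x. x \<notin> K \<Longrightarrow> g x = 0"
  shows "integrable (lebesgue_on W) (\<lambda>x. f x * g x)"
proof -
  note [simp] = compact_sets_lebesgue[OF K(1)] open_sets_lebesgue[OF W]
  have "bounded (g ` K)"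
    by (intro compact_imp_bounded compact_continuous_image K(1) continuous_on_subset[OF g(1)]) simp
  then obtain B where B: "\<And>x. x \<in> K \<Longrightarrow> \<bar>g x\<bar> \<le> B" by (auto simp: bounded_iff)
  have fK: "integrable lebesgue (\<lambda>x. indicator K x * f x)"
    using f K unfolding L1loc_def by (subst lebesgue_on_integrable[symmetric]) auto
  have "g \<in> borel_measurable lborel"
    using g(1) borel_measurable_continuous_onI by simp
  then have gm: "g \<in> borel_measurable lebesgue" by (rule measurable_completion)
  have "integrable lebesgue (\<lambda>x. (indicator K x * f x) * g x)"
  proof (rule Bochner_Integration.integrable_bound[where f="\<lambda>x. B * (indicator K x * f x)"])
    show "integrable lebesgue (\<lambda>x. B * (indicator K x * f x))" using fK by simp
    show "(\<lambda>x. (indicator K x * f x) * g x) \<in> borel_measurable lebesgue"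
      by (rule borel_measurable_times[OF borel_measurable_integrable[OF fK] gm])
    show "AE x in lebesgue. norm ((indicator K x * f x) * g x) \<le> norm (B * (indicator K x * f x))"
    proof (intro always_eventually allI)
      fix x
      have "\<bar>f x\<bar> * \<bar>g x\<bar> \<le> \<bar>B\<bar> * \<bar>f x\<bar>" if "x \<in> K"
        using B[OF that] by (metis abs_ge_self abs_ge_zero mult.commute mult_right_mono order_trans)
      then show "norm ((indicator K x * f x) * g x) \<le> norm (B * (indicator K x * f x))"
        by (auto simp: indicator_def abs_mult)
    qed
  qed
  moreover have "(\<lambda>x. (indicator K x * f x) * g x) = (\<lambda>x. indicator W x * (f x * g x))"
    using K(2) g(2) by (auto simp: indicator_def fun_eq_iff)
  ultimately show ?thesis by (simp add: lebesgue_on_integrable)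
qed

lemma test_fun_support:
  assumes "test_fun W \<phi>"
  obtains K where "compact K" "K \<subseteq> W" "\<And>x. x \<notin> K \<Longrightarrow> \<phi> x = 0" "\<And>x i. x \<notin> K \<Longrightarrow> partial \<phi> i x = 0"
proof
  show "compact (closure {x. \<phi> x \<noteq> 0})" "closure {x. \<phi> x \<noteq> 0} \<subseteq> W" using assms by (auto simp: test_fun_def)
  show "x \<notin> closure {x. \<phi> x \<noteq> 0} \<Longrightarrow> \<phi> x = 0" for x
    using closure_subset[of "{x. \<phi> x \<noteq> 0}"] by auto
qed (rule partial_eq_0)

lemma integrable_L1loc_test:
  assumes "L1loc W f" "open W" "test_fun W \<phi>"
  shows "integrable (lebesgue_on W) (\<lambda>x. f x * \<phi> x)"
    and "integrable (lebesgue_on W) (\<lambda>x. f x * partial \<phi> i x)"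
proof -
  obtain K where K: "compact K" "K \<subseteq> W" "\<And>x. x \<notin> K \<Longrightarrow> \<phi> x = 0" "\<And>x i. x \<notin> K \<Longrightarrow> partial \<phi> i x = 0"
    by (rule test_fun_support[OF assms(3)]) blast
  show "integrable (lebesgue_on W) (\<lambda>x. f x * \<phi> x)"
    and "integrable (lebesgue_on W) (\<lambda>x. f x * partial \<phi> i x)"
    using K test_fun_continuous[OF assms(3)] test_fun_partial_continuous[OF assms(3)]
    by (auto intro!: integrable_L1loc_mult[OF assms(1)] assms(2))
qed

theorem fundamental_lemma:
  assumes f: "L1loc W f" and W: "open W"
    and zero: "\<And>\<phi>. test_fun W \<phi> \<Longrightarrow> integral\<^sup>L (lebesgue_on W) (\<lambda>x. f x * \<phi> x) = 0"
  shows "AE x in lebesgue_on W. f x = 0"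
proof -
  note [simp] = open_sets_lebesgue[OF W]
  have fm: "(\<lambda>x. indicator W x * f x) \<in> borel_measurable lebesgue"
    using f by (simp add: L1loc_def lebesgue_on_measurable)
  have int: "integrable lebesgue (\<lambda>x. indicator (cbox a b) x * f x)" if "cbox a b \<subseteq> W" for a b
    using f that unfolding L1loc_def by (subst lebesgue_on_integrable[symmetric]) auto
  have box0: "(\<integral>x. indicator (box a b) x * f x \<partial>lebesgue) = 0" if ab: "cbox a b \<subseteq> W" for a b
  proof -
    \<comment> \<open>Dominated convergence: the bumps are supported in the compact box
      \<open>cbox a b\<close>, on which \<open>f\<close> is integrable.\<close>
    have "(\<lambda>k. \<integral>x. (indicator W x * f x) * bump a b k x \<partial>lebesgue)
        \<longlonglongrightarrow> (\<integral>x. (indicator W x * f x) * indicator (box a b) x \<partial>lebesgue)"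
    proof (rule integral_dominated_convergence[where w="\<lambda>x. norm (indicator (cbox a b) x * f x)"])
      show "integrable lebesgue (\<lambda>x. norm (indicator (cbox a b) x * f x))" using int[OF ab] by (rule integrable_norm)
      show "AE x in lebesgue. (\<lambda>k. (indicator W x * f x) * bump a b k x) \<longlonglongrightarrow> (indicator W x * f x) * indicator (box a b) x"
        by (intro always_eventually allI tendsto_intros bump_tendsto)
      have "bump a b k \<in> borel_measurable lborel" for k
        using borel_measurable_continuous_onI[OF test_fun_continuous[OF test_fun_bump[OF ab]]] by simp
      then show "(\<lambda>x. (indicator W x * f x) * bump a b k x) \<in> borel_measurable lebesgue" for k
        by (intro borel_measurable_times[OF fm] measurable_completion)
      show "AE x in lebesgue. norm ((indicator W x * f x) * bump a b k x) \<le> norm (indicator (cbox a b) x * f x)" for k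
      proof (intro always_eventually allI)
        fix x
        have "x \<notin> cbox a b \<Longrightarrow> bump a b k x = 0" using bump_eq_0 box_subset_cbox by blast
        moreover have "\<bar>f x\<bar> * \<bar>bump a b k x\<bar> \<le> \<bar>f x\<bar>"
          using bump_bounds[of a b k x] by (simp add: mult_left_le)
        ultimately show "norm ((indicator W x * f x) * bump a b k x) \<le> norm (indicator (cbox a b) x * f x)"
          by (auto simp: indicator_def abs_mult)
      qed
    qed (intro borel_measurable_times[OF fm] borel_measurable_indicator, simp)
    moreover have "(\<integral>x. (indicator W x * f x) * bump a b k x \<partial>lebesgue) = 0" for k
      using zero[OF test_fun_bump[OF ab], of k] by (simp add: lebesgue_on_integral mult.assoc)
    ultimately have "(\<integral>x. (indicator W x * f x) * indicator (box a b) x \<partial>lebesgue) = 0"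
      by (simp add: LIMSEQ_const_iff)
    moreover have "(\<lambda>x. (indicator W x * f x) * indicator (box a b) x) = (\<lambda>x. indicator (box a b) x * f x)"
      using ab box_subset_cbox[of a b] by (auto simp: indicator_def fun_eq_iff)
    ultimately show ?thesis by simp
  qed
  have cb: "AE x in lebesgue. x \<in> cbox a b \<longrightarrow> f x = 0" if ab: "cbox a b \<subseteq> W" for a b
  proof -
    have "integrable lebesgue (\<lambda>x. indicator (box a b) x *\<^sub>R (indicator (cbox a b) x * f x))"
      using int[OF ab] by (intro integrable_mult_indicator) auto
    moreover have "(\<lambda>x. indicator (box a b) x *\<^sub>R (indicator (cbox a b) x * f x)) = (\<lambda>x. indicator (box a b) x * f x)"
      using box_subset_cbox[of a b] by (auto simp: indicator_def fun_eq_iff)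
    ultimately have "AE x in lebesgue. indicator (box a b) x * f x = 0"
    proof (intro AE_zero_if_box_integrals_zero, simp)
      fix c d
      \<comment> \<open>The criterion tests all boxes of the space. Cutting with
        \<open>box a b\<close> yields a box whose closure is still inside \<open>W\<close>; an empty
        intersection is written as the box with reversed corners 1 and 0.\<close>
      obtain u v where uv: "box a b \<inter> box c d = box u v" "cbox u v \<subseteq> W"
      proof (cases "box a b \<inter> box c d = {}")
        case True
        have "box (1::real^'n) 0 = {}" "cbox (1::real^'n) 0 = {}"
          by (auto simp: mem_box_cart dest!: spec[of _ undefined])
        then show ?thesis using True by (intro that[of 1 0]) auto
      next
        case False
        let ?u = "\<Sum>i\<in>Basis. max (a \<bullet> i) (c \<bullet> i) *\<^sub>R i" and ?v = "\<Sum>i\<in>Basis. min (b \<bullet> i) (d \<bullet> i) *\<^sub>R i"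
        have "cbox ?u ?v \<subseteq> cbox a b" by (auto simp: mem_box)
        then show ?thesis using that[of ?u ?v] ab by (auto simp: box_Int_box)
      qed
      have "(\<lambda>x. indicator (box c d) x * (indicator (box a b) x * f x)) = (\<lambda>x. indicator (box u v) x * f x)"
        by (auto simp: uv(1)[symmetric] indicator_def fun_eq_iff)
      then show "(\<integral>x. indicator (box c d) x * (indicator (box a b) x * f x) \<partial>lebesgue) = 0"
        using box0[OF uv(2)] by simp
    qed
    \<comment> \<open>The open box misses only the faces, which are negligible.\<close>
    moreover have "AE x in lebesgue. x \<notin> cbox a b - box a b"
      by (rule AE_not_in) (use negligible_frontier_interval[of a b] in \<open>simp only: negligible_iff_null_sets\<close>)
    ultimately show ?thesis by eventually_elim (auto simp: indicator_def)
  qed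
  obtain \<D> where D: "countable \<D>" "\<D> \<subseteq> Pow W" "\<And>X. X \<in> \<D> \<Longrightarrow> \<exists>a b. X = cbox a b" "\<Union>\<D> = W"
    using open_countable_Union_open_cbox[OF W] by metis
  have "AE x in lebesgue. \<forall>X\<in>\<D>. x \<in> X \<longrightarrow> f x = 0"
    using D(1-3) cb by (subst AE_ball_countable) blast+
  then show ?thesis unfolding lebesgue_on_AE[OF open_sets_lebesgue[OF W]]
    by eventually_elim (use D(4) in auto)
qed

section \<open>Weak gradients\<close>

lemma integrable_continuous_on_compact:
  fixes f :: "'a::euclidean_space \<Rightarrow> real"
  assumes "compact K" "continuous_on K f"
  shows "integrable (lebesgue_on K) f"
proof -
  have "f absolutely_integrable_on K"
    using assms borel_integrable_compact[of K f] by (simp add: set_integrable_def integrable_completion)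
  then show ?thesis
    using compact_sets_lebesgue[OF assms(1)] by (simp add: lebesgue_on_integrable set_integrable_def)
qed

lemma L1loc_continuous:
  assumes "open W" "continuous_on W f"
  shows "L1loc W f"
  unfolding L1loc_def
proof (intro conjI allI impI)
  show "f \<in> borel_measurable (lebesgue_on W)"
    using assms by (intro continuous_imp_measurable_on_sets_lebesgue open_sets_lebesgue)
  show "integrable (lebesgue_on K) f" if "compact K \<and> K \<subseteq> W" for K
    using that assms(2) continuous_on_subset by (intro integrable_continuous_on_compact) auto
qed

lemma has_derivative_along_line:
  fixes g :: "'a::real_normed_vector \<Rightarrow> real"
  assumes "(g has_derivative g') (at (x + t *\<^sub>R e))"
  shows "((\<lambda>s. g (x + s *\<^sub>R e)) has_real_derivative g' e) (at t)"
proof -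
  have "((\<lambda>s::real. x + s *\<^sub>R e) has_derivative (\<lambda>s. s *\<^sub>R e)) (at t)"
    by (auto intro!: derivative_eq_intros)
  from has_derivative_compose[OF this assms]
  have "((\<lambda>s. g (x + s *\<^sub>R e)) has_derivative (\<lambda>s. g' (s *\<^sub>R e))) (at t)" .
  moreover have "(\<lambda>s. g' (s *\<^sub>R e)) = (*) (g' e)"
    using has_derivative_linear[OF assms] by (auto simp: linear_cmul mult.commute)
  ultimately show ?thesis by (simp add: has_field_derivative_def)
qed

text \<open>The integral is the limit of integrals of difference quotients, and each of those
  vanishes by translation invariance. With \<open>norm e \<le> 1\<close> and steps at most 1 all
  quotients live in one ball of radius \<open>r + 1\<close>; there the mean value theorem bounds
  them by the supremum of the derivative, which gives the majorant.\<close>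

lemma integral_derivative_zero:
  fixes g :: "'a::euclidean_space \<Rightarrow> real"
  assumes der: "\<And>x. (g has_derivative g' x) (at x)"
    and cont: "continuous_on UNIV (\<lambda>x. g' x e)"
    and K: "compact K" "\<And>x. x \<notin> K \<Longrightarrow> g x = 0"
    and e: "norm e \<le> 1"
  shows "(\<integral>x. g' x e \<partial>lborel) = 0"
proof -
  obtain r where "\<And>x. x \<in> K \<Longrightarrow> norm x \<le> r"
    using compact_imp_bounded[OF K(1)] by (auto simp: bounded_iff)
  then have r: "K \<subseteq> cball 0 r" by auto
  define C where "C = cball (0::'a) (r + 1)"
  have gcont: "continuous_on UNIV g"
    using der has_derivative_continuous by (force simp: continuous_on_eq_continuous_at)
  have [measurable]: "g \<in> borel_measurable borel" "(\<lambda>x. g' x e) \<in> borel_measurable borel"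
    using gcont cont borel_measurable_continuous_onI by blast+
  have "bounded ((\<lambda>x. g' x e) ` C)"
    unfolding C_def using cont continuous_on_subset compact_continuous_image compact_imp_bounded
    by (metis compact_cball subset_UNIV)
  then obtain B' where "\<And>x. x \<in> C \<Longrightarrow> \<bar>g' x e\<bar> \<le> B'" by (auto simp: bounded_iff)
  then obtain B where B: "\<And>x. x \<in> C \<Longrightarrow> \<bar>g' x e\<bar> \<le> B" and B0: "0 \<le> B"
    using that[of "max B' 0"] by (auto simp: le_max_iff_disj)
  have g'0: "g' x e = 0" if "x \<notin> C" for x
  proof -
    have "((\<lambda>_. 0) has_derivative (\<lambda>_. 0)) (at x)" by simp
    then have "(g has_derivative (\<lambda>_. 0)) (at x)"
    proof (rule has_derivative_transform_within_open[where s="- C"])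
      show "open (- C)" unfolding C_def by (intro open_Compl closed_cball)
      show "\<And>y. y \<in> - C \<Longrightarrow> 0 = g y" using K(2) r by (force simp: C_def)
    qed (use that in auto)
    then show ?thesis using der has_derivative_unique by metis
  qed
  define h where "h k = 1 / (real k + 1)" for k
  have h: "h k > 0" "h k \<le> 1" for k by (auto simp: h_def)
  have hlim: "h \<longlonglongrightarrow> 0" unfolding h_def
    using LIMSEQ_inverse_real_of_nat by (simp add: inverse_eq_divide add.commute)
  have gint: "integrable lborel g"
  proof -
    have "integrable lborel (\<lambda>x. indicator K x *\<^sub>R g x)"
      using borel_integrable_compact[OF K(1)] gcont continuous_on_subset unfolding set_integrable_def by blast
    moreover have "(\<lambda>x. indicator K x *\<^sub>R g x) = g" using K(2) by (auto simp: indicator_def fun_eq_iff)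
    ultimately show ?thesis by simp
  qed
  have shift: "integrable lborel (\<lambda>x. g (x + t))" "(\<integral>x. g (x + t) \<partial>lborel) = (\<integral>x. g x \<partial>lborel)" for t
  proof -
    have 1: "distr lborel borel ((+) t) = lborel" by (rule lborel_distr_plus)
    show "integrable lborel (\<lambda>x. g (x + t))"
      using integrable_distr[of "(+) t" lborel borel g] 1 gint by (simp add: add.commute)
    show "(\<integral>x. g (x + t) \<partial>lborel) = (\<integral>x. g x \<partial>lborel)"
      using integral_distr[of "(+) t" lborel borel g] 1 by (simp add: add.commute)
  qed
  define q where "q k x = (g (x + h k *\<^sub>R e) - g x) / h k" for k x
  have q0: "(\<integral>x. q k x \<partial>lborel) = 0" for k
    unfolding q_def using shift gint by simp
  have lim: "(\<lambda>k. q k x) \<longlonglongrightarrow> g' x e" for x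
  proof -
    have "((\<lambda>t. g (x + t *\<^sub>R e)) has_real_derivative g' x e) (at 0)"
      by (rule has_derivative_along_line) (simp add: der)
    then have "((\<lambda>t. (g (x + t *\<^sub>R e) - g x) / t) \<longlongrightarrow> g' x e) (at 0)"
      by (simp add: DERIV_def)
    moreover have "filterlim h (at 0) sequentially"
      unfolding filterlim_at using hlim h by (auto intro!: always_eventually less_imp_neq[symmetric])
    ultimately show ?thesis unfolding q_def by (rule filterlim_compose)
  qed
  have bnd: "norm (q k x) \<le> indicator C x * B" for k x
  proof -
    have deriv: "((\<lambda>t. g (x + t *\<^sub>R e)) has_real_derivative g' (x + t *\<^sub>R e) e) (at t)" for t
      by (rule has_derivative_along_line) (rule der)
    obtain t where t: "0 < t" "t < h k" "g (x + h k *\<^sub>R e) - g (x + 0 *\<^sub>R e) = (h k - 0) * g' (x + t *\<^sub>R e) e"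
      using MVT2[OF h(1)[of k], of "\<lambda>t. g (x + t *\<^sub>R e)" "\<lambda>t. g' (x + t *\<^sub>R e) e"] deriv by auto
    then have q: "q k x = g' (x + t *\<^sub>R e) e" using h(1)[of k] by (simp add: q_def)
    have "norm (q k x) \<le> B"
      using B[of "x + t *\<^sub>R e"] g'0[of "x + t *\<^sub>R e"] B0 by (cases "x + t *\<^sub>R e \<in> C") (auto simp: q)
    moreover have "q k x = 0" if "x \<notin> C"
    proof -
      have nx: "norm x > r + 1" using that by (simp add: C_def)
      have "norm (h k *\<^sub>R e) \<le> 1" using h[of k] e mult_mono[of "h k" 1 "norm e" 1] by simp
      then have "norm (x + h k *\<^sub>R e) > r" using nx norm_triangle_ineq4[of "x + h k *\<^sub>R e" "h k *\<^sub>R e"] by simp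
      then have "x + h k *\<^sub>R e \<notin> K" "x \<notin> K" using r nx by force+
      then show ?thesis using K(2) by (simp add: q_def)
    qed
    ultimately show ?thesis by (auto simp: indicator_def)
  qed
  have "(\<lambda>k. \<integral>x. q k x \<partial>lborel) \<longlonglongrightarrow> (\<integral>x. g' x e \<partial>lborel)"
  proof (rule integral_dominated_convergence[where w="\<lambda>x. indicator C x * B"])
    have "emeasure lborel C < \<infinity>" unfolding C_def by (rule emeasure_lborel_cball_finite)
    then show "integrable lborel (\<lambda>x. indicator C x * B)"
      by (intro integrable_mult_left integrable_real_indicator) (auto simp: C_def)
    show "q k \<in> borel_measurable lborel" for k unfolding q_def by measurable
  qed (use lim bnd in auto)
  then show ?thesis using q0 by (simp add: LIMSEQ_const_iff)
qed

text \<open>Integration by parts: the test function vanishes outside a compact subset of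
  \<open>W\<close>, so its product with \<open>f\<close>, extended by zero, is differentiable on the
  whole space, and the derivative of this product integrates to zero.\<close>

lemma weak_grad_C1:
  fixes f :: "real^'n \<Rightarrow> real"
  assumes W: "open W"
    and der: "\<And>x. x \<in> W \<Longrightarrow> (f has_derivative f' x) (at x)"
    and cont: "\<And>i. continuous_on W (\<lambda>x. f' x (axis i 1))"
  shows "weak_grad W f (\<lambda>x. \<chi> i. f' x (axis i 1))"
proof -
  have fc: "continuous_on W f"
    using der has_derivative_continuous by (meson continuous_at_imp_continuous_on)
  note [simp] = open_sets_lebesgue[OF W]
  have "(\<integral>x. f x * partial \<phi> i x \<partial>lebesgue_on W) = - (\<integral>x. f' x (axis i 1) * \<phi> x \<partial>lebesgue_on W)"
    if \<phi>: "test_fun W \<phi>" for \<phi> i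
  proof -
    obtain K where K: "compact K" "K \<subseteq> W" "\<And>x. x \<notin> K \<Longrightarrow> \<phi> x = 0" "\<And>x i. x \<notin> K \<Longrightarrow> partial \<phi> i x = 0"
      by (rule test_fun_support[OF \<phi>]) blast
    define g where "g x = indicator W x * (f x * \<phi> x)" for x
    define g' where "g' x h = indicator W x * (f' x h * \<phi> x + f x * frechet_derivative \<phi> (at x) h)" for x h
    have gd: "(g has_derivative g' x) (at x)" for x
    proof (cases "x \<in> W")
      case True
      have 1: "(\<phi> has_derivative frechet_derivative \<phi> (at x)) (at x)"
        using test_fun_differentiable[OF \<phi>] frechet_derivative_works by blast
      have "((\<lambda>x. f x * \<phi> x) has_derivative g' x) (at x)"
        using has_derivative_mult[OF der[OF True] 1] True
        by (auto simp: g'_def fun_eq_iff add.commute intro: has_derivative_eq_rhs)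
      then show ?thesis
        by (rule has_derivative_transform_within_open[OF _ W True]) (simp add: g_def)
    next
      case False
      have "((\<lambda>_. 0) has_derivative (\<lambda>_. 0)) (at x)" by simp
      then have "(g has_derivative (\<lambda>_. 0)) (at x)"
        by (rule has_derivative_transform_within_open[where s="- K"])
          (use K False in \<open>auto simp: g_def intro: open_Compl compact_imp_closed\<close>)
      moreover have "g' x = (\<lambda>_. 0)" using False by (simp add: g'_def fun_eq_iff)
      ultimately show ?thesis by simp
    qed
    have g'c: "continuous_on UNIV (\<lambda>x. g' x (axis i 1))"
    proof -
      have "continuous_on W (\<lambda>x. f' x (axis i 1) * \<phi> x + f x * partial \<phi> i x)"
        using fc cont test_fun_continuous[OF \<phi>] test_fun_partial_continuous[OF \<phi>] by (intro continuous_intros)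
      then have 1: "continuous_on W (\<lambda>x. g' x (axis i 1))"
        by (subst continuous_on_cong[OF refl, where g="\<lambda>x. f' x (axis i 1) * \<phi> x + f x * partial \<phi> i x"])
          (auto simp: g'_def partial_def)
      have "g' x (axis i 1) = 0" if "x \<in> - K" for x
        using K(3,4) that by (simp add: g'_def partial_def)
      then have 2: "continuous_on (- K) (\<lambda>x. g' x (axis i 1))"
        by (subst continuous_on_cong[OF refl, where g="\<lambda>x. 0"]) auto
      \<comment> \<open>\<open>W\<close> and the complement of the support are two open sets
        covering the space, so continuity on each suffices.\<close>
      have "continuous_on (W \<union> - K) (\<lambda>x. g' x (axis i 1))"
        using W K(1) compact_imp_closed by (intro continuous_on_open_Un 1 2) auto
      moreover have "W \<union> - K = UNIV" using K(2) by auto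
      ultimately show ?thesis by simp
    qed
    have "(\<integral>x. g' x (axis i 1) \<partial>lborel) = 0"
      by (rule integral_derivative_zero[OF gd g'c K(1)]) (use K(3) in \<open>auto simp: g_def\<close>)
    then have "0 = (\<integral>x. g' x (axis i 1) \<partial>lebesgue)"
      using g'c borel_measurable_continuous_onI by (subst integral_completion) auto
    also have "\<dots> = (\<integral>x. f' x (axis i 1) * \<phi> x + f x * partial \<phi> i x \<partial>lebesgue_on W)"
      by (simp add: lebesgue_on_integral g'_def partial_def)
    also have "\<dots> = (\<integral>x. f' x (axis i 1) * \<phi> x \<partial>lebesgue_on W) + (\<integral>x. f x * partial \<phi> i x \<partial>lebesgue_on W)"
      using fc cont W \<phi> by (intro Bochner_Integration.integral_add integrable_L1loc_test L1loc_continuous)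
    finally show ?thesis by simp
  qed
  then show ?thesis
    unfolding weak_grad_def using L1loc_continuous[OF W] fc cont by simp
qed

lemma L1loc_lincomb:
  assumes "L1loc W f" "L1loc W g"
  shows "L1loc W (\<lambda>x. a * f x + b * g x)"
  using assms unfolding L1loc_def by auto

lemma weak_grad_lincomb:
  fixes f g :: "real^'n \<Rightarrow> real"
  assumes "weak_grad W f F" "weak_grad W g G" "open W"
  shows "weak_grad W (\<lambda>x. a * f x + b * g x) (\<lambda>x. a *\<^sub>R F x + b *\<^sub>R G x)"
proof -
  have L: "L1loc W f" "L1loc W g" "\<And>i. L1loc W (\<lambda>x. F x $ i)" "\<And>i. L1loc W (\<lambda>x. G x $ i)"
    using assms by (auto simp: weak_grad_def)
  have "(\<integral>x. (a * f x + b * g x) * partial \<phi> i x \<partial>lebesgue_on W)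
      = - (\<integral>x. (a *\<^sub>R F x + b *\<^sub>R G x) $ i * \<phi> x \<partial>lebesgue_on W)" if "test_fun W \<phi>" for \<phi> i
  proof -
    note I = integrable_L1loc_test[OF _ assms(3) that]
    have "(\<integral>x. (a * f x + b * g x) * partial \<phi> i x \<partial>lebesgue_on W)
      = (\<integral>x. a * (f x * partial \<phi> i x) + b * (g x * partial \<phi> i x) \<partial>lebesgue_on W)"
      by (simp add: algebra_simps)
    also have "\<dots> = a * (\<integral>x. f x * partial \<phi> i x \<partial>lebesgue_on W) + b * (\<integral>x. g x * partial \<phi> i x \<partial>lebesgue_on W)"
      using I L by simp
    also have "\<dots> = - (a * (\<integral>x. F x $ i * \<phi> x \<partial>lebesgue_on W) + b * (\<integral>x. G x $ i * \<phi> x \<partial>lebesgue_on W))"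
      using assms that by (simp add: weak_grad_def)
    also have "\<dots> = - (\<integral>x. a * (F x $ i * \<phi> x) + b * (G x $ i * \<phi> x) \<partial>lebesgue_on W)"
      using I(1)[OF L(3)] I(1)[OF L(4)] by simp
    finally show ?thesis by (simp add: algebra_simps)
  qed
  moreover have "L1loc W (\<lambda>x. (a *\<^sub>R F x + b *\<^sub>R G x) $ i)" for i
    using L1loc_lincomb[OF L(3)[of i] L(4)[of i], of a b] by simp
  ultimately show ?thesis using L1loc_lincomb[OF L(1,2)] unfolding weak_grad_def by blast
qed

lemma weak_grad_unique:
  fixes f :: "real^'n \<Rightarrow> real"
  assumes "weak_grad W f F" "weak_grad W f G" "open W"
  shows "AE x in lebesgue_on W. F x = G x"
proof -
  have "AE x in lebesgue_on W. 1 * F x $ i + (-1) * G x $ i = 0" for i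
  proof (rule fundamental_lemma[OF _ assms(3)])
    have L: "L1loc W (\<lambda>x. F x $ i)" "L1loc W (\<lambda>x. G x $ i)"
      using assms by (auto simp: weak_grad_def)
    then show "L1loc W (\<lambda>x. 1 * F x $ i + (-1) * G x $ i)" by (rule L1loc_lincomb)
    fix \<phi> assume \<phi>: "test_fun W \<phi>"
    note I = integrable_L1loc_test[OF _ assms(3) \<phi>]
    have "(\<integral>x. (1 * F x $ i + (-1) * G x $ i) * \<phi> x \<partial>lebesgue_on W)
        = (\<integral>x. F x $ i * \<phi> x - G x $ i * \<phi> x \<partial>lebesgue_on W)" by (simp add: algebra_simps)
    also have "\<dots> = (\<integral>x. F x $ i * \<phi> x \<partial>lebesgue_on W) - (\<integral>x. G x $ i * \<phi> x \<partial>lebesgue_on W)"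
      using I(1)[OF L(1)] I(1)[OF L(2)] by simp
    also have "\<dots> = 0" using assms \<phi> by (simp add: weak_grad_def)
    finally show "(\<integral>x. (1 * F x $ i + (-1) * G x $ i) * \<phi> x \<partial>lebesgue_on W) = 0" .
  qed
  then have "AE x in lebesgue_on W. \<forall>i. 1 * F x $ i + (-1) * G x $ i = 0"
    by (simp add: AE_all_countable)
  then show ?thesis by eventually_elim (simp add: vec_eq_iff)
qed

lemma L1loc_mono:
  assumes "L1loc W f" "V \<subseteq> W" "open V" "open W"
  shows "L1loc V f"
  using assms measurable_restrict_mono[of f lebesgue W borel V] unfolding L1loc_def by blast

lemma weak_grad_mono:
  assumes "weak_grad W f G" "V \<subseteq> W" "open V" "open W"
  shows "weak_grad V f G"
proof -
  have "(\<integral>x. f x * partial \<phi> i x \<partial>lebesgue_on V) = - (\<integral>x. G x $ i * \<phi> x \<partial>lebesgue_on V)"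
    if \<phi>: "test_fun V \<phi>" for \<phi> i
  proof -
    have 1: "(\<integral>x. u x * \<psi> x \<partial>lebesgue_on V) = (\<integral>x. u x * \<psi> x \<partial>lebesgue_on W)"
      if "\<And>x. x \<notin> V \<Longrightarrow> \<psi> x = 0" for u \<psi> :: "_ \<Rightarrow> real"
      using that assms(2) open_sets_lebesgue[OF assms(3)] open_sets_lebesgue[OF assms(4)]
      by (simp add: lebesgue_on_integral) (intro Bochner_Integration.integral_cong, auto simp: indicator_def)
    show ?thesis
      using assms(1) test_fun_mono[OF \<phi> assms(2)] test_fun_eq_0[OF \<phi>] test_fun_partial_eq_0[OF \<phi>]
      by (simp add: 1 weak_grad_def)
  qed
  then show ?thesis using assms L1loc_mono unfolding weak_grad_def by blast
qed

text \<open>Convergence in L1 on compact subsets is enough: a test function and its partial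
  derivatives are bounded and live on one compact set, so both sides of the defining identity pass
  to the limit.\<close>

lemma weak_grad_limit:
  fixes f :: "nat \<Rightarrow> real^'n \<Rightarrow> real"
  assumes W: "open W" and wg: "\<And>k. weak_grad W (f k) (G k)"
    and L: "L1loc W g" "\<And>i. L1loc W (\<lambda>x. H x $ i)"
    and limf: "\<And>K. compact K \<Longrightarrow> K \<subseteq> W \<Longrightarrow> (\<lambda>k. \<integral>x. \<bar>f k x - g x\<bar> \<partial>lebesgue_on K) \<longlonglongrightarrow> 0"
    and limG: "\<And>K i. compact K \<Longrightarrow> K \<subseteq> W \<Longrightarrow> (\<lambda>k. \<integral>x. \<bar>G k x $ i - H x $ i\<bar> \<partial>lebesgue_on K) \<longlonglongrightarrow> 0"
  shows "weak_grad W g H"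
proof -
  have key: "(\<lambda>k. \<integral>x. u k x * \<psi> x \<partial>lebesgue_on W) \<longlonglongrightarrow> (\<integral>x. v x * \<psi> x \<partial>lebesgue_on W)"
    if u: "\<And>k. L1loc W (u k)" and v: "L1loc W v" and K: "compact K" "K \<subseteq> W"
      and lim: "(\<lambda>k. \<integral>x. \<bar>u k x - v x\<bar> \<partial>lebesgue_on K) \<longlonglongrightarrow> 0"
      and \<psi>: "continuous_on UNIV \<psi>" "\<And>x. x \<notin> K \<Longrightarrow> \<psi> x = 0"
    for u and v \<psi> :: "real^'n \<Rightarrow> real" and K
  proof -
    note [simp] = compact_sets_lebesgue[OF K(1)] open_sets_lebesgue[OF W]
    have "bounded (\<psi> ` K)"
      by (intro compact_imp_bounded compact_continuous_image K(1) continuous_on_subset[OF \<psi>(1)]) simp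
    then obtain B where B: "\<And>x. x \<in> K \<Longrightarrow> \<bar>\<psi> x\<bar> \<le> B" by (auto simp: bounded_iff)
    have iu: "integrable (lebesgue_on W) (\<lambda>x. u k x * \<psi> x)" for k
      by (rule integrable_L1loc_mult[OF u K W \<psi>])
    have iv: "integrable (lebesgue_on W) (\<lambda>x. v x * \<psi> x)"
      by (rule integrable_L1loc_mult[OF v K W \<psi>])
    have "\<bar>(\<integral>x. u k x * \<psi> x \<partial>lebesgue_on W) - (\<integral>x. v x * \<psi> x \<partial>lebesgue_on W)\<bar>
        \<le> B * (\<integral>x. \<bar>u k x - v x\<bar> \<partial>lebesgue_on K)" for k
    proof -
      have ik: "integrable (lebesgue_on K) (\<lambda>x. u k x - v x)"
        using u v K unfolding L1loc_def by auto
      have "(\<integral>x. u k x * \<psi> x \<partial>lebesgue_on W) - (\<integral>x. v x * \<psi> x \<partial>lebesgue_on W)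
          = (\<integral>x. (u k x - v x) * \<psi> x \<partial>lebesgue_on W)"
        using iu iv by (simp add: left_diff_distrib)
      also have "\<dots> = (\<integral>x. (u k x - v x) * \<psi> x \<partial>lebesgue_on K)"
        by (simp add: lebesgue_on_integral, intro Bochner_Integration.integral_cong)
          (use K \<psi> in \<open>auto simp: indicator_def\<close>)
      finally have "\<bar>(\<integral>x. u k x * \<psi> x \<partial>lebesgue_on W) - (\<integral>x. v x * \<psi> x \<partial>lebesgue_on W)\<bar>
          \<le> (\<integral>x. \<bar>(u k x - v x) * \<psi> x\<bar> \<partial>lebesgue_on K)"
        using integral_abs_bound by simp
      also have "\<dots> \<le> (\<integral>x. B * \<bar>u k x - v x\<bar> \<partial>lebesgue_on K)"
      proof (rule integral_mono_AE)
        show "integrable (lebesgue_on K) (\<lambda>x. \<bar>(u k x - v x) * \<psi> x\<bar>)"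
          using Bochner_Integration.integrable_diff[OF iu iv] K(2) integrable_lebesgue_on_subset[of W _ K]
          by (auto simp: left_diff_distrib)
        show "integrable (lebesgue_on K) (\<lambda>x. B * \<bar>u k x - v x\<bar>)" using ik by auto
        show "AE x in lebesgue_on K. \<bar>(u k x - v x) * \<psi> x\<bar> \<le> B * \<bar>u k x - v x\<bar>"
          by (intro AE_I2) (simp add: abs_mult mult.commute[of "\<bar>u k _ - v _\<bar>"] B mult_right_mono)
      qed
      finally show ?thesis using ik by simp
    qed
    then have "(\<lambda>k. (\<integral>x. u k x * \<psi> x \<partial>lebesgue_on W) - (\<integral>x. v x * \<psi> x \<partial>lebesgue_on W)) \<longlonglongrightarrow> 0"
      by (intro Lim_null_comparison[OF always_eventually tendsto_mult_right_zero[OF lim]]) auto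
    then show ?thesis by (simp add: LIM_zero_iff)
  qed
  have "(\<integral>x. g x * partial \<phi> i x \<partial>lebesgue_on W) = - (\<integral>x. H x $ i * \<phi> x \<partial>lebesgue_on W)"
    if \<phi>: "test_fun W \<phi>" for \<phi> i
  proof -
    obtain K where K: "compact K" "K \<subseteq> W" "\<And>x. x \<notin> K \<Longrightarrow> \<phi> x = 0" "\<And>x i. x \<notin> K \<Longrightarrow> partial \<phi> i x = 0"
      by (rule test_fun_support[OF \<phi>]) blast
    have 1: "(\<lambda>k. \<integral>x. f k x * partial \<phi> i x \<partial>lebesgue_on W) \<longlonglongrightarrow> (\<integral>x. g x * partial \<phi> i x \<partial>lebesgue_on W)"
      using wg by (intro key[OF _ L(1) K(1,2) limf[OF K(1,2)] test_fun_partial_continuous[OF \<phi>] K(4)])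
        (auto simp: weak_grad_def)
    have 2: "(\<lambda>k. - (\<integral>x. G k x $ i * \<phi> x \<partial>lebesgue_on W)) \<longlonglongrightarrow> - (\<integral>x. H x $ i * \<phi> x \<partial>lebesgue_on W)"
      using wg by (intro tendsto_minus key[OF _ L(2) K(1,2) limG[OF K(1,2)] test_fun_continuous[OF \<phi>] K(3)])
        (auto simp: weak_grad_def)
    have 3: "(\<lambda>k. \<integral>x. f k x * partial \<phi> i x \<partial>lebesgue_on W) = (\<lambda>k. - (\<integral>x. G k x $ i * \<phi> x \<partial>lebesgue_on W))"
      using wg \<phi> by (simp add: weak_grad_def)
    show ?thesis by (rule LIMSEQ_unique[OF 1 2[folded 3]])
  qed
  then show ?thesis using L unfolding weak_grad_def by simp
qed

section \<open>Semi-inner products and square integrable functions\<close>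

text \<open>Functions are not identified modulo null sets, so elements of zero norm need not be zero
  and only semi-definiteness is available. The locale serves L2 spaces, the Dirichlet form and its
  perturbations alike.\<close>

locale semi_inner =
  fixes V :: "('a \<Rightarrow> real) set" and B :: "('a \<Rightarrow> real) \<Rightarrow> ('a \<Rightarrow> real) \<Rightarrow> real"
  assumes lincomb: "f \<in> V \<Longrightarrow> g \<in> V \<Longrightarrow> (\<lambda>x. a * f x + b * g x) \<in> V"
    and bilinear: "f \<in> V \<Longrightarrow> g \<in> V \<Longrightarrow> h \<in> V \<Longrightarrow> B (\<lambda>x. a * f x + b * g x) h = a * B f h + b * B g h"
    and sym: "f \<in> V \<Longrightarrow> g \<in> V \<Longrightarrow> B f g = B g f"
    and nonneg: "f \<in> V \<Longrightarrow> 0 \<le> B f f"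
begin

lemma bilinear_right:
  "f \<in> V \<Longrightarrow> g \<in> V \<Longrightarrow> h \<in> V \<Longrightarrow> B h (\<lambda>x. a * f x + b * g x) = a * B h f + b * B h g"
  using bilinear[of f g h a b] sym[of h f] sym[of h g] sym[of h "\<lambda>x. a * f x + b * g x"] lincomb[of f g a b]
  by simp

lemma square_lincomb:
  "f \<in> V \<Longrightarrow> g \<in> V \<Longrightarrow>
    B (\<lambda>x. a * f x + b * g x) (\<lambda>x. a * f x + b * g x) = a\<^sup>2 * B f f + 2 * a * b * B f g + b\<^sup>2 * B g g"
  using sym[of g f] by (simp add: bilinear bilinear_right lincomb power2_eq_square algebra_simps)

lemma Cauchy_Schwarz:
  assumes "f \<in> V" "g \<in> V"
  shows "(B f g)\<^sup>2 \<le> B f f * B g g"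
proof (cases "B g g = 0")
  case True
  have "B f g = 0"
  proof (rule ccontr)
    assume ne: "B f g \<noteq> 0"
    \<comment> \<open>The square of f + t g is affine in t when g has zero norm; this t makes it
      equal to -1.\<close>
    define t where "t = - (B f f + 1) / (2 * B f g)"
    have "0 \<le> B (\<lambda>x. 1 * f x + t * g x) (\<lambda>x. 1 * f x + t * g x)"
      by (intro nonneg lincomb assms)
    also have "\<dots> = B f f + 2 * t * B f g" using square_lincomb[OF assms, of 1 t] True by simp
    also have "\<dots> = - 1" using ne by (simp add: t_def field_simps)
    finally show False by simp
  qed
  then show ?thesis using True by simp
next
  case False
  then have pos: "0 < B g g" using nonneg[OF assms(2)] by simp
  have "0 \<le> B (\<lambda>x. B g g * f x + (- B f g) * g x) (\<lambda>x. B g g * f x + (- B f g) * g x)"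
    by (intro nonneg lincomb assms)
  also have "\<dots> = B g g * (B f f * B g g - (B f g)\<^sup>2)"
    unfolding square_lincomb[OF assms] by (simp add: power2_eq_square algebra_simps)
  finally show ?thesis using pos by (simp add: zero_le_mult_iff)
qed

lemma scale: "f \<in> V \<Longrightarrow> (\<lambda>x. a * f x) \<in> V"
  using lincomb[of f f a 0] by simp

lemma diff: "f \<in> V \<Longrightarrow> g \<in> V \<Longrightarrow> (\<lambda>x. f x - g x) \<in> V"
  using lincomb[of f g 1 "-1"] by simp

lemma add: "f \<in> V \<Longrightarrow> g \<in> V \<Longrightarrow> (\<lambda>x. f x + g x) \<in> V"
  using lincomb[of f g 1 1] by simp

lemma square_diff:
  "f \<in> V \<Longrightarrow> g \<in> V \<Longrightarrow> B (\<lambda>x. f x - g x) (\<lambda>x. f x - g x) = B f f - 2 * B f g + B g g"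
  using square_lincomb[of f g 1 "-1"] by simp

lemma square_diff_le:
  assumes "f \<in> V" "g \<in> V"
  shows "B (\<lambda>x. f x - g x) (\<lambda>x. f x - g x) \<le> 2 * B f f + 2 * B g g"
  using square_diff[OF assms] square_lincomb[OF assms, of 1 1] nonneg[OF lincomb[OF assms, of 1 1]]
  by simp

lemma square_scale: "f \<in> V \<Longrightarrow> B (\<lambda>x. a * f x) (\<lambda>x. a * f x) = a\<^sup>2 * B f f"
  using square_lincomb[of f f a 0] by simp

lemma diff_left: "f \<in> V \<Longrightarrow> g \<in> V \<Longrightarrow> h \<in> V \<Longrightarrow> B (\<lambda>x. f x - g x) h = B f h - B g h"
  using bilinear[of f g h 1 "-1"] by simp

end

section \<open>Square integrable functions and completeness of L2\<close>

definition sq_int :: "'a measure \<Rightarrow> ('a \<Rightarrow> real) \<Rightarrow> bool" where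
  "sq_int M f \<longleftrightarrow> f \<in> borel_measurable M \<and> integrable M (\<lambda>x. (f x)\<^sup>2)"

lemma sq_int_mult:
  assumes "sq_int M f" "sq_int M g"
  shows "integrable M (\<lambda>x. f x * g x)"
proof (rule Bochner_Integration.integrable_bound)
  show "integrable M (\<lambda>x. (f x)\<^sup>2 + (g x)\<^sup>2)" "(\<lambda>x. f x * g x) \<in> borel_measurable M"
    using assms by (auto simp: sq_int_def)
  show "AE x in M. norm (f x * g x) \<le> norm ((f x)\<^sup>2 + (g x)\<^sup>2)"
  proof (intro always_eventually allI)
    fix x
    have "2 * (\<bar>f x\<bar> * \<bar>g x\<bar>) \<le> (f x)\<^sup>2 + (g x)\<^sup>2"
      using sum_squares_bound[of "\<bar>f x\<bar>" "\<bar>g x\<bar>"] by simp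
    then show "norm (f x * g x) \<le> norm ((f x)\<^sup>2 + (g x)\<^sup>2)"
      by (simp add: abs_mult) (smt (verit) mult_nonneg_nonneg abs_ge_zero)
  qed
qed

lemma sq_int_lincomb:
  assumes "sq_int M f" "sq_int M g"
  shows "sq_int M (\<lambda>x. a * f x + b * g x)"
proof -
  have "(\<lambda>x. (a * f x + b * g x)\<^sup>2) = (\<lambda>x. a\<^sup>2 * (f x)\<^sup>2 + (2 * a * b) * (f x * g x) + b\<^sup>2 * (g x)\<^sup>2)"
    by (auto simp: power2_eq_square algebra_simps)
  then show ?thesis using assms sq_int_mult[OF assms] by (auto simp: sq_int_def)
qed

lemma sq_int_diff: "sq_int M f \<Longrightarrow> sq_int M g \<Longrightarrow> sq_int M (\<lambda>x. f x - g x)"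
  using sq_int_lincomb[of M f g 1 "-1"] by simp

lemma sq_int_const: "finite_measure M \<Longrightarrow> sq_int M (\<lambda>x. c)"
  by (simp add: sq_int_def finite_measure.integrable_const)

lemma sq_int_imp_integrable: "finite_measure M \<Longrightarrow> sq_int M f \<Longrightarrow> integrable M f"
  using sq_int_mult[of M f "\<lambda>_. 1"] sq_int_const[of M 1] by simp

lemma semi_inner_sq_int: "semi_inner {f. sq_int M f} (\<lambda>f g. \<integral>x. f x * g x \<partial>M)"
proof
  fix f g h :: "'a \<Rightarrow> real" and a b
  assume f: "f \<in> {f. sq_int M f}" and g: "g \<in> {f. sq_int M f}"
  show "(\<lambda>x. a * f x + b * g x) \<in> {f. sq_int M f}" using f g by (auto intro: sq_int_lincomb)
  show "(\<integral>x. f x * g x \<partial>M) = (\<integral>x. g x * f x \<partial>M)" by (simp add: mult.commute)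
  assume h: "h \<in> {f. sq_int M f}"
  have "(\<integral>x. (a * f x + b * g x) * h x \<partial>M) = (\<integral>x. a * (f x * h x) + b * (g x * h x) \<partial>M)"
    by (simp add: algebra_simps)
  also have "\<dots> = a * (\<integral>x. f x * h x \<partial>M) + b * (\<integral>x. g x * h x \<partial>M)"
    using sq_int_mult[of M f h] sq_int_mult[of M g h] f g h by simp
  finally show "(\<integral>x. (a * f x + b * g x) * h x \<partial>M) = a * (\<integral>x. f x * h x \<partial>M) + b * (\<integral>x. g x * h x \<partial>M)" .
qed simp

lemma integral_Cauchy_Schwarz:
  assumes "sq_int M f" "sq_int M g"
  shows "(\<integral>x. f x * g x \<partial>M)\<^sup>2 \<le> (\<integral>x. (f x)\<^sup>2 \<partial>M) * (\<integral>x. (g x)\<^sup>2 \<partial>M)"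
  using semi_inner.Cauchy_Schwarz[OF semi_inner_sq_int, of f M g] assms by (simp add: power2_eq_square)

lemma integral_abs_le_L2:
  assumes "finite_measure M" "sq_int M f"
  shows "(\<integral>x. \<bar>f x\<bar> \<partial>M)\<^sup>2 \<le> measure M (space M) * (\<integral>x. (f x)\<^sup>2 \<partial>M)"
proof -
  have "sq_int M (\<lambda>x. \<bar>f x\<bar>)" using assms(2) by (auto simp: sq_int_def)
  from integral_Cauchy_Schwarz[OF sq_int_const[OF assms(1), of 1] this] show ?thesis
    using assms by simp
qed

text \<open>Fatou's lemma applied to the squares of \<open>s k - s (r i)\<close> as i grows. A
  subsequence is allowed because a Cauchy sequence is only known to converge almost everywhere along
  one.\<close>

lemma sq_int_AE_limit:
  fixes s :: "nat \<Rightarrow> 'a \<Rightarrow> real"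
  assumes s: "\<And>k. sq_int M (s k)"
    and cauchy: "\<And>e. e > 0 \<Longrightarrow> \<exists>N. \<forall>m\<ge>N. \<forall>k\<ge>N. (\<integral>x. (s m x - s k x)\<^sup>2 \<partial>M) < e"
    and r: "strict_mono r" and lim: "AE x in M. (\<lambda>i. s (r i) x) \<longlonglongrightarrow> g x"
    and g[measurable]: "g \<in> borel_measurable M"
  shows "sq_int M g" and "(\<lambda>k. \<integral>x. (s k x - g x)\<^sup>2 \<partial>M) \<longlonglongrightarrow> 0"
proof -
  have sm[measurable]: "\<And>k. s k \<in> borel_measurable M" using s by (simp add: sq_int_def)
  have key: "\<exists>N. \<forall>k\<ge>N. integrable M (\<lambda>x. (s k x - g x)\<^sup>2) \<and> (\<integral>x. (s k x - g x)\<^sup>2 \<partial>M) \<le> e" if e: "e > 0" for e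
  proof -
    obtain N where N: "\<And>m k. m \<ge> N \<Longrightarrow> k \<ge> N \<Longrightarrow> (\<integral>x. (s m x - s k x)\<^sup>2 \<partial>M) < e"
      using cauchy[OF e] by blast
    have "integrable M (\<lambda>x. (s k x - g x)\<^sup>2) \<and> (\<integral>x. (s k x - g x)\<^sup>2 \<partial>M) \<le> e" if k: "k \<ge> N" for k
    proof -
      have "(\<integral>\<^sup>+x. ennreal ((s k x - g x)\<^sup>2) \<partial>M) = (\<integral>\<^sup>+x. liminf (\<lambda>i. ennreal ((s k x - s (r i) x)\<^sup>2)) \<partial>M)"
      proof (rule nn_integral_cong_AE)
        show "AE x in M. ennreal ((s k x - g x)\<^sup>2) = liminf (\<lambda>i. ennreal ((s k x - s (r i) x)\<^sup>2))"
          using lim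
        proof eventually_elim
          case (elim x)
          have "(\<lambda>i. ennreal ((s k x - s (r i) x)\<^sup>2)) \<longlonglongrightarrow> ennreal ((s k x - g x)\<^sup>2)"
            by (intro tendsto_ennrealI tendsto_intros elim)
          from lim_imp_Liminf[OF _ this] show ?case by simp
        qed
      qed
      also have "\<dots> \<le> liminf (\<lambda>i. \<integral>\<^sup>+x. ennreal ((s k x - s (r i) x)\<^sup>2) \<partial>M)"
        by (intro nn_integral_liminf) measurable
      also have "\<dots> \<le> ennreal e"
      proof (rule Liminf_le)
        have "(\<integral>\<^sup>+x. ennreal ((s k x - s (r i) x)\<^sup>2) \<partial>M) \<le> ennreal e" if "i \<ge> N" for i
        proof -
          have "r i \<ge> N" using that seq_suble[OF r, of i] by simp
          then have "(\<integral>x. (s k x - s (r i) x)\<^sup>2 \<partial>M) < e" using N k by blast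
          moreover have "integrable M (\<lambda>x. (s k x - s (r i) x)\<^sup>2)"
            using sq_int_diff[OF s s] by (simp add: sq_int_def)
          ultimately show ?thesis by (subst nn_integral_eq_integral) (auto intro: ennreal_leI)
        qed
        then show "\<forall>\<^sub>F i in sequentially. (\<integral>\<^sup>+x. ennreal ((s k x - s (r i) x)\<^sup>2) \<partial>M) \<le> ennreal e"
          using eventually_ge_at_top by (rule eventually_mono[rotated])
      qed simp
      finally have le: "(\<integral>\<^sup>+x. ennreal ((s k x - g x)\<^sup>2) \<partial>M) \<le> ennreal e" .
      then have i: "integrable M (\<lambda>x. (s k x - g x)\<^sup>2)"
        by (intro integrableI_nonneg) (auto intro: le_less_trans)
      then show ?thesis using le e by (subst (asm) nn_integral_eq_integral) auto
    qed
    then show ?thesis by blast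
  qed
  obtain N where "integrable M (\<lambda>x. (s N x - g x)\<^sup>2)" using key[of 1] by auto
  then have "sq_int M (\<lambda>x. s N x - g x)" by (simp add: sq_int_def)
  from sq_int_diff[OF s[of N] this] show "sq_int M g" by simp
  show "(\<lambda>k. \<integral>x. (s k x - g x)\<^sup>2 \<partial>M) \<longlonglongrightarrow> 0"
  proof (rule LIMSEQ_I)
    fix e :: real assume "e > 0"
    then obtain N where "\<forall>k\<ge>N. (\<integral>x. (s k x - g x)\<^sup>2 \<partial>M) \<le> e / 2" using key[of "e / 2"] by auto
    then have "\<forall>k\<ge>N. norm ((\<integral>x. (s k x - g x)\<^sup>2 \<partial>M) - 0) < e" using \<open>e > 0\<close> by fastforce
    then show "\<exists>N. \<forall>k\<ge>N. norm ((\<integral>x. (s k x - g x)\<^sup>2 \<partial>M) - 0) < e" by blast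
  qed
qed

text \<open>On a finite measure space L2 Cauchy implies L1 Cauchy, which yields a subsequence
  converging almost everywhere; its limit is then the L2 limit of the whole sequence.\<close>

lemma sq_int_complete:
  fixes s :: "nat \<Rightarrow> 'a \<Rightarrow> real"
  assumes fin: "finite_measure M" and s: "\<And>k. sq_int M (s k)"
    and cauchy: "\<And>e. e > 0 \<Longrightarrow> \<exists>N. \<forall>m\<ge>N. \<forall>k\<ge>N. (\<integral>x. (s m x - s k x)\<^sup>2 \<partial>M) < e"
  obtains g where "sq_int M g" "(\<lambda>k. \<integral>x. (s k x - g x)\<^sup>2 \<partial>M) \<longlonglongrightarrow> 0"
proof -
  have sm[measurable]: "\<And>k. s k \<in> borel_measurable M" using s by (simp add: sq_int_def)
  have "\<exists>N. \<forall>m\<ge>N. \<forall>k\<ge>N. (\<integral>x. norm (s m x - s k x) \<partial>M) < e" if e: "e > 0" for e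
  proof -
    define v where "v = measure M (space M)"
    have v: "v \<ge> 0" by (simp add: v_def)
    obtain N where N: "\<And>m k. m \<ge> N \<Longrightarrow> k \<ge> N \<Longrightarrow> (\<integral>x. (s m x - s k x)\<^sup>2 \<partial>M) < e\<^sup>2 / (v + 1)"
      using cauchy[of "e\<^sup>2 / (v + 1)"] e v by auto
    have "(\<integral>x. norm (s m x - s k x) \<partial>M) < e" if "m \<ge> N" "k \<ge> N" for m k
    proof -
      have "(\<integral>x. \<bar>s m x - s k x\<bar> \<partial>M)\<^sup>2 \<le> v * (\<integral>x. (s m x - s k x)\<^sup>2 \<partial>M)"
        unfolding v_def by (rule integral_abs_le_L2[OF fin sq_int_diff[OF s s]])
      also have "\<dots> \<le> v * (e\<^sup>2 / (v + 1))"
        using N[OF that] v by (intro mult_left_mono) auto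
      also have "\<dots> < e\<^sup>2" using e v by (simp add: field_simps)
      finally show ?thesis using e power2_less_imp_less[of _ e] by simp
    qed
    then show ?thesis by blast
  qed
  then obtain r where r: "strict_mono r" "AE x in M. Cauchy (\<lambda>i. s (r i) x)"
    by (rule cauchy_L1_AE_cauchy_subseq[OF sq_int_imp_integrable[OF fin s]]) blast
  define g where "g x = lim (\<lambda>i. s (r i) x)" for x
  have "AE x in M. (\<lambda>i. s (r i) x) \<longlonglongrightarrow> g x"
    using r(2) unfolding g_def by eventually_elim (simp add: Cauchy_convergent_iff convergent_LIMSEQ_iff)
  moreover have "g \<in> borel_measurable M" unfolding g_def by measurable
  ultimately show ?thesis
    using that sq_int_AE_limit[OF s cauchy r(1)] by blast
qed

section \<open>The Poincare inequality on convex sets\<close>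

lemma lborel_translate:
  fixes u :: "'a::euclidean_space \<Rightarrow> 'b::{banach, second_countable_topology}"
  assumes "u \<in> borel_measurable borel"
  shows "integrable lborel (\<lambda>x. u (x + t)) \<longleftrightarrow> integrable lborel u"
    and "(\<integral>x. u (x + t) \<partial>lborel) = (\<integral>x. u x \<partial>lborel)"
  using integrable_distr_eq[of "(+) t" lborel borel u] integral_distr[of "(+) t" lborel borel u]
    lborel_distr_plus[of t] assms by (simp_all add: add.commute)

lemma nn_integral_lborel_translate:
  assumes "u \<in> borel_measurable borel"
  shows "(\<integral>\<^sup>+x. u (x + t) \<partial>lborel) = (\<integral>\<^sup>+x. u x \<partial>lborel)"
  using nn_integral_distr[of "(+) t" lborel borel u] lborel_distr_plus[of t] assms
  by (simp add: add.commute)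

text \<open>Product measurability and shifts are handled for Borel functions and
  \<open>lborel\<close>. The representative vanishes exactly off \<open>W\<close>, not merely almost
  everywhere, so sums and shifts need no further indicator.\<close>

lemma borel_representative:
  fixes f :: "'a::euclidean_space \<Rightarrow> real"
  assumes W: "open W" and f: "f \<in> borel_measurable (lebesgue_on W)"
  obtains g where "g \<in> borel_measurable borel" "\<And>x. x \<notin> W \<Longrightarrow> g x = 0"
    "AE x in lebesgue. g x = indicator W x * f x"
proof -
  have "(\<lambda>x. indicator W x * f x) \<in> borel_measurable lebesgue"
    using f open_sets_lebesgue[OF W] by (simp add: lebesgue_on_measurable)
  then obtain g where g: "g \<in> borel_measurable lborel" "AE x in lborel. indicator W x * f x = g x"
    using completion_ex_borel_measurable_real by blast
  have "(\<lambda>x. indicator W x * g x) \<in> borel_measurable borel"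
    using g(1) W by (intro borel_measurable_times borel_measurable_indicator) auto
  moreover have "AE x in lebesgue. indicator W x * g x = indicator W x * f x"
    using AE_completion[OF g(2)] by eventually_elim (auto simp: indicator_def split: if_splits)
  ultimately show ?thesis using that[of "\<lambda>x. indicator W x * g x"] by (simp add: indicator_def)
qed

lemma borel_representative_integral:
  fixes f :: "'a::euclidean_space \<Rightarrow> real"
  assumes W: "open W" and f: "f \<in> borel_measurable (lebesgue_on W)"
    and g: "g \<in> borel_measurable borel" "AE x in lebesgue. g x = indicator W x * f x"
    and p: "p \<in> borel_measurable borel"
  shows "integrable (lebesgue_on W) (\<lambda>x. f x * p x) \<longleftrightarrow> integrable lborel (\<lambda>x. g x * p x)"
    and "(\<integral>x. f x * p x \<partial>lebesgue_on W) = (\<integral>x. g x * p x \<partial>lborel)"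
proof -
  note [simp] = open_sets_lebesgue[OF W]
  have gp: "(\<lambda>x. g x * p x) \<in> borel_measurable lborel" using g p by simp
  have "(\<lambda>x. (indicator W x * f x) * p x) \<in> borel_measurable lebesgue"
    using f p borel_measurable_times[OF _ measurable_completion[of p lborel]] by (simp add: lebesgue_on_measurable)
  then have fp: "(\<lambda>x. indicator W x * (f x * p x)) \<in> borel_measurable lebesgue"
    by (simp add: mult.assoc)
  have ae: "AE x in lebesgue. indicator W x * (f x * p x) = g x * p x"
    using g(2) by eventually_elim simp
  show "integrable (lebesgue_on W) (\<lambda>x. f x * p x) \<longleftrightarrow> integrable lborel (\<lambda>x. g x * p x)"
    using integrable_cong_AE[OF fp measurable_completion[OF gp] ae] integrable_completion[OF gp]
    by (simp add: lebesgue_on_integrable)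
  show "(\<integral>x. f x * p x \<partial>lebesgue_on W) = (\<integral>x. g x * p x \<partial>lborel)"
    using integral_cong_AE[OF fp measurable_completion[OF gp] ae] integral_completion[OF gp]
    by (simp add: lebesgue_on_integral)
qed

lemma integrable_pair_shift:
  fixes g :: "'a::euclidean_space \<Rightarrow> real"
  assumes g_int: "integrable lborel g"
  shows "integrable (lborel \<Otimes>\<^sub>M lborel) (\<lambda>(t, x). indicator {0..1::real} t * g (x + t *\<^sub>R h))"
proof (rule integrableI_bounded)
  have [measurable]: "g \<in> borel_measurable borel" using g_int by auto
  show "(\<lambda>(t, x). indicator {0..1::real} t * g (x + t *\<^sub>R h)) \<in> borel_measurable (lborel \<Otimes>\<^sub>M lborel)"
    by measurable
  have "(\<integral>\<^sup>+p. ennreal (norm (case p of (t, x) \<Rightarrow> indicator {0..1::real} t * g (x + t *\<^sub>R h))) \<partial>(lborel \<Otimes>\<^sub>M lborel))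
     = (\<integral>\<^sup>+t. \<integral>\<^sup>+x. indicator {0..1::real} t * ennreal \<bar>g (x + t *\<^sub>R h)\<bar> \<partial>lborel \<partial>lborel)"
    by (subst sigma_finite_measure.nn_integral_fst[OF sigma_finite_lborel, symmetric]) (auto simp: abs_mult ennreal_mult ennreal_indicator)
  also have "\<dots> = (\<integral>\<^sup>+t. indicator {0..1::real} t * (\<integral>\<^sup>+x. ennreal \<bar>g x\<bar> \<partial>lborel) \<partial>lborel)"
    by (subst nn_integral_cmult) (auto simp: nn_integral_lborel_translate[of "\<lambda>x. ennreal \<bar>g x\<bar>"])
  also have "\<dots> = (\<integral>\<^sup>+x. ennreal \<bar>g x\<bar> \<partial>lborel)" by (simp add: nn_integral_multc)
  also have "\<dots> < \<infinity>" using g_int by (simp add: integrable_iff_bounded)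
  finally show "(\<integral>\<^sup>+p. ennreal (norm (case p of (t, x) \<Rightarrow> indicator {0..1::real} t * g (x + t *\<^sub>R h))) \<partial>(lborel \<Otimes>\<^sub>M lborel)) < \<infinity>" .
qed

text \<open>The fundamental theorem of calculus in the weak setting; tested against \<open>\<phi>\<close> and differentiated
  in \<open>t\<close>, it is the definition of the weak gradient applied to translates of \<open>\<phi>\<close>.\<close>

lemma weak_difference_formula:
  fixes f :: "real^'n \<Rightarrow> real" and G :: "real^'n \<Rightarrow> real^'n"
  assumes W: "open W" "convex W" and wg: "weak_grad W f G"
    and f0: "f0 \<in> borel_measurable borel"
      "AE x in lebesgue. f0 x = indicator W x * f x" "integrable lborel f0"
    and G0: "\<And>i. G0 i \<in> borel_measurable borel"
      "\<And>i. AE x in lebesgue. G0 i x = indicator W x * G x $ i" "\<And>i. integrable lborel (G0 i)"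
  shows "AE x in lborel. x \<in> W \<and> x + h \<in> W \<longrightarrow>
    f0 (x + h) - f0 x = (\<integral>t. indicator {0..1::real} t * (\<Sum>i\<in>UNIV. h $ i * G0 i (x + t *\<^sub>R h)) \<partial>lborel)"
proof -
  note [measurable] = f0(1) G0(1)
  define Gh where "Gh y = (\<Sum>i\<in>UNIV. h $ i * G0 i y)" for y
  have Gh[measurable]: "Gh \<in> borel_measurable borel" and Gh_int: "integrable lborel Gh"
    using G0(3) unfolding Gh_def by (auto intro!: Bochner_Integration.integrable_sum)
  define N where "N x = (\<integral>t. indicator {0..1::real} t * Gh (x + t *\<^sub>R h) \<partial>lborel)" for x
  note Gh_pair = integrable_pair_shift[OF Gh_int, of h]
  have N_int: "integrable lborel N" and N[measurable]: "N \<in> borel_measurable borel"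
    using lborel_pair.integrable_snd[OF Gh_pair] unfolding N_def by auto
  define S where "S = W \<inter> (\<lambda>x. x + h) -` W"
  have S: "open S" unfolding S_def using W(1)
    by (intro open_Int open_vimage) (auto intro: continuous_intros)
  \<comment> \<open>Convexity of \<open>W\<close> is used here: the segment from x to x + h stays in
    \<open>W\<close>, so a test function on \<open>S\<close> shifted by \<open>t *\<^sub>R h\<close>
    is a test function on \<open>W\<close>.\<close>
  have shift_in: "x + t *\<^sub>R h \<in> W" if "x \<in> S" "0 \<le> t" "t \<le> 1" for x t
  proof -
    have "(1 - t) *\<^sub>R x + t *\<^sub>R (x + h) \<in> W" using that W(2) by (intro convexD) (auto simp: S_def)
    then show ?thesis by (simp add: algebra_simps)
  qed
  have f0h: "integrable lborel (\<lambda>x. f0 (x + h))" using f0 by (simp add: lborel_translate)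
  define u where "u x = f0 (x + h) - f0 x - N x" for x
  have u_int: "integrable lborel u" unfolding u_def using f0h f0(3) N_int by simp
  have u_leb: "integrable lebesgue u"
    using u_int by (subst integrable_completion) auto
  have "AE x in lebesgue_on S. u x = 0"
  proof (rule fundamental_lemma[OF _ S])
    have "integrable (lebesgue_on K) u" if "K \<in> sets lebesgue" for K
      using integrable_mult_indicator[OF that u_leb] that by (simp add: lebesgue_on_integrable)
    then show "L1loc S u"
      unfolding L1loc_def using open_sets_lebesgue[OF S] compact_sets_lebesgue by blast
    fix \<phi> assume \<phi>: "test_fun S \<phi>"
    obtain K where K: "compact K" "K \<subseteq> S" "\<And>x. x \<notin> K \<Longrightarrow> \<phi> x = 0" "\<And>x i. x \<notin> K \<Longrightarrow> partial \<phi> i x = 0"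
      by (rule test_fun_support[OF \<phi>]) blast
    define \<psi> where "\<psi> x = (\<Sum>i\<in>UNIV. h $ i * partial \<phi> i x)" for x
    have \<psi>c: "continuous_on UNIV \<psi>" unfolding \<psi>_def
      by (intro continuous_intros test_fun_partial_continuous[OF \<phi>])
    have [measurable]: "\<phi> \<in> borel_measurable borel" "\<psi> \<in> borel_measurable borel"
      "\<And>i. partial \<phi> i \<in> borel_measurable borel"
      using \<psi>c test_fun_continuous[OF \<phi>] test_fun_partial_continuous[OF \<phi>]
      by (auto intro: borel_measurable_continuous_onI)
    have bnd: "\<exists>B. \<forall>x. \<bar>p x\<bar> \<le> B" if "continuous_on UNIV p" "\<And>x. x \<notin> K \<Longrightarrow> p x = 0" for p :: "real^'n \<Rightarrow> real"
    proof -
      have "bounded (p ` K)"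
        by (intro compact_imp_bounded compact_continuous_image K(1) continuous_on_subset[OF that(1)]) simp
      then obtain B where "\<And>x. x \<in> K \<Longrightarrow> \<bar>p x\<bar> \<le> B" by (auto simp: bounded_iff)
      then have "\<bar>p x\<bar> \<le> max B 0" for x using that(2)[of x] by (cases "x \<in> K") (auto simp: le_max_iff_disj)
      then show ?thesis by blast
    qed
    obtain B where B: "\<And>x. \<bar>\<phi> x\<bar> \<le> B" using bnd[OF test_fun_continuous[OF \<phi>] K(3)] by blast
    obtain B' where B': "\<And>x. \<bar>\<psi> x\<bar> \<le> B'" using bnd[OF \<psi>c] K(4) by (auto simp: \<psi>_def)
    have diff_quot: "\<phi> (y - h) - \<phi> y = - (\<integral>t. indicator {0..1::real} t * \<psi> (y - t *\<^sub>R h) \<partial>lborel)" for y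
    proof -
      have "((\<lambda>t. \<phi> (y + t *\<^sub>R (- h))) has_real_derivative (\<Sum>i\<in>UNIV. (- h) $ i * partial \<phi> i (y + t *\<^sub>R (- h)))) (at t)" for t
        by (rule has_derivative_along_line[OF has_derivative_partial[OF test_fun_differentiable[OF \<phi>]]])
      moreover have "(\<Sum>i\<in>UNIV. (- h) $ i * partial \<phi> i (y + t *\<^sub>R (- h))) = - \<psi> (y - t *\<^sub>R h)" for t
        by (simp add: \<psi>_def sum_negf)
      ultimately have d: "((\<lambda>t. \<phi> (y - t *\<^sub>R h)) has_real_derivative - \<psi> (y - t *\<^sub>R h)) (at t)" for t
        by simp
      have "(\<integral>t. - \<psi> (y - t *\<^sub>R h) * indicator {0..1::real} t \<partial>lborel) = \<phi> (y - 1 *\<^sub>R h) - \<phi> (y - 0 *\<^sub>R h)"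
      proof (rule integral_FTC_Icc_real)
        have "continuous_on UNIV (\<lambda>t. - \<psi> (y - t *\<^sub>R h))"
          by (intro continuous_intros continuous_on_compose2[OF \<psi>c]) auto
        then show "isCont (\<lambda>t. - \<psi> (y - t *\<^sub>R h)) t" for t :: real
          by (simp add: continuous_on_eq_continuous_at)
      qed (simp, rule d)
      then show ?thesis by (simp add: mult.commute)
    qed
    have inner: "(\<integral>y. f0 y * \<psi> (y - t *\<^sub>R h) \<partial>lborel) = - (\<integral>x. Gh (x + t *\<^sub>R h) * \<phi> x \<partial>lborel)"
      if t: "0 \<le> t" "t \<le> 1" for t
    proof -
      have tr: "test_fun W (\<lambda>y. \<phi> (y - t *\<^sub>R h))"
        by (rule test_fun_translate[OF \<phi>]) (use shift_in t in \<open>auto simp: add.commute\<close>)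
      have pt: "partial (\<lambda>y. \<phi> (y - t *\<^sub>R h)) i y = partial \<phi> i (y - t *\<^sub>R h)" for i y
        by (rule partial_translate[OF test_fun_differentiable[OF \<phi>]])
      have L: "L1loc W f" "\<And>i. L1loc W (\<lambda>x. G x $ i)" using wg by (auto simp: weak_grad_def)
      have fm: "f \<in> borel_measurable (lebesgue_on W)" "\<And>i. (\<lambda>x. G x $ i) \<in> borel_measurable (lebesgue_on W)"
        using L by (auto simp: L1loc_def)
      have 1: "(\<integral>y. f0 y * partial \<phi> i (y - t *\<^sub>R h) \<partial>lborel) = - (\<integral>y. G0 i y * \<phi> (y - t *\<^sub>R h) \<partial>lborel)" for i
      proof -
        have "(\<integral>y. f0 y * partial \<phi> i (y - t *\<^sub>R h) \<partial>lborel) = (\<integral>y. f y * partial \<phi> i (y - t *\<^sub>R h) \<partial>lebesgue_on W)"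
          by (rule borel_representative_integral(2)[OF W(1) fm(1) f0(1,2), symmetric]) measurable
        also have "\<dots> = - (\<integral>y. G y $ i * \<phi> (y - t *\<^sub>R h) \<partial>lebesgue_on W)"
          using wg tr unfolding weak_grad_def pt[symmetric] by blast
        also have "(\<integral>y. G y $ i * \<phi> (y - t *\<^sub>R h) \<partial>lebesgue_on W) = (\<integral>y. G0 i y * \<phi> (y - t *\<^sub>R h) \<partial>lborel)"
          by (rule borel_representative_integral(2)[OF W(1) fm(2) G0(1,2)]) measurable
        finally show ?thesis .
      qed
      have i1: "integrable lborel (\<lambda>y. f0 y * partial \<phi> i (y - t *\<^sub>R h))" for i
        using integrable_L1loc_test(2)[OF L(1) W(1) tr, of i] unfolding pt
        by (subst borel_representative_integral(1)[OF W(1) fm(1) f0(1,2), symmetric]) auto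
      have i2: "integrable lborel (\<lambda>y. G0 i y * \<phi> (y - t *\<^sub>R h))" for i
        using integrable_L1loc_test(1)[OF L(2) W(1) tr, of i]
        by (subst borel_representative_integral(1)[OF W(1) fm(2) G0(1,2), symmetric]) auto
      have "(\<integral>y. f0 y * \<psi> (y - t *\<^sub>R h) \<partial>lborel) = (\<integral>y. (\<Sum>i\<in>UNIV. h $ i * (f0 y * partial \<phi> i (y - t *\<^sub>R h))) \<partial>lborel)"
        by (simp add: \<psi>_def sum_distrib_left mult.left_commute)
      also have "\<dots> = (\<Sum>i\<in>UNIV. h $ i * (\<integral>y. f0 y * partial \<phi> i (y - t *\<^sub>R h) \<partial>lborel))"
        using i1 by (subst Bochner_Integration.integral_sum) auto
      also have "\<dots> = - (\<Sum>i\<in>UNIV. h $ i * (\<integral>y. G0 i y * \<phi> (y - t *\<^sub>R h) \<partial>lborel))"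
        by (simp add: 1 sum_negf)
      also have "(\<Sum>i\<in>UNIV. h $ i * (\<integral>y. G0 i y * \<phi> (y - t *\<^sub>R h) \<partial>lborel))
          = (\<integral>y. (\<Sum>i\<in>UNIV. h $ i * (G0 i y * \<phi> (y - t *\<^sub>R h))) \<partial>lborel)"
        using i2 by (subst Bochner_Integration.integral_sum) auto
      also have "\<dots> = (\<integral>y. Gh y * \<phi> (y - t *\<^sub>R h) \<partial>lborel)"
        by (simp add: Gh_def sum_distrib_right mult.assoc)
      also have "\<dots> = (\<integral>x. Gh (x + t *\<^sub>R h) * \<phi> x \<partial>lborel)"
        using lborel_translate(2)[of "\<lambda>y. Gh y * \<phi> (y - t *\<^sub>R h)" "t *\<^sub>R h"] by simp
      finally show ?thesis .
    qed
    \<comment> \<open>Joint integrability for Fubini: the derivative of the test function is bounded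
      by \<open>B'\<close>, and the majorant is \<open>integrable_pair_shift\<close> with zero
      shift.\<close>
    have int1: "integrable (lborel \<Otimes>\<^sub>M lborel) (\<lambda>(t, y). f0 y * (indicator {0..1::real} t * \<psi> (y - t *\<^sub>R h)))"
    proof (rule Bochner_Integration.integrable_bound[OF integrable_mult_right[OF integrable_pair_shift[OF f0(3), of 0], of B']])
      show "(\<lambda>(t, y). f0 y * (indicator {0..1::real} t * \<psi> (y - t *\<^sub>R h))) \<in> borel_measurable (lborel \<Otimes>\<^sub>M lborel)"
        by measurable
      show "AE p in lborel \<Otimes>\<^sub>M lborel. norm (case p of (t, y) \<Rightarrow> f0 y * (indicator {0..1::real} t * \<psi> (y - t *\<^sub>R h)))
          \<le> norm (B' * (case p of (t, y) \<Rightarrow> indicator {0..1::real} t * f0 (y + t *\<^sub>R 0)))"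
        by (intro always_eventually allI)
          (auto simp: abs_mult indicator_def mult.commute[of "\<bar>B'\<bar>"] intro!: mult_left_mono order_trans[OF B' abs_ge_self])
    qed
    have int2: "integrable (lborel \<Otimes>\<^sub>M lborel) (\<lambda>(t, x). \<phi> x * (indicator {0..1::real} t * Gh (x + t *\<^sub>R h)))"
    proof (rule Bochner_Integration.integrable_bound[OF integrable_mult_right[OF Gh_pair, of B]])
      show "(\<lambda>(t, x). \<phi> x * (indicator {0..1::real} t * Gh (x + t *\<^sub>R h))) \<in> borel_measurable (lborel \<Otimes>\<^sub>M lborel)"
        by measurable
      show "AE p in lborel \<Otimes>\<^sub>M lborel. norm (case p of (t, x) \<Rightarrow> \<phi> x * (indicator {0..1::real} t * Gh (x + t *\<^sub>R h)))
          \<le> norm (B * (case p of (t, x) \<Rightarrow> indicator {0..1::real} t * Gh (x + t *\<^sub>R h)))"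
        using B abs_ge_self[of B] by (intro always_eventually allI)
          (auto simp: abs_mult intro!: mult_right_mono order_trans[OF B abs_ge_self])
    qed
    have lhs: "(\<integral>x. (f0 (x + h) - f0 x) * \<phi> x \<partial>lborel) = (\<integral>y. f0 y * (\<phi> (y - h) - \<phi> y) \<partial>lborel)"
    proof -
      have i: "integrable lborel (\<lambda>x. g x * p x)" if "integrable lborel g" "\<And>x. \<bar>p x\<bar> \<le> B" "p \<in> borel_measurable borel"
        for g p :: "real^'n \<Rightarrow> real"
      proof (rule Bochner_Integration.integrable_bound[OF integrable_mult_right[OF that(1), of B]])
        show "(\<lambda>x. g x * p x) \<in> borel_measurable lborel" using that by (intro borel_measurable_times) auto
        show "AE x in lborel. norm (g x * p x) \<le> norm (B * g x)"
          by (intro always_eventually allI)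
            (auto simp: abs_mult mult.commute[of "\<bar>B\<bar>"] intro!: mult_left_mono order_trans[OF that(2) abs_ge_self])
      qed
      have "(\<integral>x. (f0 (x + h) - f0 x) * \<phi> x \<partial>lborel) = (\<integral>x. f0 (x + h) * \<phi> x \<partial>lborel) - (\<integral>x. f0 x * \<phi> x \<partial>lborel)"
        using i[OF f0h B] i[OF f0(3) B] by (simp add: left_diff_distrib)
      also have "(\<integral>x. f0 (x + h) * \<phi> x \<partial>lborel) = (\<integral>y. f0 y * \<phi> (y - h) \<partial>lborel)"
        using lborel_translate(2)[of "\<lambda>y. f0 y * \<phi> (y - h)" h] by simp
      also have "(\<integral>y. f0 y * \<phi> (y - h) \<partial>lborel) - (\<integral>x. f0 x * \<phi> x \<partial>lborel) = (\<integral>y. f0 y * (\<phi> (y - h) - \<phi> y) \<partial>lborel)"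
        using i[OF f0(3), of "\<lambda>y. \<phi> (y - h)"] B i[OF f0(3) B] by (simp add: right_diff_distrib)
      finally show ?thesis .
    qed
    also have "\<dots> = - (\<integral>y. \<integral>t. f0 y * (indicator {0..1::real} t * \<psi> (y - t *\<^sub>R h)) \<partial>lborel \<partial>lborel)"
      by (simp add: diff_quot)
    also have "\<dots> = - (\<integral>t. \<integral>y. f0 y * (indicator {0..1::real} t * \<psi> (y - t *\<^sub>R h)) \<partial>lborel \<partial>lborel)"
      using lborel_pair.Fubini_integral[OF int1] by simp
    also have "\<dots> = (\<integral>t. \<integral>x. \<phi> x * (indicator {0..1::real} t * Gh (x + t *\<^sub>R h)) \<partial>lborel \<partial>lborel)"
    proof -
      have "- (\<integral>y. f0 y * (indicator {0..1::real} t * \<psi> (y - t *\<^sub>R h)) \<partial>lborel)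
          = (\<integral>x. \<phi> x * (indicator {0..1::real} t * Gh (x + t *\<^sub>R h)) \<partial>lborel)" for t
      proof (cases "t \<in> {0..1}")
        case True
        then show ?thesis using inner[of t] by (simp add: mult.commute)
      qed simp
      then show ?thesis by (simp flip: Bochner_Integration.integral_minus)
    qed
    also have "\<dots> = (\<integral>x. \<integral>t. \<phi> x * (indicator {0..1::real} t * Gh (x + t *\<^sub>R h)) \<partial>lborel \<partial>lborel)"
      using lborel_pair.Fubini_integral[OF int2] by simp
    also have "\<dots> = (\<integral>x. N x * \<phi> x \<partial>lborel)" by (simp add: N_def mult.commute)
    finally have eq: "(\<integral>x. (f0 (x + h) - f0 x) * \<phi> x \<partial>lborel) = (\<integral>x. N x * \<phi> x \<partial>lborel)" .
    have i3: "integrable lborel (\<lambda>x. g x * \<phi> x)" if "integrable lborel g" for g :: "real^'n \<Rightarrow> real"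
    proof (rule Bochner_Integration.integrable_bound[OF integrable_mult_right[OF that, of B]])
      show "(\<lambda>x. g x * \<phi> x) \<in> borel_measurable lborel" using that by (intro borel_measurable_times) auto
      show "AE x in lborel. norm (g x * \<phi> x) \<le> norm (B * g x)"
        by (intro always_eventually allI)
          (auto simp: abs_mult mult.commute[of "\<bar>B\<bar>"] intro!: mult_left_mono order_trans[OF B abs_ge_self])
    qed
    have "(\<integral>x. u x * \<phi> x \<partial>lebesgue_on S) = (\<integral>x. u x * \<phi> x \<partial>lebesgue)"
      using open_sets_lebesgue[OF S] test_fun_eq_0[OF \<phi>]
      by (simp add: lebesgue_on_integral) (intro Bochner_Integration.integral_cong, auto simp: indicator_def)
    also have "\<dots> = (\<integral>x. u x * \<phi> x \<partial>lborel)"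
      by (rule integral_completion) (use u_int in auto)
    also have "\<dots> = (\<integral>x. (f0 (x + h) - f0 x) * \<phi> x - N x * \<phi> x \<partial>lborel)"
      by (simp add: u_def algebra_simps)
    also have "\<dots> = 0"
      using eq i3[OF N_int] i3[OF Bochner_Integration.integrable_diff[OF f0h f0(3)]] by simp
    finally show "(\<integral>x. u x * \<phi> x \<partial>lebesgue_on S) = 0" .
  qed
  then have "AE x in lebesgue. x \<in> S \<longrightarrow> u x = 0"
    by (simp add: lebesgue_on_AE open_sets_lebesgue[OF S])
  then have "AE x in lborel. x \<in> S \<longrightarrow> u x = 0" by (simp add: AE_completion_iff)
  then show ?thesis
    by eventually_elim (auto simp: S_def u_def N_def Gh_def)
qed

text \<open>Cauchy-Schwarz on an interval of length one. If the integral on the left does not exist,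
  its default value 0 makes the claim trivial, so integrability need not be checked for individual
  lines.\<close>

lemma integral_square_le_nn_integral_square:
  fixes g :: "real \<Rightarrow> real"
  assumes [measurable]: "g \<in> borel_measurable borel"
  shows "ennreal ((\<integral>t. indicator {0..1} t * g t \<partial>lborel)\<^sup>2) \<le> (\<integral>\<^sup>+t. indicator {0..1} t * ennreal ((g t)\<^sup>2) \<partial>lborel)"
proof -
  have "ennreal \<bar>\<integral>t. indicator {0..1} t * g t \<partial>lborel\<bar> \<le> (\<integral>\<^sup>+t. ennreal \<bar>indicator {0..1} t * g t\<bar> \<partial>lborel)"
  proof (cases "integrable lborel (\<lambda>t. indicator {0..1} t * g t)")
    case True
    from integral_norm_bound_ennreal[OF this] show ?thesis by simp
  qed (simp add: not_integrable_integral_eq)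
  also have "(\<integral>\<^sup>+t. ennreal \<bar>indicator {0..1} t * g t\<bar> \<partial>lborel)
      = (\<integral>\<^sup>+t. indicator {0..1} t * (indicator {0..1} t * ennreal \<bar>g t\<bar>) \<partial>lborel)"
    by (intro nn_integral_cong) (auto simp: indicator_def)
  finally have "(ennreal \<bar>\<integral>t. indicator {0..1} t * g t \<partial>lborel\<bar>)\<^sup>2
      \<le> (\<integral>\<^sup>+t. indicator {0..1} t * (indicator {0..1} t * ennreal \<bar>g t\<bar>) \<partial>lborel)\<^sup>2"
    by (intro power_mono) auto
  also have "\<dots> \<le> (\<integral>\<^sup>+t. (indicator {0..1::real} t)\<^sup>2 \<partial>lborel) * (\<integral>\<^sup>+t. (indicator {0..1} t * ennreal \<bar>g t\<bar>)\<^sup>2 \<partial>lborel)"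
    by (rule Cauchy_Schwarz_nn_integral) measurable
  also have "(\<integral>\<^sup>+t. (indicator {0..1::real} t)\<^sup>2 \<partial>lborel) = (\<integral>\<^sup>+t. indicator {0..1::real} t \<partial>lborel)"
    by (intro nn_integral_cong) (auto simp: indicator_def)
  also have "\<dots> = 1" by simp
  also have "(\<integral>\<^sup>+t. (indicator {0..1} t * ennreal \<bar>g t\<bar>)\<^sup>2 \<partial>lborel) = (\<integral>\<^sup>+t. indicator {0..1} t * ennreal ((g t)\<^sup>2) \<partial>lborel)"
    by (intro nn_integral_cong) (auto simp: indicator_def ennreal_power)
  finally show ?thesis by (simp add: ennreal_power)
qed

text \<open>Squaring the difference formula and applying Cauchy-Schwarz in \<open>t\<close> and in
  the components leaves an average over \<open>t\<close> of integrals of shifted squares. By Tonelli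
  and translation invariance each of them equals the unshifted one.\<close>

lemma weak_difference_bound:
  fixes f :: "real^'n \<Rightarrow> real" and G :: "real^'n \<Rightarrow> real^'n"
  assumes W: "open W" "convex W" and wg: "weak_grad W f G"
    and f0: "f0 \<in> borel_measurable borel"
      "AE x in lebesgue. f0 x = indicator W x * f x" "integrable lborel f0"
    and G0: "\<And>i. G0 i \<in> borel_measurable borel"
      "\<And>i. AE x in lebesgue. G0 i x = indicator W x * G x $ i" "\<And>i. integrable lborel (G0 i)"
  shows "(\<integral>\<^sup>+x. indicator {x. x \<in> W \<and> x + h \<in> W} x * ennreal ((f0 (x + h) - f0 x)\<^sup>2) \<partial>lborel)
    \<le> ennreal ((norm h)\<^sup>2) * (\<integral>\<^sup>+x. ennreal (\<Sum>i\<in>UNIV. (G0 i x)\<^sup>2) \<partial>lborel)"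
proof -
  note [measurable] = f0(1) G0(1)
  have [measurable]: "W \<in> sets borel" using W(1) by simp
  define Gh where "Gh y = (\<Sum>i\<in>UNIV. h $ i * G0 i y)" for y
  have Gh[measurable]: "Gh \<in> borel_measurable borel" unfolding Gh_def by measurable
  have Gh_le: "(Gh y)\<^sup>2 \<le> (norm h)\<^sup>2 * (\<Sum>i\<in>UNIV. (G0 i y)\<^sup>2)" for y
    using Cauchy_Schwarz_ineq_sum[of "\<lambda>i. h $ i" "\<lambda>i. G0 i y" UNIV] unfolding Gh_def
    by (simp add: norm_vec_def L2_set_def sum_nonneg)
  have "(\<integral>\<^sup>+x. indicator {x. x \<in> W \<and> x + h \<in> W} x * ennreal ((f0 (x + h) - f0 x)\<^sup>2) \<partial>lborel)
      \<le> (\<integral>\<^sup>+x. (\<integral>\<^sup>+t. indicator {0..1::real} t * ennreal ((Gh (x + t *\<^sub>R h))\<^sup>2) \<partial>lborel) \<partial>lborel)"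
  proof (rule nn_integral_mono_AE)
    show "AE x in lborel. indicator {x. x \<in> W \<and> x + h \<in> W} x * ennreal ((f0 (x + h) - f0 x)\<^sup>2)
      \<le> (\<integral>\<^sup>+t. indicator {0..1::real} t * ennreal ((Gh (x + t *\<^sub>R h))\<^sup>2) \<partial>lborel)"
      using weak_difference_formula[OF W wg f0 G0, of h]
    proof eventually_elim
      case (elim x)
      have "(\<lambda>t. Gh (x + t *\<^sub>R h)) \<in> borel_measurable borel" by measurable
      from integral_square_le_nn_integral_square[OF this] elim show ?case
        by (auto simp: indicator_def Gh_def)
    qed
  qed
  also have "\<dots> = (\<integral>\<^sup>+t. (\<integral>\<^sup>+x. indicator {0..1::real} t * ennreal ((Gh (x + t *\<^sub>R h))\<^sup>2) \<partial>lborel) \<partial>lborel)"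
    by (rule lborel_pair.Fubini') measurable
  also have "\<dots> = (\<integral>\<^sup>+t. indicator {0..1::real} t * (\<integral>\<^sup>+x. ennreal ((Gh x)\<^sup>2) \<partial>lborel) \<partial>lborel)"
    by (subst nn_integral_cmult) (auto simp: nn_integral_lborel_translate[of "\<lambda>x. ennreal ((Gh x)\<^sup>2)"])
  also have "\<dots> = (\<integral>\<^sup>+x. ennreal ((Gh x)\<^sup>2) \<partial>lborel)" by (simp add: nn_integral_multc)
  also have "\<dots> \<le> (\<integral>\<^sup>+x. ennreal ((norm h)\<^sup>2) * ennreal (\<Sum>i\<in>UNIV. (G0 i x)\<^sup>2) \<partial>lborel)"
    using Gh_le by (intro nn_integral_mono) (simp flip: ennreal_mult add: sum_nonneg ennreal_leI)
  also have "\<dots> = ennreal ((norm h)\<^sup>2) * (\<integral>\<^sup>+x. ennreal (\<Sum>i\<in>UNIV. (G0 i x)\<^sup>2) \<partial>lborel)"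
    by (rule nn_integral_cmult) measurable
  finally show ?thesis .
qed

section \<open>Poincare inequalities on bounded convex sets and on balls\<close>

lemma finite_measure_lebesgue_on_open:
  assumes "open W" "bounded W"
  shows "finite_measure (lebesgue_on W)"
  using assms bounded_set_imp_lmeasurable[OF assms(2) open_sets_lebesgue[OF assms(1)]]
  by (auto intro!: finite_measure_lebesgue_on)

text \<open>The left side is the integral of (f(y) - f(x))^2 over W x W. Writing y = x + h, only
  shifts with |h| \<le> d contribute, each at most |h|^2 times the energy, and integration over h
  produces the volume of the ball of radius \<open>d\<close>. Using expanded squares instead of mean
  values avoids any division by the volume of \<open>W\<close>.\<close>

theorem poincare_convex:
  fixes f :: "real^'n \<Rightarrow> real"
  assumes W: "open W" "convex W" "bounded W" and wg: "weak_grad W f G"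
    and f: "sq_int (lebesgue_on W) f" and G: "\<And>i. sq_int (lebesgue_on W) (\<lambda>x. G x $ i)"
    and d: "\<And>x y. x \<in> W \<Longrightarrow> y \<in> W \<Longrightarrow> dist x y \<le> d"
  shows "2 * (measure lebesgue W * (\<integral>x. (f x)\<^sup>2 \<partial>lebesgue_on W) - (\<integral>x. f x \<partial>lebesgue_on W)\<^sup>2)
    \<le> d\<^sup>2 * measure lebesgue (cball (0::real^'n) d) * (\<integral>x. (norm (G x))\<^sup>2 \<partial>lebesgue_on W)"
proof -
  have fm: "f \<in> borel_measurable (lebesgue_on W)" "\<And>i. (\<lambda>x. G x $ i) \<in> borel_measurable (lebesgue_on W)"
    using f G by (auto simp: sq_int_def)
  obtain f0 where f0: "f0 \<in> borel_measurable borel" "\<And>x. x \<notin> W \<Longrightarrow> f0 x = 0"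
      "AE x in lebesgue. f0 x = indicator W x * f x"
    by (rule borel_representative[OF W(1) fm(1)]) blast
  have "\<exists>g. g \<in> borel_measurable borel \<and> (\<forall>x. x \<notin> W \<longrightarrow> g x = 0) \<and> (AE x in lebesgue. g x = indicator W x * G x $ i)" for i
    by (rule borel_representative[OF W(1) fm(2)[of i]]) blast
  then have "\<exists>G0. \<forall>i. G0 i \<in> borel_measurable borel \<and> (\<forall>x. x \<notin> W \<longrightarrow> G0 i x = 0) \<and> (AE x in lebesgue. G0 i x = indicator W x * G x $ i)"
    by (intro choice) blast
  then obtain G0 where G0: "\<And>i. G0 i \<in> borel_measurable borel" "\<And>i x. x \<notin> W \<Longrightarrow> G0 i x = 0"
      "\<And>i. AE x in lebesgue. G0 i x = indicator W x * G x $ i"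
    by blast
  note fin = finite_measure_lebesgue_on_open[OF W(1,3)]
  note [measurable] = f0(1) G0(1)
  have [measurable]: "W \<in> sets borel" using W(1) by simp
  have rep: "integrable lborel u" "integrable lborel (\<lambda>x. (u x)\<^sup>2)"
      "(\<integral>x. (v x)\<^sup>2 \<partial>lebesgue_on W) = (\<integral>x. (u x)\<^sup>2 \<partial>lborel)" "(\<integral>x. v x \<partial>lebesgue_on W) = (\<integral>x. u x \<partial>lborel)"
    if u[measurable]: "u \<in> borel_measurable borel" and uv: "AE x in lebesgue. u x = indicator W x * v x" and v: "sq_int (lebesgue_on W) v"
    for u v :: "real^'n \<Rightarrow> real"
  proof -
    have vm: "v \<in> borel_measurable (lebesgue_on W)" "(\<lambda>x. (v x)\<^sup>2) \<in> borel_measurable (lebesgue_on W)"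
      using v by (auto simp: sq_int_def)
    have u2: "(\<lambda>x. (u x)\<^sup>2) \<in> borel_measurable borel" by measurable
    have uv2: "AE x in lebesgue. (u x)\<^sup>2 = indicator W x * (v x)\<^sup>2"
      using uv by eventually_elim (auto simp: indicator_def)
    note 1 = borel_representative_integral[OF W(1) vm(1) u uv, of "\<lambda>_. 1", simplified]
    note 2 = borel_representative_integral[OF W(1) vm(2) u2 uv2, of "\<lambda>_. 1", simplified]
    show "integrable lborel u" using 1(1) sq_int_imp_integrable[OF fin v] by simp
    show "integrable lborel (\<lambda>x. (u x)\<^sup>2)" using 2(1) v by (simp add: sq_int_def)
    show "(\<integral>x. (v x)\<^sup>2 \<partial>lebesgue_on W) = (\<integral>x. (u x)\<^sup>2 \<partial>lborel)" "(\<integral>x. v x \<partial>lebesgue_on W) = (\<integral>x. u x \<partial>lborel)"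
      using 1(2) 2(2) by simp_all
  qed
  note f0r = rep[OF f0(1,3) f] and G0r = rep[OF G0(1,3) G]
  define m where "m = measure lebesgue W"
  define I where "I = (\<integral>x. f0 x \<partial>lborel)"
  define J where "J = (\<integral>x. (f0 x)\<^sup>2 \<partial>lborel)"
  define E where "E = (\<integral>x. (norm (G x))\<^sup>2 \<partial>lebesgue_on W)"
  have emW: "emeasure lborel W < \<infinity>" using emeasure_bounded_finite[OF W(3)] by simp
  have iW: "integrable lborel (indicator W :: _ \<Rightarrow> real)" using emW by (intro integrable_real_indicator) auto
  have mW: "(\<integral>x. indicator W x \<partial>lborel) = m" unfolding m_def by simp
  have E: "(\<integral>\<^sup>+x. ennreal (\<Sum>i\<in>UNIV. (G0 i x)\<^sup>2) \<partial>lborel) = ennreal E"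
  proof -
    have "(\<integral>\<^sup>+x. ennreal (\<Sum>i\<in>UNIV. (G0 i x)\<^sup>2) \<partial>lborel) = ennreal (\<integral>x. (\<Sum>i\<in>UNIV. (G0 i x)\<^sup>2) \<partial>lborel)"
      using G0r(2) by (intro nn_integral_eq_integral) (auto simp: sum_nonneg)
    also have "(\<integral>x. (\<Sum>i\<in>UNIV. (G0 i x)\<^sup>2) \<partial>lborel) = (\<Sum>i\<in>UNIV. \<integral>x. (G0 i x)\<^sup>2 \<partial>lborel)"
      using G0r(2) by (intro Bochner_Integration.integral_sum) auto
    also have "\<dots> = (\<Sum>i\<in>UNIV. \<integral>x. (G x $ i)\<^sup>2 \<partial>lebesgue_on W)"
      using G0r(3) by simp
    also have "\<dots> = (\<integral>x. (\<Sum>i\<in>UNIV. (G x $ i)\<^sup>2) \<partial>lebesgue_on W)"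
      using G by (intro Bochner_Integration.integral_sum[symmetric]) (auto simp: sq_int_def)
    also have "\<dots> = E" unfolding E_def by (simp add: norm_vec_def L2_set_def sum_nonneg)
    finally show ?thesis .
  qed
  have E0: "0 \<le> E" by (simp add: E_def)
  define k where "k x y = indicator W x * indicator W y * (f0 y - f0 x)\<^sup>2" for x y
  have k[measurable]: "(\<lambda>(x, y). k x y) \<in> borel_measurable (lborel \<Otimes>\<^sub>M lborel)"
    unfolding k_def by measurable
  have inner: "integrable lborel (\<lambda>y. k x y) \<and> (\<integral>y. k x y \<partial>lborel) = indicator W x * (m * (f0 x)\<^sup>2 - 2 * I * f0 x + J)" for x
  proof -
    have eq: "k x = (\<lambda>y. indicator W x * ((f0 x)\<^sup>2 * indicator W y - 2 * f0 x * f0 y + (f0 y)\<^sup>2))"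
    proof
      show "k x y = indicator W x * ((f0 x)\<^sup>2 * indicator W y - 2 * f0 x * f0 y + (f0 y)\<^sup>2)" for y
        using f0(2)[of y] by (auto simp: k_def indicator_def power2_eq_square algebra_simps)
    qed
    have i: "integrable lborel (\<lambda>y. (f0 x)\<^sup>2 * indicator W y - 2 * f0 x * f0 y + (f0 y)\<^sup>2)"
      using iW f0r(1,2) by auto
    have "(\<integral>y. (f0 x)\<^sup>2 * indicator W y - 2 * f0 x * f0 y + (f0 y)\<^sup>2 \<partial>lborel) = (f0 x)\<^sup>2 * m - 2 * f0 x * I + J"
      using iW f0r(1,2) mW by (simp add: I_def J_def)
    then show ?thesis using i unfolding eq by (cases "x \<in> W") (simp_all add: mult.commute)
  qed
  have "(\<integral>\<^sup>+x. \<integral>\<^sup>+y. ennreal (k x y) \<partial>lborel \<partial>lborel) = (\<integral>\<^sup>+x. ennreal (\<integral>y. k x y \<partial>lborel) \<partial>lborel)"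
    using inner by (intro nn_integral_cong nn_integral_eq_integral) (auto simp: k_def)
  also have "\<dots> = ennreal (\<integral>x. (\<integral>y. k x y \<partial>lborel) \<partial>lborel)"
  proof (rule nn_integral_eq_integral)
    have "(\<lambda>x. \<integral>y. k x y \<partial>lborel) = (\<lambda>x. m * (f0 x)\<^sup>2 - 2 * I * f0 x + J * indicator W x)"
      using inner f0(2) by (auto simp: indicator_def fun_eq_iff)
    then show "integrable lborel (\<lambda>x. \<integral>y. k x y \<partial>lborel)"
      using iW f0r(1,2) by auto
    show "AE x in lborel. 0 \<le> (\<integral>y. k x y \<partial>lborel)" by (auto simp: k_def)
  qed
  also have "(\<integral>x. (\<integral>y. k x y \<partial>lborel) \<partial>lborel) = (\<integral>x. m * (f0 x)\<^sup>2 - 2 * I * f0 x + J * indicator W x \<partial>lborel)"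
    using inner f0(2) by (intro Bochner_Integration.integral_cong) (auto simp: indicator_def)
  also have "\<dots> = m * J - 2 * I * I + J * m"
    using iW f0r(1,2) mW by (simp add: I_def J_def)
  finally have lhs: "(\<integral>\<^sup>+x. \<integral>\<^sup>+y. ennreal (k x y) \<partial>lborel \<partial>lborel) = ennreal (2 * (m * J - I\<^sup>2))"
    by (simp add: power2_eq_square algebra_simps)
  have "(\<integral>\<^sup>+x. \<integral>\<^sup>+y. ennreal (k x y) \<partial>lborel \<partial>lborel) = (\<integral>\<^sup>+x. \<integral>\<^sup>+h. ennreal (k x (h + x)) \<partial>lborel \<partial>lborel)"
    by (intro nn_integral_cong nn_integral_lborel_translate[symmetric]) measurable
  also have "\<dots> = (\<integral>\<^sup>+h. \<integral>\<^sup>+x. ennreal (k x (h + x)) \<partial>lborel \<partial>lborel)"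
    by (rule lborel_pair.Fubini') (unfold k_def, measurable)
  also have "\<dots> \<le> (\<integral>\<^sup>+h. ennreal (d\<^sup>2 * E) * indicator (cball (0::real^'n) d) h \<partial>lborel)"
  proof (rule nn_integral_mono)
    fix h :: "real^'n"
    show "(\<integral>\<^sup>+x. ennreal (k x (h + x)) \<partial>lborel) \<le> ennreal (d\<^sup>2 * E) * indicator (cball 0 d) h"
    proof (cases "h \<in> cball 0 d")
      case True
      have "(\<integral>\<^sup>+x. ennreal (k x (h + x)) \<partial>lborel)
          = (\<integral>\<^sup>+x. indicator {x. x \<in> W \<and> x + h \<in> W} x * ennreal ((f0 (x + h) - f0 x)\<^sup>2) \<partial>lborel)"
        by (intro nn_integral_cong) (auto simp: k_def indicator_def add.commute)
      also have "\<dots> \<le> ennreal ((norm h)\<^sup>2) * ennreal E"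
        using weak_difference_bound[OF W(1,2) wg f0(1,3) f0r(1) G0(1,3) G0r(1)] unfolding E .
      also have "\<dots> \<le> ennreal (d\<^sup>2 * E)"
        using True E0 by (simp flip: ennreal_mult) (intro ennreal_leI mult_right_mono power_mono, auto)
      finally show ?thesis using True by simp
    next
      case False
      have "k x (h + x) = 0" for x
        using d[of x "h + x"] False by (auto simp: k_def indicator_def dist_norm)
      then show ?thesis by simp
    qed
  qed
  also have "\<dots> = ennreal (d\<^sup>2 * E * measure lebesgue (cball (0::real^'n) d))"
    using E0 emeasure_lborel_cball_finite[of "0::real^'n" d]
    by (simp add: nn_integral_cmult_indicator emeasure_eq_ennreal_measure ennreal_mult less_top[symmetric])
  finally show ?thesis
    using lhs E0 f0r(3,4) unfolding m_def[symmetric] E_def[symmetric]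
    by (simp add: I_def J_def ennreal_le_iff mult_ac)
qed

text \<open>Origin of the constant: the diameter bound is 2r and a ball of radius 2r has 2^n times
  the volume, so the convex case gives (2r)^2 2^n / 2 = 2^(n+1) r^2 after dividing by the
  volume.\<close>

lemma poincare_ball:
  fixes f :: "real^'n \<Rightarrow> real"
  assumes r: "0 < r" and wg: "weak_grad (ball c r) f G"
    and f: "sq_int (lebesgue_on (ball c r)) f" and G: "\<And>i. sq_int (lebesgue_on (ball c r)) (\<lambda>x. G x $ i)"
  shows "(\<integral>x. (f x)\<^sup>2 \<partial>lebesgue_on (ball c r)) - (\<integral>x. f x \<partial>lebesgue_on (ball c r))\<^sup>2 / measure lebesgue (ball c r)
    \<le> 2 ^ (CARD('n) + 1) * r\<^sup>2 * (\<integral>x. (norm (G x))\<^sup>2 \<partial>lebesgue_on (ball c r))"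
proof -
  let ?m = "measure lebesgue (ball c r)" and ?F = "\<integral>x. (f x)\<^sup>2 \<partial>lebesgue_on (ball c r)"
    and ?I = "\<integral>x. f x \<partial>lebesgue_on (ball c r)" and ?E = "\<integral>x. (norm (G x))\<^sup>2 \<partial>lebesgue_on (ball c r)"
  have m: "?m > 0" using content_ball_pos[OF r, of c] by simp
  have "measure lebesgue (cball (0::real^'n) (2 * r)) = 2 ^ CARD('n) * ?m"
    using r by (simp add: content_cball content_ball power_mult_distrib)
  moreover have "2 * (?m * ?F - ?I\<^sup>2) \<le> (2 * r)\<^sup>2 * measure lebesgue (cball (0::real^'n) (2 * r)) * ?E"
  proof (rule poincare_convex[OF _ _ _ wg f G])
    show "dist x y \<le> 2 * r" if "x \<in> ball c r" "y \<in> ball c r" for x y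
      using that dist_triangle2[of x y c] by (auto simp: dist_commute)
  qed auto
  ultimately have "?m * ?F - ?I\<^sup>2 \<le> ?m * (2 ^ (CARD('n) + 1) * r\<^sup>2 * ?E)"
    by (simp add: power2_eq_square mult_ac)
  then have "(?m * ?F - ?I\<^sup>2) / ?m \<le> 2 ^ (CARD('n) + 1) * r\<^sup>2 * ?E"
    using m by (simp add: divide_le_eq mult.commute)
  then show ?thesis using m by (simp add: diff_divide_distrib)
qed

section \<open>Sobolev functions and the extended Dirichlet space\<close>

lemma borel_measurable_lebesgue_AE:
  fixes f g :: "'a::euclidean_space \<Rightarrow> real"
  assumes g: "g \<in> borel_measurable lebesgue" and eq: "AE x in lebesgue. f x = g x"
  shows "f \<in> borel_measurable lebesgue"
proof (rule measurableI)
  fix A :: "real set" assume A: "A \<in> sets borel"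
  show "f -` A \<inter> space lebesgue \<in> sets lebesgue"
  proof (rule complete_measure.in_sets_AE[OF completion.complete_measure_axioms])
    show "g -` A \<inter> space lebesgue \<in> sets lebesgue" using measurable_sets[OF g A] .
    show "AE x in lebesgue. (x \<in> g -` A \<inter> space lebesgue) = (x \<in> f -` A \<inter> space lebesgue)"
      using eq by eventually_elim auto
  qed auto
qed auto

lemma borel_measurable_lebesgue_on_AE_LIMSEQ:
  fixes s :: "nat \<Rightarrow> 'a::euclidean_space \<Rightarrow> real"
  assumes W: "W \<in> sets lebesgue" and s: "\<And>k. s k \<in> borel_measurable (lebesgue_on W)"
    and lim: "AE x in lebesgue_on W. (\<lambda>k. s k x) \<longlonglongrightarrow> f x"
  shows "f \<in> borel_measurable (lebesgue_on W)"
proof -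
  have sm[measurable]: "(\<lambda>x. indicator W x * s k x) \<in> borel_measurable lebesgue" for k
    using s W by (simp add: lebesgue_on_measurable)
  have g: "(\<lambda>x. lim (\<lambda>k. indicator W x * s k x)) \<in> borel_measurable lebesgue" by measurable
  have "AE x in lebesgue. indicator W x * f x = lim (\<lambda>k. indicator W x * s k x)"
    using lim unfolding lebesgue_on_AE[OF W]
  proof eventually_elim
    case (elim x)
    then have "(\<lambda>k. indicator W x * s k x) \<longlonglongrightarrow> indicator W x * f x"
      by (cases "x \<in> W") auto
    then show ?case by (simp add: limI)
  qed
  then show ?thesis using borel_measurable_lebesgue_AE[OF g] W by (simp add: lebesgue_on_measurable)
qed

lemma L2_eq_sq_int: "L2 W f = sq_int (lebesgue_on W) f"
  by (simp add: L2_def sq_int_def)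

text \<open>Carries a weak gradient explicitly. \<open>wgrad\<close> is a choice, fixed only up to
  null sets, so computations are done with any convenient \<open>G\<close> and transferred by
  uniqueness.\<close>

definition sobolev :: "(real^'n) set \<Rightarrow> (real^'n \<Rightarrow> real) \<Rightarrow> (real^'n \<Rightarrow> real^'n) \<Rightarrow> bool" where
  "sobolev W f G \<longleftrightarrow> sq_int (lebesgue_on W) f \<and> weak_grad W f G \<and> (\<forall>i. sq_int (lebesgue_on W) (\<lambda>x. G x $ i))"

lemma H12_iff_sobolev: "H12 W f \<longleftrightarrow> (\<exists>G. sobolev W f G)"
  by (auto simp: H12_def sobolev_def L2_eq_sq_int)

lemma sobolev_wgrad: "H12 W f \<Longrightarrow> sobolev W f (wgrad W f)"
  unfolding H12_def sobolev_def wgrad_def L2_eq_sq_int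
  using someI_ex[of "\<lambda>G. weak_grad W f G \<and> (\<forall>i. sq_int (lebesgue_on W) (\<lambda>x. G x $ i))"] by blast

lemma sobolev_imp_H12: "sobolev W f G \<Longrightarrow> H12 W f"
  by (auto simp: H12_iff_sobolev)

lemma sobolev_unique:
  assumes "open W" "sobolev W f F" "sobolev W f G"
  shows "AE x in lebesgue_on W. F x = G x"
  using weak_grad_unique[OF _ _ assms(1)] assms by (auto simp: sobolev_def)

lemma sobolev_lincomb:
  assumes "open W" "sobolev W f F" "sobolev W g G"
  shows "sobolev W (\<lambda>x. a * f x + b * g x) (\<lambda>x. a *\<^sub>R F x + b *\<^sub>R G x)"
  using assms weak_grad_lincomb[of W f F g G a b] unfolding sobolev_def
  by (auto intro: sq_int_lincomb)

lemma sobolev_diff: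
  assumes "open W" "sobolev W f F" "sobolev W g G"
  shows "sobolev W (\<lambda>x. f x - g x) (\<lambda>x. F x - G x)"
  using sobolev_lincomb[OF assms, of 1 "-1"] by simp

section \<open>The Dirichlet form and local control by the energy\<close>

lemma sq_int_vec_inner:
  fixes F G :: "real^'n \<Rightarrow> real^'n"
  assumes "\<And>i. sq_int M (\<lambda>x. F x $ i)" "\<And>i. sq_int M (\<lambda>x. G x $ i)"
  shows "integrable M (\<lambda>x. F x \<bullet> G x)"
  unfolding inner_vec_def using sq_int_mult[OF assms] by simp

lemma inner_vec_measurable:
  fixes F G :: "real^'n \<Rightarrow> real^'n"
  assumes "\<And>i. sq_int M (\<lambda>x. F x $ i)" "\<And>i. sq_int M (\<lambda>x. G x $ i)"
  shows "(\<lambda>x. F x \<bullet> G x) \<in> borel_measurable M"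
  using sq_int_vec_inner[OF assms] by (rule borel_measurable_integrable)

definition Dform :: "(real^'n) set \<Rightarrow> (real^'n \<Rightarrow> real) \<Rightarrow> (real^'n \<Rightarrow> real) \<Rightarrow> real" where
  "Dform W f g = (\<integral>x. wgrad W f x \<bullet> wgrad W g x \<partial>lebesgue_on W)"

lemma Dform_eq:
  assumes W: "open W" and f: "sobolev W f F" and g: "sobolev W g G"
  shows "Dform W f g = (\<integral>x. F x \<bullet> G x \<partial>lebesgue_on W)"
proof -
  note f' = sobolev_wgrad[OF sobolev_imp_H12[OF f]] and g' = sobolev_wgrad[OF sobolev_imp_H12[OF g]]
  have "AE x in lebesgue_on W. wgrad W f x \<bullet> wgrad W g x = F x \<bullet> G x"
    using sobolev_unique[OF W f' f] sobolev_unique[OF W g' g] by eventually_elim simp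
  then show ?thesis unfolding Dform_def
    using f g f' g' by (intro integral_cong_AE inner_vec_measurable) (auto simp: sobolev_def)
qed

lemma Dir_eq_Dform: "Dir W f = Dform W f f"
  by (simp add: Dir_def Dform_def power2_norm_eq_inner)

lemma Dir_eq:
  assumes "open W" "sobolev W f F"
  shows "Dir W f = (\<integral>x. (norm (F x))\<^sup>2 \<partial>lebesgue_on W)"
  using Dform_eq[OF assms(1) assms(2) assms(2)] by (simp add: Dir_eq_Dform power2_norm_eq_inner)

lemma H12_lincomb: "open W \<Longrightarrow> H12 W f \<Longrightarrow> H12 W g \<Longrightarrow> H12 W (\<lambda>x. a * f x + b * g x)"
  unfolding H12_iff_sobolev by (elim exE) (rule exI, rule sobolev_lincomb)

lemma semi_inner_Dform:
  assumes W: "open W"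
  shows "semi_inner {f. H12 W f} (Dform W)"
proof
  fix f g h :: "real^'a \<Rightarrow> real" and a b
  assume f: "f \<in> {f. H12 W f}" and g: "g \<in> {f. H12 W f}"
  show "(\<lambda>x. a * f x + b * g x) \<in> {f. H12 W f}" using f g H12_lincomb[OF W] by blast
  show "Dform W f g = Dform W g f" by (simp add: Dform_def inner_commute)
  assume h: "h \<in> {f. H12 W f}"
  have f': "sobolev W f (wgrad W f)" and g': "sobolev W g (wgrad W g)" and h': "sobolev W h (wgrad W h)"
    using f g h sobolev_wgrad by auto
  have i: "integrable (lebesgue_on W) (\<lambda>x. wgrad W f x \<bullet> wgrad W h x)"
    "integrable (lebesgue_on W) (\<lambda>x. wgrad W g x \<bullet> wgrad W h x)"
    using f' g' h' by (auto simp: sobolev_def intro!: sq_int_vec_inner)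
  show "Dform W (\<lambda>x. a * f x + b * g x) h = a * Dform W f h + b * Dform W g h"
    using Dform_eq[OF W sobolev_lincomb[OF W f' g', of a b] h'] Dform_eq[OF W f' h'] Dform_eq[OF W g' h'] i
    by (simp add: inner_add_left)
qed (auto simp: Dform_def)

lemma ball_measure_pos: "0 < r \<Longrightarrow> 0 < measure lebesgue (ball (c::'a::euclidean_space) r)"
  using content_ball_pos[of r c] by simp

lemma finite_measure_ball: "finite_measure (lebesgue_on (ball (c::'a::euclidean_space) r))"
  by (rule finite_measure_lebesgue_on_open) auto

lemma measure_lebesgue_on_space: "S \<in> sets lebesgue \<Longrightarrow> measure (lebesgue_on S) (space (lebesgue_on S)) = measure lebesgue S"
  by (simp add: measure_restrict_space)

lemma integral_square_minus_mean:
  assumes M: "finite_measure M" "measure M (space M) = m" "m > 0" and u: "sq_int M u"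
  shows "(\<integral>x. (u x - (\<integral>x. u x \<partial>M) / m)\<^sup>2 \<partial>M) = (\<integral>x. (u x)\<^sup>2 \<partial>M) - (\<integral>x. u x \<partial>M)\<^sup>2 / m"
proof -
  define I where "I = (\<integral>x. u x \<partial>M)"
  have i: "integrable M u" "integrable M (\<lambda>x. (u x)\<^sup>2)" "\<And>c. integrable M (\<lambda>x. c :: real)"
    using sq_int_imp_integrable[OF M(1) u] u finite_measure.integrable_const[OF M(1)] by (auto simp: sq_int_def)
  have "(\<integral>x. (u x - I / m)\<^sup>2 \<partial>M) = (\<integral>x. (u x)\<^sup>2 - (2 * I / m) * u x + (I / m)\<^sup>2 \<partial>M)"
    by (intro Bochner_Integration.integral_cong) (auto simp: power2_eq_square algebra_simps)
  also have "\<dots> = (\<integral>x. (u x)\<^sup>2 \<partial>M) - (2 * I / m) * I + (I / m)\<^sup>2 * m"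
    using i M(2) by (simp add: I_def)
  also have "\<dots> = (\<integral>x. (u x)\<^sup>2 \<partial>M) - I\<^sup>2 / m"
    using M(3) by (simp add: field_simps power2_eq_square)
  finally show ?thesis by (simp add: I_def)
qed

text \<open>By Poincare the \<open>s k\<close> are Cauchy up to constants; the constants are controlled on a set of
  positive measure where the \<open>s k\<close> are uniformly bounded, since there dominated convergence applies.\<close>

lemma cauchy_of_gradient_cauchy:
  fixes s :: "nat \<Rightarrow> real^'n \<Rightarrow> real"
  assumes r: "0 < r" and s: "\<And>k. sobolev (ball c r) (s k) (G k)"
    and cauchy: "\<And>e. e > 0 \<Longrightarrow> \<exists>N. \<forall>m\<ge>N. \<forall>k\<ge>N. (\<integral>x. (norm (G m x - G k x))\<^sup>2 \<partial>lebesgue_on (ball c r)) < e"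
    and lim: "AE x in lebesgue_on (ball c r). (\<lambda>k. s k x) \<longlonglongrightarrow> f x"
    and e: "e > 0"
  shows "\<exists>N. \<forall>m\<ge>N. \<forall>k\<ge>N. (\<integral>x. (s m x - s k x)\<^sup>2 \<partial>lebesgue_on (ball c r)) < e"
proof -
  let ?B = "ball c r"
  let ?M = "lebesgue_on ?B"
  interpret finite_measure ?M by (rule finite_measure_ball)
  define v where "v = measure lebesgue ?B"
  have v: "v > 0" unfolding v_def by (rule ball_measure_pos[OF r])
  have spv: "measure ?M (space ?M) = v" unfolding v_def by (rule measure_lebesgue_on_space) simp
  define P :: real where "P = 2 ^ (CARD('n) + 1) * r\<^sup>2"
  have P: "P > 0" using r by (simp add: P_def)
  have sq: "sq_int ?M (s k)" for k using s by (simp add: sobolev_def)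
  have sm[measurable]: "s k \<in> borel_measurable ?M" for k using sq by (simp add: sq_int_def)
  have fm[measurable]: "f \<in> borel_measurable ?M"
    by (rule borel_measurable_lebesgue_on_AE_LIMSEQ[OF _ sm lim]) simp
  define a where "a m k = (\<integral>x. s m x - s k x \<partial>?M) / v" for m k
  have poin: "(\<integral>x. (s m x - s k x - a m k)\<^sup>2 \<partial>?M) \<le> P * (\<integral>x. (norm (G m x - G k x))\<^sup>2 \<partial>?M)"
    and split: "(\<integral>x. (s m x - s k x)\<^sup>2 \<partial>?M) = (\<integral>x. (s m x - s k x - a m k)\<^sup>2 \<partial>?M) + (a m k)\<^sup>2 * v" for m k
  proof -
    have d: "sobolev ?B (\<lambda>x. s m x - s k x) (\<lambda>x. G m x - G k x)"
      by (rule sobolev_diff[OF _ s s]) simp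
    have m: "(\<integral>x. (s m x - s k x - a m k)\<^sup>2 \<partial>?M) = (\<integral>x. (s m x - s k x)\<^sup>2 \<partial>?M) - (\<integral>x. s m x - s k x \<partial>?M)\<^sup>2 / v"
      unfolding a_def using integral_square_minus_mean[OF finite_measure_axioms spv v sq_int_diff[OF sq sq]] .
    show "(\<integral>x. (s m x - s k x - a m k)\<^sup>2 \<partial>?M) \<le> P * (\<integral>x. (norm (G m x - G k x))\<^sup>2 \<partial>?M)"
      unfolding m P_def v_def using d by (intro poincare_ball r) (auto simp: sobolev_def)
    show "(\<integral>x. (s m x - s k x)\<^sup>2 \<partial>?M) = (\<integral>x. (s m x - s k x - a m k)\<^sup>2 \<partial>?M) + (a m k)\<^sup>2 * v"
      unfolding m using v by (simp add: a_def power2_eq_square)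
  qed
  \<comment> \<open>A convergent sequence is bounded, so almost every point lies in some
    \<open>A n\<close>, and one of these sets has positive measure. On it the sequence is dominated
    by a constant.\<close>
  define A where "A n = {x \<in> space ?M. \<forall>k. \<bar>s k x\<bar> \<le> real n}" for n
  have [measurable]: "A n \<in> sets ?M" for n unfolding A_def by measurable
  have "\<exists>n. emeasure ?M (A n) \<noteq> 0"
  proof (rule ccontr)
    assume "\<not> ?thesis"
    then have "A n \<in> null_sets ?M" for n by (auto simp: null_sets_def)
    then have "(\<Union>n. A n) \<in> null_sets ?M" by (rule null_sets_UN)
    then have "AE x in ?M. x \<notin> (\<Union>n. A n)" by (rule AE_not_in)
    with lim have "AE x in ?M. False"
    proof (rule AE_mp[OF _ AE_mp[OF _ AE_I2]], intro impI)
      fix x assume x: "x \<in> space ?M" "x \<notin> (\<Union>n. A n)" "(\<lambda>k. s k x) \<longlonglongrightarrow> f x"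
      then have "Bseq (\<lambda>k. s k x)" by (intro convergent_imp_Bseq) (auto simp: convergent_def)
      then obtain K where K: "\<And>k. \<bar>s k x\<bar> \<le> K" by (auto simp: Bseq_def)
      obtain n :: nat where "K \<le> real n" using real_arch_simple by blast
      then have "x \<in> A n" using K x(1) order_trans by (fastforce simp: A_def)
      then show False using x by blast
    qed
    then have "emeasure ?M (space ?M) = 0"
      by (subst (asm) AE_iff_measurable[OF sets.top]) auto
    then show False using spv v by (simp add: measure_def)
  qed
  then obtain n where n: "emeasure ?M (A n) \<noteq> 0" by blast
  define w where "w = measure ?M (A n)"
  have w: "w > 0" using n unfolding w_def
    by (simp add: emeasure_eq_measure zero_less_measure_iff)
  have indA: "integrable ?M (indicator (A n) :: _ \<Rightarrow> real)" by (intro integrable_real_indicator) (auto simp: less_top[symmetric])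
  have "(\<lambda>k. \<integral>x. indicator (A n) x * \<bar>s k x - f x\<bar> \<partial>?M) \<longlonglongrightarrow> (\<integral>x. 0 \<partial>?M)"
  proof (rule integral_dominated_convergence[where w="\<lambda>x. 2 * real n * indicator (A n) x"])
    show "AE x in ?M. (\<lambda>k. indicator (A n) x * \<bar>s k x - f x\<bar>) \<longlonglongrightarrow> 0"
      using lim
    proof eventually_elim
      case (elim x)
      have "(\<lambda>k. indicator (A n) x * \<bar>s k x - f x\<bar>) \<longlonglongrightarrow> indicator (A n) x * \<bar>f x - f x\<bar>"
        by (intro tendsto_intros elim)
      then show ?case by simp
    qed
    show "AE x in ?M. norm (indicator (A n) x * \<bar>s k x - f x\<bar>) \<le> 2 * real n * indicator (A n) x" for k
      using lim
    proof eventually_elim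
      case (elim x)
      show ?case
      proof (cases "x \<in> A n")
        case True
        then have b: "\<bar>s k x\<bar> \<le> real n" for k by (simp add: A_def)
        have "\<bar>f x\<bar> \<le> real n"
          by (rule LIMSEQ_le_const2[OF tendsto_rabs[OF elim]]) (use b in auto)
        then show ?thesis using b[of k] True by simp
      qed simp
    qed
  qed (use indA in auto)
  then have L1A: "(\<lambda>k. \<integral>x. indicator (A n) x * \<bar>s k x - f x\<bar> \<partial>?M) \<longlonglongrightarrow> 0" by simp
  have iA: "integrable ?M (\<lambda>x. indicator (A n) x * \<bar>s k x - f x\<bar>)" for k
  proof (rule Bochner_Integration.integrable_bound[OF integrable_mult_right[OF indA, of "2 * real n"]])
    show "AE x in ?M. norm (indicator (A n) x * \<bar>s k x - f x\<bar>) \<le> norm (2 * real n * indicator (A n) x :: real)"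
      using lim
    proof eventually_elim
      case (elim x)
      show ?case
      proof (cases "x \<in> A n")
        case True
        then have b: "\<bar>s k x\<bar> \<le> real n" for k by (simp add: A_def)
        have "\<bar>f x\<bar> \<le> real n"
          by (rule LIMSEQ_le_const2[OF tendsto_rabs[OF elim]]) (use b in auto)
        then show ?thesis using b[of k] True by simp
      qed simp
    qed
  qed measurable
  \<comment> \<open>Three errors below \<delta> give
    \<open>\<bar>a m k\<bar> * w < 3 * \<delta>\<close>, which is exactly what makes
    \<open>(a m k)\<^sup>2 * v\<close> less than \<open>e / 2\<close>.\<close>
  define \<delta> where "\<delta> = sqrt (e / (2 * v)) * w / 3"
  have \<delta>: "\<delta> > 0" using e v w by (simp add: \<delta>_def)
  obtain N1 where N1: "\<And>k. k \<ge> N1 \<Longrightarrow> (\<integral>x. indicator (A n) x * \<bar>s k x - f x\<bar> \<partial>?M) < \<delta>"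
    using LIMSEQ_D[OF L1A \<delta>] by (auto simp: abs_less_iff)
  \<comment> \<open>Through Poincare an energy below \<open>e'\<close> makes the oscillation smaller
    than \<open>e / 2\<close>, and smaller than \<delta>^2 / v, so that its L1 norm is below
    \<delta>.\<close>
  define e' where "e' = min (e / 2) (\<delta>\<^sup>2 / v) / (2 * P)"
  have "e' > 0" using e \<delta> v P by (simp add: e'_def)
  then obtain N2 where N2: "\<And>m k. m \<ge> N2 \<Longrightarrow> k \<ge> N2 \<Longrightarrow> (\<integral>x. (norm (G m x - G k x))\<^sup>2 \<partial>?M) < e'"
    using cauchy by meson
  have "(\<integral>x. (s m x - s k x)\<^sup>2 \<partial>?M) < e" if mk: "m \<ge> max N1 N2" "k \<ge> max N1 N2" for m k
  proof -
    have "P * (\<integral>x. (norm (G m x - G k x))\<^sup>2 \<partial>?M) < P * e'" using N2[of m k] mk P by simp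
    also have "P * e' = min (e / 2) (\<delta>\<^sup>2 / v) / 2" using P by (simp add: e'_def)
    finally have osc: "(\<integral>x. (s m x - s k x - a m k)\<^sup>2 \<partial>?M) < min (e / 2) (\<delta>\<^sup>2 / v) / 2"
      using poin[of m k] by simp
    have mpos: "min (e / 2) (\<delta>\<^sup>2 / v) > 0" using e \<delta> v by simp
    have half: "x < q / 2 \<Longrightarrow> 0 < q \<Longrightarrow> q \<le> y \<Longrightarrow> x < y" for x q y :: real by linarith
    note osc1 = half[OF osc mpos min.cobounded1] and osc2 = half[OF osc mpos min.cobounded2]
    have sqd: "sq_int ?M (\<lambda>x. s m x - s k x - a m k)"
      by (intro sq_int_diff sq sq_int_const finite_measure_axioms)
    have "(\<integral>x. \<bar>s m x - s k x - a m k\<bar> \<partial>?M)\<^sup>2 \<le> v * (\<integral>x. (s m x - s k x - a m k)\<^sup>2 \<partial>?M)"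
      using integral_abs_le_L2[OF finite_measure_axioms sqd] spv by simp
    also have "\<dots> < \<delta>\<^sup>2" using osc2 v by (simp add: field_simps)
    finally have L1: "(\<integral>x. \<bar>s m x - s k x - a m k\<bar> \<partial>?M) < \<delta>" using \<delta> power2_less_imp_less[of _ \<delta>] by simp
    have iabs: "integrable ?M (\<lambda>x. \<bar>s m x - s k x - a m k\<bar>)"
      using sq_int_imp_integrable[OF finite_measure_axioms sqd] by simp
    have AB: "A n \<inter> ball c r = A n" by (auto simp: A_def)
    have "\<bar>a m k\<bar> * w = (\<integral>x. indicator (A n) x * \<bar>a m k\<bar> \<partial>?M)" using indA by (simp add: w_def AB)
    also have "\<dots> \<le> (\<integral>x. indicator (A n) x * \<bar>s m x - f x\<bar> + indicator (A n) x * \<bar>s k x - f x\<bar> + \<bar>s m x - s k x - a m k\<bar> \<partial>?M)"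
    proof (rule integral_mono_AE)
      show "integrable ?M (\<lambda>x. indicator (A n) x * \<bar>a m k\<bar>)" using indA by simp
      show "integrable ?M (\<lambda>x. indicator (A n) x * \<bar>s m x - f x\<bar> + indicator (A n) x * \<bar>s k x - f x\<bar> + \<bar>s m x - s k x - a m k\<bar>)"
        using iA iabs by simp
    qed (auto simp: indicator_def)
    also have "\<dots> = (\<integral>x. indicator (A n) x * \<bar>s m x - f x\<bar> \<partial>?M) + (\<integral>x. indicator (A n) x * \<bar>s k x - f x\<bar> \<partial>?M)
        + (\<integral>x. \<bar>s m x - s k x - a m k\<bar> \<partial>?M)"
      using iA iabs by simp
    also have "\<dots> < 3 * \<delta>" using N1[of m] N1[of k] mk L1 by simp
    finally have "\<bar>a m k\<bar> * w < sqrt (e / (2 * v)) * w" by (simp add: \<delta>_def)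
    then have "\<bar>a m k\<bar> < sqrt (e / (2 * v))" using w by simp
    then have "\<bar>a m k\<bar>\<^sup>2 < (sqrt (e / (2 * v)))\<^sup>2" by (intro power_strict_mono) auto
    then have "(a m k)\<^sup>2 < e / (2 * v)" using e v by simp
    then have "(a m k)\<^sup>2 * v < e / 2" using v by (simp add: field_simps)
    then show ?thesis using split[of m k] osc1 by simp
  qed
  then show ?thesis by blast
qed

lemma sobolev_mono:
  assumes "sobolev W f G" "V \<subseteq> W" "open V" "open W"
  shows "sobolev V f G"
proof -
  note [simp] = open_sets_lebesgue[OF assms(3)] open_sets_lebesgue[OF assms(4)]
  have "sq_int (lebesgue_on V) u" if "sq_int (lebesgue_on W) u" for u
    unfolding sq_int_def
  proof
    show "u \<in> borel_measurable (lebesgue_on V)"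
      using that by (intro measurable_restrict_mono[OF _ assms(2)]) (simp add: sq_int_def)
    show "integrable (lebesgue_on V) (\<lambda>x. (u x)\<^sup>2)"
      using that by (intro integrable_lebesgue_on_subset[OF _ assms(2)]) (simp_all add: sq_int_def)
  qed
  then show ?thesis
    using assms(1) weak_grad_mono[OF _ assms(2-4), of f G] unfolding sobolev_def by simp
qed

lemma integral_gradient_mono:
  fixes F :: "real^'n \<Rightarrow> real^'n"
  assumes "\<And>i. sq_int (lebesgue_on W) (\<lambda>x. F x $ i)" "V \<subseteq> W" "open V" "open W"
  shows "(\<integral>x. (norm (F x))\<^sup>2 \<partial>lebesgue_on V) \<le> (\<integral>x. (norm (F x))\<^sup>2 \<partial>lebesgue_on W)"
  using sq_int_vec_inner[OF assms(1) assms(1)] assms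
  by (intro integral_mono_lebesgue_on_AE) (auto simp: power2_norm_eq_inner open_sets_lebesgue)

text \<open>On a ball inside \<open>W\<close> almost everywhere convergence and small energy
  differences upgrade to L2 convergence; on all of \<open>W\<close> there is no Poincare inequality
  to do this.\<close>

lemma sq_int_on_ball_of_approx:
  fixes s :: "nat \<Rightarrow> real^'n \<Rightarrow> real"
  assumes W: "open W" and s: "\<And>k. sobolev W (s k) (G k)"
    and cauchy: "\<And>e. e > 0 \<Longrightarrow> \<exists>N. \<forall>m\<ge>N. \<forall>k\<ge>N. (\<integral>x. (norm (G m x - G k x))\<^sup>2 \<partial>lebesgue_on W) < e"
    and lim: "AE x in lebesgue_on W. (\<lambda>k. s k x) \<longlonglongrightarrow> f x"
    and B: "ball c r \<subseteq> W" "0 < r"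
  shows "sq_int (lebesgue_on (ball c r)) f"
    and "(\<lambda>k. \<integral>x. (s k x - f x)\<^sup>2 \<partial>lebesgue_on (ball c r)) \<longlonglongrightarrow> 0"
proof -
  have sB: "sobolev (ball c r) (s k) (G k)" for k by (rule sobolev_mono[OF s B(1) open_ball W])
  have sq: "sq_int (lebesgue_on (ball c r)) (s k)" for k using sB by (simp add: sobolev_def)
  have limB: "AE x in lebesgue_on (ball c r). (\<lambda>k. s k x) \<longlonglongrightarrow> f x"
    using lim B(1) W by (auto simp: lebesgue_on_AE open_sets_lebesgue elim!: eventually_mono)
  have cB: "\<exists>N. \<forall>m\<ge>N. \<forall>k\<ge>N. (\<integral>x. (norm (G m x - G k x))\<^sup>2 \<partial>lebesgue_on (ball c r)) < e" if e: "e > 0" for e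
  proof -
    have "(\<integral>x. (norm (G m x - G k x))\<^sup>2 \<partial>lebesgue_on (ball c r)) \<le> (\<integral>x. (norm (G m x - G k x))\<^sup>2 \<partial>lebesgue_on W)" for m k
      using sobolev_diff[OF W s s, of m k] by (intro integral_gradient_mono[OF _ B(1) open_ball W]) (simp add: sobolev_def)
    then show ?thesis using cauchy[OF e] by (meson le_less_trans)
  qed
  have fm: "f \<in> borel_measurable (lebesgue_on (ball c r))"
    using sq by (intro borel_measurable_lebesgue_on_AE_LIMSEQ[OF _ _ limB]) (auto simp: sq_int_def)
  note c = cauchy_of_gradient_cauchy[OF B(2) sB cB limB]
  show "sq_int (lebesgue_on (ball c r)) f"
    and "(\<lambda>k. \<integral>x. (s k x - f x)\<^sup>2 \<partial>lebesgue_on (ball c r)) \<longlonglongrightarrow> 0"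
    using sq_int_AE_limit[OF sq c strict_mono_id _ fm] limB by auto
qed

lemma gradient_limit:
  fixes G :: "nat \<Rightarrow> real^'n \<Rightarrow> real^'n"
  assumes fin: "finite_measure M" and G: "\<And>k i. sq_int M (\<lambda>x. G k x $ i)"
    and cauchy: "\<And>e. e > 0 \<Longrightarrow> \<exists>N. \<forall>m\<ge>N. \<forall>k\<ge>N. (\<integral>x. (norm (G m x - G k x))\<^sup>2 \<partial>M) < e"
  obtains H where "\<And>i. sq_int M (\<lambda>x. H x $ i)" "\<And>i. (\<lambda>k. \<integral>x. (G k x $ i - H x $ i)\<^sup>2 \<partial>M) \<longlonglongrightarrow> 0"
    "(\<lambda>k. \<integral>x. (norm (G k x - H x))\<^sup>2 \<partial>M) \<longlonglongrightarrow> 0"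
    "(\<lambda>k. \<integral>x. (norm (G k x))\<^sup>2 \<partial>M) \<longlonglongrightarrow> (\<integral>x. (norm (H x))\<^sup>2 \<partial>M)"
proof -
  have comp: "\<exists>h. sq_int M h \<and> (\<lambda>k. \<integral>x. (G k x $ i - h x)\<^sup>2 \<partial>M) \<longlonglongrightarrow> 0" for i
  proof -
    have d: "sq_int M (\<lambda>x. (G m x - G k x) $ j)" for m k j using sq_int_diff[OF G[of m j] G[of k j]] by simp
    have "(\<integral>x. (G m x $ i - G k x $ i)\<^sup>2 \<partial>M) \<le> (\<integral>x. (norm (G m x - G k x))\<^sup>2 \<partial>M)" for m k
    proof (rule integral_mono_AE)
      show "integrable M (\<lambda>x. (G m x $ i - G k x $ i)\<^sup>2)" using sq_int_diff[OF G[of m i] G[of k i]] by (simp add: sq_int_def)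
      show "integrable M (\<lambda>x. (norm (G m x - G k x))\<^sup>2)"
        unfolding power2_norm_eq_inner by (rule sq_int_vec_inner[OF d d])
      show "AE x in M. (G m x $ i - G k x $ i)\<^sup>2 \<le> (norm (G m x - G k x))\<^sup>2"
        using component_le_norm_cart[of "G m _ - G k _" i] by (intro AE_I2) (metis abs_le_square_iff abs_norm_cancel vector_minus_component)
    qed
    then have "\<exists>N. \<forall>m\<ge>N. \<forall>k\<ge>N. (\<integral>x. (G m x $ i - G k x $ i)\<^sup>2 \<partial>M) < e" if "e > 0" for e
      using cauchy[OF that] by (meson le_less_trans)
    then obtain g where "sq_int M g" "(\<lambda>k. \<integral>x. (G k x $ i - g x)\<^sup>2 \<partial>M) \<longlonglongrightarrow> 0"
      by (rule sq_int_complete[OF fin, of "\<lambda>k x. G k x $ i", OF G]) blast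
    then show ?thesis by blast
  qed
  define h where "h i = (SOME h. sq_int M h \<and> (\<lambda>k. \<integral>x. (G k x $ i - h x)\<^sup>2 \<partial>M) \<longlonglongrightarrow> 0)" for i
  have h: "sq_int M (h i)" "(\<lambda>k. \<integral>x. (G k x $ i - h i x)\<^sup>2 \<partial>M) \<longlonglongrightarrow> 0" for i
    using someI_ex[OF comp[of i]] by (simp_all add: h_def)
  define H where "H x = (\<chi> i. h i x)" for x
  have H: "sq_int M (\<lambda>x. H x $ i)" "(\<lambda>k. \<integral>x. (G k x $ i - H x $ i)\<^sup>2 \<partial>M) \<longlonglongrightarrow> 0" for i
    using h by (simp_all add: H_def)
  have nrm: "(\<integral>x. (norm (F x))\<^sup>2 \<partial>M) = (\<Sum>i\<in>UNIV. \<integral>x. (F x $ i)\<^sup>2 \<partial>M)"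
    if "\<And>i. sq_int M (\<lambda>x. F x $ i)" for F :: "_ \<Rightarrow> real^'n"
    using that by (subst Bochner_Integration.integral_sum[symmetric])
      (auto simp: sq_int_def norm_vec_def L2_set_def sum_nonneg)
  have dsq: "sq_int M (\<lambda>x. (G k x - H x) $ i)" for k i using sq_int_diff[OF G H(1)] by simp
  have n0: "(\<lambda>k. \<integral>x. (norm (G k x - H x))\<^sup>2 \<partial>M) \<longlonglongrightarrow> 0"
    unfolding nrm[OF dsq] using tendsto_sum[of UNIV "\<lambda>i k. \<integral>x. ((G k x - H x) $ i)\<^sup>2 \<partial>M" "\<lambda>_. 0"] H(2) by simp
  have "(\<lambda>k. \<integral>x. (G k x $ i)\<^sup>2 \<partial>M) \<longlonglongrightarrow> (\<integral>x. (H x $ i)\<^sup>2 \<partial>M)" for i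
  proof -
    have e: "(\<integral>x. (G k x $ i)\<^sup>2 \<partial>M) = (\<integral>x. (G k x $ i - H x $ i)\<^sup>2 \<partial>M) + 2 * (\<integral>x. (G k x $ i - H x $ i) * H x $ i \<partial>M) + (\<integral>x. (H x $ i)\<^sup>2 \<partial>M)" for k
    proof -
      have d: "sq_int M (\<lambda>x. G k x $ i - H x $ i)" by (rule sq_int_diff[OF G H(1)])
      have "(\<integral>x. (G k x $ i)\<^sup>2 \<partial>M) = (\<integral>x. (G k x $ i - H x $ i)\<^sup>2 + 2 * ((G k x $ i - H x $ i) * H x $ i) + (H x $ i)\<^sup>2 \<partial>M)"
        by (intro Bochner_Integration.integral_cong) (auto simp: power2_eq_square algebra_simps)
      also have "\<dots> = (\<integral>x. (G k x $ i - H x $ i)\<^sup>2 \<partial>M) + 2 * (\<integral>x. (G k x $ i - H x $ i) * H x $ i \<partial>M) + (\<integral>x. (H x $ i)\<^sup>2 \<partial>M)"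
        using d H(1)[of i] sq_int_mult[OF d H(1)[of i]] by (simp add: sq_int_def)
      finally show ?thesis .
    qed
    have "(\<lambda>k. \<integral>x. (G k x $ i - H x $ i) * H x $ i \<partial>M) \<longlonglongrightarrow> 0"
    proof (rule tendsto_rabs_zero_cancel, rule Lim_null_comparison)
      show "\<forall>\<^sub>F k in sequentially. norm \<bar>\<integral>x. (G k x $ i - H x $ i) * H x $ i \<partial>M\<bar>
          \<le> sqrt ((\<integral>x. (G k x $ i - H x $ i)\<^sup>2 \<partial>M) * (\<integral>x. (H x $ i)\<^sup>2 \<partial>M))"
        using integral_Cauchy_Schwarz[OF sq_int_diff[OF G H(1)] H(1)]
        by (intro always_eventually allI) (auto intro!: real_le_rsqrt)
      show "(\<lambda>k. sqrt ((\<integral>x. (G k x $ i - H x $ i)\<^sup>2 \<partial>M) * (\<integral>x. (H x $ i)\<^sup>2 \<partial>M))) \<longlonglongrightarrow> 0"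
        using tendsto_real_sqrt[OF tendsto_mult_left_zero[OF H(2)]] by simp
    qed
    then show ?thesis unfolding e using tendsto_add[OF tendsto_add[OF H(2) tendsto_mult_left[of _ 0 _ 2]] tendsto_const] by fastforce
  qed
  then have "(\<lambda>k. \<integral>x. (norm (G k x))\<^sup>2 \<partial>M) \<longlonglongrightarrow> (\<integral>x. (norm (H x))\<^sup>2 \<partial>M)"
    unfolding nrm[OF G] nrm[OF H(1)] by (intro tendsto_sum)
  with that H n0 show thesis by blast
qed

section \<open>Identification of the extended Dirichlet space\<close>

lemma L1_tendsto_of_L2_tendsto:
  assumes fin: "finite_measure M" and u: "\<And>k. sq_int M (u k)"
    and lim: "(\<lambda>k. \<integral>x. (u k x)\<^sup>2 \<partial>M) \<longlonglongrightarrow> 0"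
  shows "(\<lambda>k. \<integral>x. \<bar>u k x\<bar> \<partial>M) \<longlonglongrightarrow> 0"
proof (rule Lim_null_comparison)
  show "\<forall>\<^sub>F k in sequentially. norm (\<integral>x. \<bar>u k x\<bar> \<partial>M) \<le> sqrt (measure M (space M) * (\<integral>x. (u k x)\<^sup>2 \<partial>M))"
    using integral_abs_le_L2[OF fin u] by (intro always_eventually allI) (auto intro!: real_le_rsqrt)
  show "(\<lambda>k. sqrt (measure M (space M) * (\<integral>x. (u k x)\<^sup>2 \<partial>M))) \<longlonglongrightarrow> 0"
    using tendsto_real_sqrt[OF tendsto_mult_right_zero[OF lim]] by simp
qed

lemma L1_tendsto_subset:
  fixes u :: "nat \<Rightarrow> 'a::euclidean_space \<Rightarrow> real"
  assumes "\<And>k. integrable (lebesgue_on W) (u k)" "K \<subseteq> W" "K \<in> sets lebesgue" "W \<in> sets lebesgue"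
    and lim: "(\<lambda>k. \<integral>x. \<bar>u k x\<bar> \<partial>lebesgue_on W) \<longlonglongrightarrow> 0"
  shows "(\<lambda>k. \<integral>x. \<bar>u k x\<bar> \<partial>lebesgue_on K) \<longlonglongrightarrow> 0"
proof (rule Lim_null_comparison[OF _ lim])
  show "\<forall>\<^sub>F k in sequentially. norm (\<integral>x. \<bar>u k x\<bar> \<partial>lebesgue_on K) \<le> (\<integral>x. \<bar>u k x\<bar> \<partial>lebesgue_on W)"
    using assms by (intro always_eventually allI) (auto intro!: integral_mono_lebesgue_on_AE)
qed

lemma compact_ball_cover:
  fixes K :: "'a::euclidean_space set"
  assumes "compact K" "K \<subseteq> W" "open W"
  obtains I r where "finite I" "K \<subseteq> (\<Union>c\<in>I. ball c (r c))" "\<And>c. c \<in> I \<Longrightarrow> ball c (r c) \<subseteq> W \<and> 0 < r c"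
proof -
  have "\<forall>c\<in>K. \<exists>e>0. ball c e \<subseteq> W" using assms open_contains_ball by blast
  then obtain r where r: "\<And>c. c \<in> K \<Longrightarrow> 0 < r c \<and> ball c (r c) \<subseteq> W" by metis
  obtain I where "I \<subseteq> K" "finite I" "K \<subseteq> (\<Union>c\<in>I. ball c (r c))"
    by (rule compactE_image[OF assms(1), of K "\<lambda>c. ball c (r c)"]) (use r in auto)
  then show thesis using that[of I r] r by blast
qed

text \<open>The gradients converge in L2 on all of \<open>W\<close>, the functions only locally, by
  covering compact sets with balls inside \<open>W\<close>. This asymmetry is harmless, since the
  weak gradient is tested with compactly supported functions; \<open>f\<close> itself is not claimed
  to be square integrable on \<open>W\<close>.\<close>

lemma approx_seq_weak_grad:
  fixes f :: "real^'n \<Rightarrow> real"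
  assumes W: "open W" "bounded W" and s: "approx_seq W f s"
  obtains H where "weak_grad W f H" "\<And>i. sq_int (lebesgue_on W) (\<lambda>x. H x $ i)"
    "(\<lambda>k. Dir W (s k)) \<longlonglongrightarrow> (\<integral>x. (norm (H x))\<^sup>2 \<partial>lebesgue_on W)"
proof -
  note fin = finite_measure_lebesgue_on_open[OF W]
  note [simp] = open_sets_lebesgue[OF W(1)]
  define G where "G k = wgrad W (s k)" for k
  have sG: "sobolev W (s k) (G k)" for k
    using s unfolding G_def by (intro sobolev_wgrad) (simp add: approx_seq_def)
  have lim: "AE x in lebesgue_on W. (\<lambda>k. s k x) \<longlonglongrightarrow> f x" using s by (simp add: approx_seq_def)
  have "Dir W (\<lambda>x. s m x - s k x) = (\<integral>x. (norm (G m x - G k x))\<^sup>2 \<partial>lebesgue_on W)" for m k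
    by (rule Dir_eq[OF W(1) sobolev_diff[OF W(1) sG sG]])
  then have cauchy: "\<exists>N. \<forall>m\<ge>N. \<forall>k\<ge>N. (\<integral>x. (norm (G m x - G k x))\<^sup>2 \<partial>lebesgue_on W) < e" if "e > 0" for e
    using s that by (simp add: approx_seq_def)
  have sqG: "sq_int (lebesgue_on W) (\<lambda>x. G k x $ i)" for k i using sG by (simp add: sobolev_def)
  obtain H where H: "\<And>i. sq_int (lebesgue_on W) (\<lambda>x. H x $ i)"
      "\<And>i. (\<lambda>k. \<integral>x. (G k x $ i - H x $ i)\<^sup>2 \<partial>lebesgue_on W) \<longlonglongrightarrow> 0"
      "(\<lambda>k. \<integral>x. (norm (G k x))\<^sup>2 \<partial>lebesgue_on W) \<longlonglongrightarrow> (\<integral>x. (norm (H x))\<^sup>2 \<partial>lebesgue_on W)"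
    by (rule gradient_limit[OF fin sqG cauchy]) blast+
  have sm: "s k \<in> borel_measurable (lebesgue_on W)" for k using sG by (simp add: sobolev_def sq_int_def)
  have fm: "f \<in> borel_measurable (lebesgue_on W)"
    by (rule borel_measurable_lebesgue_on_AE_LIMSEQ[OF _ sm lim]) simp
  have loc: "integrable (lebesgue_on K) f \<and> (\<lambda>k. \<integral>x. \<bar>s k x - f x\<bar> \<partial>lebesgue_on K) \<longlonglongrightarrow> 0"
    if K: "compact K" "K \<subseteq> W" for K
  proof -
    note [simp] = compact_sets_lebesgue[OF K(1)]
    obtain I r where I: "finite I" "K \<subseteq> (\<Union>c\<in>I. ball c (r c))" "\<And>c. c \<in> I \<Longrightarrow> ball c (r c) \<subseteq> W \<and> 0 < r c"
      by (rule compact_ball_cover[OF K W(1)]) blast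
    have b: "sq_int (lebesgue_on (ball c (r c))) f" "(\<lambda>k. \<integral>x. (s k x - f x)\<^sup>2 \<partial>lebesgue_on (ball c (r c))) \<longlonglongrightarrow> 0"
      if "c \<in> I" for c
      using sq_int_on_ball_of_approx[OF W(1) sG cauchy lim] I(3)[OF that] by blast+
    have sb: "sq_int (lebesgue_on (ball c (r c))) (s k)" if "c \<in> I" for c k
      using sobolev_mono[OF sG _ open_ball W(1)] I(3)[OF that] by (simp add: sobolev_def)
    have ib: "integrable lebesgue (\<lambda>x. indicator (ball c (r c)) x * \<bar>f x\<bar>)" if "c \<in> I" for c
      using sq_int_imp_integrable[OF finite_measure_ball b(1)[OF that]] integrable_abs
      by (subst lebesgue_on_integrable[symmetric]) auto
    have idb: "integrable lebesgue (\<lambda>x. indicator (ball c (r c)) x * \<bar>s k x - f x\<bar>)" if "c \<in> I" for c k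
      using sq_int_imp_integrable[OF finite_measure_ball sq_int_diff[OF sb[OF that, of k] b(1)[OF that]]]
      by (subst lebesgue_on_integrable[symmetric]) auto
    \<comment> \<open>A finite cover by balls replaces the compact set: overlaps only increase the
      sum.\<close>
    have dom: "indicator K x * \<bar>u x\<bar> \<le> (\<Sum>c\<in>I. indicator (ball c (r c)) x * \<bar>u x\<bar>)" for u :: "real^'n \<Rightarrow> real" and x
    proof (cases "x \<in> K")
      case True
      then obtain c where c: "c \<in> I" "x \<in> ball c (r c)" using I(2) by blast
      have "indicator (ball c (r c)) x * \<bar>u x\<bar> \<le> (\<Sum>c\<in>I. indicator (ball c (r c)) x * \<bar>u x\<bar>)"
        using c I(1) by (intro member_le_sum) auto
      then show ?thesis using c True by simp
    qed (simp add: sum_nonneg)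
    have Km: "u \<in> borel_measurable (lebesgue_on K)" if "u \<in> borel_measurable (lebesgue_on W)" for u :: "real^'n \<Rightarrow> real"
      using measurable_restrict_mono[OF that K(2)] .
    have fK: "integrable lebesgue (\<lambda>x. indicator K x * f x)"
    proof (rule Bochner_Integration.integrable_bound)
      show "integrable lebesgue (\<lambda>x. \<Sum>c\<in>I. indicator (ball c (r c)) x * \<bar>f x\<bar>)"
        using ib by (intro Bochner_Integration.integrable_sum) auto
      show "(\<lambda>x. indicator K x * f x) \<in> borel_measurable lebesgue"
        using Km[OF fm] by (simp add: lebesgue_on_measurable)
      show "AE x in lebesgue. norm (indicator K x * f x) \<le> norm (\<Sum>c\<in>I. indicator (ball c (r c)) x * \<bar>f x\<bar>)"
        using dom[of _ f] by (intro always_eventually allI) (simp add: abs_mult abs_of_nonneg[OF sum_nonneg])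
    qed
    have le: "norm (\<integral>x. \<bar>s k x - f x\<bar> \<partial>lebesgue_on K) \<le> (\<Sum>c\<in>I. \<integral>x. \<bar>s k x - f x\<bar> \<partial>lebesgue_on (ball c (r c)))" for k
    proof -
      have "norm (\<integral>x. \<bar>s k x - f x\<bar> \<partial>lebesgue_on K) = (\<integral>x. indicator K x * \<bar>s k x - f x\<bar> \<partial>lebesgue)"
        by (simp add: lebesgue_on_integral)
      also have "\<dots> \<le> (\<integral>x. (\<Sum>c\<in>I. indicator (ball c (r c)) x * \<bar>s k x - f x\<bar>) \<partial>lebesgue)"
      proof (rule integral_mono_AE')
        show "integrable lebesgue (\<lambda>x. \<Sum>c\<in>I. indicator (ball c (r c)) x * \<bar>s k x - f x\<bar>)"
          using idb by (intro Bochner_Integration.integrable_sum) auto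
        show "AE x in lebesgue. indicator K x * \<bar>s k x - f x\<bar> \<le> (\<Sum>c\<in>I. indicator (ball c (r c)) x * \<bar>s k x - f x\<bar>)"
          using dom[of _ "\<lambda>x. s k x - f x"] by (intro always_eventually allI)
      qed (auto intro!: sum_nonneg)
      also have "\<dots> = (\<Sum>c\<in>I. \<integral>x. indicator (ball c (r c)) x * \<bar>s k x - f x\<bar> \<partial>lebesgue)"
        using idb by (intro Bochner_Integration.integral_sum) auto
      finally show ?thesis by (simp add: lebesgue_on_integral)
    qed
    have "(\<lambda>k. \<Sum>c\<in>I. \<integral>x. \<bar>s k x - f x\<bar> \<partial>lebesgue_on (ball c (r c))) \<longlonglongrightarrow> (\<Sum>c\<in>I. 0)"
    proof (rule tendsto_sum)
      show "(\<lambda>k. \<integral>x. \<bar>s k x - f x\<bar> \<partial>lebesgue_on (ball c (r c))) \<longlonglongrightarrow> 0" if "c \<in> I" for c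
        by (rule L1_tendsto_of_L2_tendsto[OF finite_measure_ball sq_int_diff[OF sb[OF that] b(1)[OF that]] b(2)[OF that]])
    qed
    then have tend: "(\<lambda>k. \<Sum>c\<in>I. \<integral>x. \<bar>s k x - f x\<bar> \<partial>lebesgue_on (ball c (r c))) \<longlonglongrightarrow> 0"
      by (simp only: sum.neutral_const)
    have "(\<lambda>k. \<integral>x. \<bar>s k x - f x\<bar> \<partial>lebesgue_on K) \<longlonglongrightarrow> 0"
      by (rule Lim_null_comparison[OF always_eventually[OF allI[OF le]] tend])
    then show ?thesis using fK by (simp add: lebesgue_on_integrable)
  qed
  have "weak_grad W f H"
  proof (rule weak_grad_limit[OF W(1)])
    show "weak_grad W (s k) (G k)" for k using sG by (simp add: sobolev_def)
    show "L1loc W f" using fm loc by (simp add: L1loc_def)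
    show "L1loc W (\<lambda>x. H x $ i)" for i
      using H(1)[of i] integrable_lebesgue_on_subset[OF sq_int_imp_integrable[OF fin H(1)[of i]] _ compact_sets_lebesgue]
      by (simp add: L1loc_def sq_int_def)
    fix K :: "(real^'n) set" assume K: "compact K" "K \<subseteq> W"
    show "(\<lambda>k. \<integral>x. \<bar>s k x - f x\<bar> \<partial>lebesgue_on K) \<longlonglongrightarrow> 0" using loc[OF K] by blast
    show "(\<lambda>k. \<integral>x. \<bar>G k x $ i - H x $ i\<bar> \<partial>lebesgue_on K) \<longlonglongrightarrow> 0" for i
      by (rule L1_tendsto_subset[OF sq_int_imp_integrable[OF fin sq_int_diff[OF sqG H(1)]] K(2)
            compact_sets_lebesgue[OF K(1)] open_sets_lebesgue[OF W(1)]
            L1_tendsto_of_L2_tendsto[OF fin sq_int_diff[OF sqG H(1)] H(2)]])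
  qed
  moreover have "Dir W (s k) = (\<integral>x. (norm (G k x))\<^sup>2 \<partial>lebesgue_on W)" for k
    by (rule Dir_eq[OF W(1) sG])
  ultimately show thesis using that H by simp
qed

text \<open>One inclusion is the weak gradient of the limit just constructed; for the other the
  constant sequence approximates. This makes the form domain concrete once the weighted L2 space is
  the plain one.\<close>

lemma H12e_cases:
  fixes f :: "real^'n \<Rightarrow> real"
  assumes W: "open W" "bounded W"
  shows "H12e W f \<and> sq_int (lebesgue_on W) f \<longleftrightarrow> H12 W f"
proof
  assume L: "H12e W f \<and> sq_int (lebesgue_on W) f"
  then obtain s where s: "approx_seq W f s" by (auto simp: H12e_def)
  obtain H where "weak_grad W f H" "\<And>i. sq_int (lebesgue_on W) (\<lambda>x. H x $ i)"
      "(\<lambda>k. Dir W (s k)) \<longlonglongrightarrow> (\<integral>x. (norm (H x))\<^sup>2 \<partial>lebesgue_on W)"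
    by (rule approx_seq_weak_grad[OF W s]) (rule that)
  then show "H12 W f" using L by (auto simp: H12_iff_sobolev sobolev_def)
next
  assume f: "H12 W f"
  have "Dir W (\<lambda>x. f x - f x) = 0"
    using Dir_eq[OF W(1) sobolev_diff[OF W(1) sobolev_wgrad[OF f] sobolev_wgrad[OF f]]] by simp
  then have "approx_seq W f (\<lambda>_. f)" using f by (simp add: approx_seq_def)
  then show "H12e W f \<and> sq_int (lebesgue_on W) f"
    using sobolev_wgrad[OF f] by (auto simp: H12e_def sobolev_def)
qed

text \<open>\<open>DirE\<close> evaluates along an approximating sequence selected by choice. The
  energies of any such sequence converge to the energy of a weak gradient of \<open>f\<close>, and
  that is unique almost everywhere, so the choice does not matter.\<close>

lemma DirE_eq_Dform:
  fixes f :: "real^'n \<Rightarrow> real"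
  assumes W: "open W" "bounded W" and f: "H12 W f"
  shows "DirE W f = Dform W f f"
proof -
  have "H12e W f" using f H12e_cases[OF W] by blast
  then have "approx_seq W f (SOME s. approx_seq W f s)" unfolding H12e_def by (rule someI_ex)
  then obtain H where H: "weak_grad W f H" "\<And>i. sq_int (lebesgue_on W) (\<lambda>x. H x $ i)"
    "(\<lambda>k. Dir W ((SOME s. approx_seq W f s) k)) \<longlonglongrightarrow> (\<integral>x. (norm (H x))\<^sup>2 \<partial>lebesgue_on W)"
    by (rule approx_seq_weak_grad[OF W]) (rule that)
  have sH: "sobolev W f H" using H f sobolev_wgrad[OF f] by (simp add: sobolev_def)
  have "DirE W f = (\<integral>x. (norm (H x))\<^sup>2 \<partial>lebesgue_on W)" unfolding DirE_def by (rule limI[OF H(3)])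
  then show ?thesis using Dform_eq[OF W(1) sH sH] by (simp add: power2_norm_eq_inner)
qed

lemma DirE2_eq_Dform:
  fixes f h :: "real^'n \<Rightarrow> real"
  assumes W: "open W" "bounded W" and f: "H12 W f" and h: "H12 W h"
  shows "DirE2 W f h = Dform W f h"
proof -
  interpret semi_inner "{f. H12 W f}" "Dform W" by (rule semi_inner_Dform[OF W(1)])
  have fh: "f \<in> {f. H12 W f}" "h \<in> {f. H12 W f}" using f h by auto
  have "H12 W (\<lambda>x. f x + h x)" "H12 W (\<lambda>x. f x - h x)" using add[OF fh] diff[OF fh] by auto
  then have "DirE2 W f h = (Dform W (\<lambda>x. f x + h x) (\<lambda>x. f x + h x) - Dform W (\<lambda>x. f x - h x) (\<lambda>x. f x - h x)) / 4"
    by (simp add: DirE2_def DirE_eq_Dform[OF W])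
  then show ?thesis using square_diff[OF fh] square_lincomb[OF fh, of 1 1] by simp
qed

section \<open>Spectral gaps of forms\<close>

lemma zero_gradient_ball:
  fixes f :: "real^'n \<Rightarrow> real"
  assumes r: "0 < r" and f: "sobolev (ball c r) f G"
    and G: "(\<integral>x. (norm (G x))\<^sup>2 \<partial>lebesgue_on (ball c r)) = 0"
  shows "\<exists>a. AE x in lebesgue_on (ball c r). f x = a"
proof -
  let ?M = "lebesgue_on (ball c r)"
  define v where "v = measure lebesgue (ball c r)"
  define a where "a = (\<integral>x. f x \<partial>?M) / v"
  have v: "v > 0" unfolding v_def by (rule ball_measure_pos[OF r])
  have spv: "measure ?M (space ?M) = v" unfolding v_def by (rule measure_lebesgue_on_space) simp
  have sq: "sq_int ?M f" using f by (simp add: sobolev_def)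
  have sqa: "sq_int ?M (\<lambda>x. f x - a)" by (intro sq_int_diff sq sq_int_const finite_measure_ball)
  have "(\<integral>x. (f x - a)\<^sup>2 \<partial>?M) = (\<integral>x. (f x)\<^sup>2 \<partial>?M) - (\<integral>x. f x \<partial>?M)\<^sup>2 / v"
    unfolding a_def by (rule integral_square_minus_mean[OF finite_measure_ball spv v sq])
  also have "\<dots> \<le> 0"
    using poincare_ball[OF r, of c f G] f G by (simp add: sobolev_def v_def)
  finally have "(\<integral>x. (f x - a)\<^sup>2 \<partial>?M) = 0" by (simp add: order_antisym)
  then have "AE x in ?M. (f x - a)\<^sup>2 = 0"
    using sqa by (subst (asm) integral_nonneg_eq_0_iff_AE) (auto simp: sq_int_def)
  then show ?thesis by auto
qed

text \<open>Poincare makes \<open>f\<close> almost everywhere constant on every ball inside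
  \<open>W\<close>. The sets of points with local value \<open>a\<close> are open, disjoint for
  different \<open>a\<close> because balls are not null, and cover \<open>W\<close>, so
  connectedness leaves one of them. Countably many balls suffice to cover \<open>W\<close>, hence
  the exceptional null sets add up to a null set.\<close>

lemma zero_gradient_imp_constant:
  fixes f :: "real^'n \<Rightarrow> real"
  assumes W: "open W" "connected W" and f: "sobolev W f G"
    and G: "(\<integral>x. (norm (G x))\<^sup>2 \<partial>lebesgue_on W) = 0"
  shows "\<exists>a. AE x in lebesgue_on W. f x = a"
proof (cases "W = {}")
  case True
  then show ?thesis by (auto intro!: exI[of _ 0] AE_I2)
next
  case False
  define U where "U a = {x \<in> W. \<exists>r>0. ball x r \<subseteq> W \<and> (AE y in lebesgue. y \<in> ball x r \<longrightarrow> f y = a)}" for a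
  have uniq: "a = b" if "x \<in> U a" "x \<in> U b" for a b x
  proof (rule ccontr)
    assume ne: "a \<noteq> b"
    from that obtain r r' where r: "r > 0" "AE y in lebesgue. y \<in> ball x r \<longrightarrow> f y = a"
      and r': "r' > 0" "AE y in lebesgue. y \<in> ball x r' \<longrightarrow> f y = b" unfolding U_def by blast
    have "AE y in lebesgue. y \<notin> ball x (min r r')"
      using r(2) r'(2) by eventually_elim (use ne in auto)
    then have "ball x (min r r') \<in> null_sets lebesgue"
      using AE_iff_null_sets[of "ball x (min r r')" lebesgue] by simp
    then have "negligible (ball x (min r r'))" by (simp add: negligible_iff_null_sets)
    then show False using open_not_negligible[of "ball x (min r r')"] r(1) r'(1) by auto
  qed
  have op: "open (U a)" for a
    unfolding open_contains_ball
  proof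
    fix x assume x: "x \<in> U a"
    then obtain r where r: "r > 0" "ball x r \<subseteq> W" "AE y in lebesgue. y \<in> ball x r \<longrightarrow> f y = a"
      unfolding U_def by blast
    have "ball x (r / 2) \<subseteq> U a"
    proof
      fix z assume z: "z \<in> ball x (r / 2)"
      have sub: "ball z (r / 2) \<subseteq> ball x r"
      proof
        fix y assume "y \<in> ball z (r / 2)"
        then show "y \<in> ball x r" using z dist_triangle[of x y z] by simp
      qed
      moreover have "AE y in lebesgue. y \<in> ball z (r / 2) \<longrightarrow> f y = a"
        using r(3) by eventually_elim (use sub in auto)
      ultimately show "z \<in> U a" unfolding U_def using r z by (auto intro!: exI[of _ "r / 2"])
    qed
    then show "\<exists>e>0. ball x e \<subseteq> U a" using r(1) by (intro exI[of _ "r / 2"]) auto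
  qed
  have cover: "\<exists>a. x \<in> U a" if x: "x \<in> W" for x
  proof -
    obtain r where r: "r > 0" "ball x r \<subseteq> W" using openE[OF W(1) x] .
    have "(\<integral>x. (norm (G x))\<^sup>2 \<partial>lebesgue_on (ball x r)) \<le> 0"
      using integral_gradient_mono[OF _ r(2) open_ball W(1), of G] f G by (simp add: sobolev_def)
    then have "(\<integral>x. (norm (G x))\<^sup>2 \<partial>lebesgue_on (ball x r)) = 0" by (simp add: order_antisym)
    then obtain a where "AE y in lebesgue_on (ball x r). f y = a"
      using zero_gradient_ball[OF r(1) sobolev_mono[OF f r(2) open_ball W(1)]] by blast
    then have "AE y in lebesgue. y \<in> ball x r \<longrightarrow> f y = a" by (subst lebesgue_on_AE[symmetric]) auto
    then show ?thesis unfolding U_def using r x by blast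
  qed
  obtain x0 a where x0: "x0 \<in> W" "x0 \<in> U a" using False cover by blast
  have "W \<subseteq> U a"
  proof (rule ccontr)
    assume "\<not> W \<subseteq> U a"
    then obtain x where "x \<in> W" "x \<notin> U a" by blast
    then have ne: "(\<Union>b\<in>-{a}. U b) \<inter> W \<noteq> {}" using cover[of x] by auto
    have opV: "open (\<Union>b\<in>-{a}. U b)" by (intro open_UN ballI op)
    have disj: "U a \<inter> (\<Union>b\<in>-{a}. U b) \<inter> W = {}" using uniq by auto
    have cov: "W \<subseteq> U a \<union> (\<Union>b\<in>-{a}. U b)"
    proof
      fix x assume "x \<in> W"
      from cover[OF this] obtain b where "x \<in> U b" by blast
      then show "x \<in> U a \<union> (\<Union>b\<in>-{a}. U b)" by (cases "b = a") auto
    qed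
    from connectedD[OF W(2) op opV disj cov] ne x0 show False by auto
  qed
  then have "\<forall>x\<in>W. \<exists>r>0. AE y in lebesgue. y \<in> ball x r \<longrightarrow> f y = a" unfolding U_def by blast
  then obtain r where r: "\<And>x. x \<in> W \<Longrightarrow> r x > 0 \<and> (AE y in lebesgue. y \<in> ball x (r x) \<longrightarrow> f y = a)" by metis
  obtain \<F> where F: "\<F> \<subseteq> (\<lambda>x. ball x (r x)) ` W" "countable \<F>" "\<Union>\<F> = \<Union>((\<lambda>x. ball x (r x)) ` W)"
    by (rule Lindelof[of "(\<lambda>x. ball x (r x)) ` W"]) auto
  have "AE y in lebesgue. \<forall>S\<in>\<F>. y \<in> S \<longrightarrow> f y = a"
    using F(1,2) r by (subst AE_ball_countable) auto
  moreover have "W \<subseteq> \<Union>\<F>" using F(3) r by force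
  ultimately have "AE y in lebesgue. y \<in> W \<longrightarrow> f y = a"
    by (auto elim!: eventually_mono)
  then show ?thesis using lebesgue_on_AE[OF open_sets_lebesgue[OF W(1)]] by blast
qed

text \<open>The direct method, which works for a semi-inner product without forming a quotient: a
  minimising sequence of B f f - 2 l f is Cauchy by the parallelogram identity, and the first
  variation at its limit is the desired equation.\<close>

lemma (in semi_inner) riesz:
  assumes ne: "V \<noteq> {}"
    and complete: "\<And>s. (\<And>k::nat. s k \<in> V) \<Longrightarrow>
        (\<And>e. e > 0 \<Longrightarrow> \<exists>N. \<forall>m\<ge>N. \<forall>k\<ge>N. B (\<lambda>x. s m x - s k x) (\<lambda>x. s m x - s k x) < e) \<Longrightarrow>
        \<exists>f\<in>V. (\<lambda>k. B (\<lambda>x. s k x - f x) (\<lambda>x. s k x - f x)) \<longlonglongrightarrow> 0"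
    and l: "\<And>f g a b. f \<in> V \<Longrightarrow> g \<in> V \<Longrightarrow> l (\<lambda>x. a * f x + b * g x) = a * l f + b * l g"
    and C: "C \<ge> 0" and bound: "\<And>f. f \<in> V \<Longrightarrow> (l f)\<^sup>2 \<le> C * B f f"
  shows "\<exists>f\<in>V. \<forall>h\<in>V. B f h = l h"
proof -
  define J where "J f = B f f - 2 * l f" for f
  have J_lower: "- C \<le> J f" if f: "f \<in> V" for f
  proof (rule ccontr)
    assume "\<not> - C \<le> J f"
    then have "C + B f f < 2 * l f" by (simp add: J_def)
    then have "(C + B f f)\<^sup>2 < (2 * l f)\<^sup>2" using C nonneg[OF f] by (intro power_strict_mono) auto
    also have "\<dots> \<le> 4 * (C * B f f)" using bound[OF f] by (simp add: power_mult_distrib)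
    finally have "(C - B f f)\<^sup>2 < 0" by (simp add: power2_eq_square algebra_simps)
    then show False by simp
  qed
  define m where "m = Inf (J ` V)"
  have bdd: "bdd_below (J ` V)" using J_lower by (intro bdd_belowI[of _ "- C"]) auto
  have m_le: "m \<le> J f" if "f \<in> V" for f unfolding m_def using that bdd by (intro cINF_lower) auto
  have "\<exists>f\<in>V. J f < m + 1 / (real k + 1)" for k :: nat
  proof (rule ccontr)
    assume "\<not> ?thesis"
    then have "m + 1 / (real k + 1) \<le> m" unfolding m_def using ne by (intro cINF_greatest) (auto simp: not_less)
    then show False by simp
  qed
  then obtain s where s: "\<And>k::nat. s k \<in> V" "\<And>k. J (s k) < m + 1 / (real k + 1)" by metis
  \<comment> \<open>The midpoint of \<open>s j\<close> and \<open>s k\<close> cannot beat the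
    infimum \<open>m\<close>, which bounds their distance by the two excesses over
    \<open>m\<close>.\<close>
  have para: "B (\<lambda>x. s j x - s k x) (\<lambda>x. s j x - s k x) \<le> 2 / (real j + 1) + 2 / (real k + 1)" for j k
  proof -
    have "4 * m \<le> 4 * J (\<lambda>x. 1/2 * s j x + 1/2 * s k x)" using m_le[OF lincomb[OF s(1)[of j] s(1)[of k], of "1/2" "1/2"]] by simp
    also have "\<dots> = B (s j) (s j) + 2 * B (s j) (s k) + B (s k) (s k) - 4 * l (s j) - 4 * l (s k)"
      unfolding J_def square_lincomb[OF s(1) s(1)] l[OF s(1) s(1)] by (simp add: power2_eq_square field_simps)
    finally have "B (\<lambda>x. s j x - s k x) (\<lambda>x. s j x - s k x) \<le> 2 * J (s j) + 2 * J (s k) - 4 * m"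
      using square_diff[OF s(1) s(1), of j k] by (simp add: J_def)
    then show ?thesis using s(2)[of j] s(2)[of k] by simp
  qed
  have cau: "\<exists>N. \<forall>j\<ge>N. \<forall>k\<ge>N. B (\<lambda>x. s j x - s k x) (\<lambda>x. s j x - s k x) < e" if e: "e > 0" for e
  proof -
    obtain N :: nat where N: "4 / e < real N" using reals_Archimedean2 by blast
    have "B (\<lambda>x. s j x - s k x) (\<lambda>x. s j x - s k x) < e" if "j \<ge> N" "k \<ge> N" for j k
    proof -
      have small: "2 / (real i + 1) < e / 2" if "i \<ge> N" for i
      proof -
        have "4 / e < real i + 1" using N that by simp
        then show ?thesis using e by (simp add: field_simps)
      qed
      show ?thesis using para[of j k] small[OF that(1)] small[OF that(2)] by simp
    qed
    then show ?thesis by blast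
  qed
  have "\<exists>f\<in>V. (\<lambda>k. B (\<lambda>x. s k x - f x) (\<lambda>x. s k x - f x)) \<longlonglongrightarrow> 0"
  proof (rule complete)
    show "s k \<in> V" for k by (rule s(1))
    show "\<exists>N. \<forall>j\<ge>N. \<forall>k\<ge>N. B (\<lambda>x. s j x - s k x) (\<lambda>x. s j x - s k x) < e" if "e > 0" for e
      by (rule cau[OF that])
  qed
  then obtain f where f: "f \<in> V" and lim: "(\<lambda>k. B (\<lambda>x. s k x - f x) (\<lambda>x. s k x - f x)) \<longlonglongrightarrow> 0"
    by (elim bexE) (rule that)
  have "B f h = l h" if h: "h \<in> V" for h
  proof -
    have "(\<lambda>k. B (s k) h - B f h) \<longlonglongrightarrow> 0"
    proof (rule Lim_null_comparison)
      show "\<forall>\<^sub>F k in sequentially. norm (B (s k) h - B f h) \<le> sqrt (B (\<lambda>x. s k x - f x) (\<lambda>x. s k x - f x) * B h h)"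
        using Cauchy_Schwarz[OF diff[OF s(1) f] h] diff_left[OF s(1) f h]
        by (intro always_eventually allI) (auto intro!: real_le_rsqrt)
      show "(\<lambda>k. sqrt (B (\<lambda>x. s k x - f x) (\<lambda>x. s k x - f x) * B h h)) \<longlonglongrightarrow> 0"
        using tendsto_real_sqrt[OF tendsto_mult_left_zero[OF lim]] by simp
    qed
    then have lim': "(\<lambda>k. B (s k) h) \<longlonglongrightarrow> B f h" by (simp add: LIM_zero_iff)
    have var: "0 \<le> 2 * t * (B f h - l h) + t\<^sup>2 * B h h" for t
    proof -
      have ineq: "0 \<le> 1 / (real k + 1) + 2 * t * (B (s k) h - l h) + t\<^sup>2 * B h h" for k
      proof -
        have "m \<le> J (\<lambda>x. 1 * s k x + t * h x)" by (intro m_le lincomb s h)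
        also have "\<dots> = J (s k) + 2 * t * (B (s k) h - l h) + t\<^sup>2 * B h h"
          unfolding J_def square_lincomb[OF s(1) h] l[OF s(1) h] by (simp add: algebra_simps)
        finally show ?thesis using s(2)[of k] by simp
      qed
      have "(\<lambda>k. 1 / (real k + 1) + 2 * t * (B (s k) h - l h) + t\<^sup>2 * B h h) \<longlonglongrightarrow> 0 + 2 * t * (B f h - l h) + t\<^sup>2 * B h h"
        using LIMSEQ_inverse_real_of_nat by (intro tendsto_intros lim') (simp add: inverse_eq_divide add.commute)
      from LIMSEQ_le_const[OF this, of 0] ineq show ?thesis by auto
    qed
    define d where "d = B f h - l h"
    \<comment> \<open>Nearly the minimiser of the quadratic in t; the added 1 keeps the denominator
      positive when \<open>h\<close> has zero norm.\<close>
    define t where "t = - d / (B h h + 1)"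
    have hh: "B h h \<ge> 0" using nonneg[OF h] .
    have "0 \<le> 2 * t * d + t\<^sup>2 * B h h" using var[of t] by (simp add: d_def)
    also have "\<dots> \<le> 2 * t * d + t\<^sup>2 * (B h h + 1)" by (simp add: mult_left_mono)
    also have "\<dots> = t * d"
    proof -
      have "t * (B h h + 1) = - d" using hh by (simp add: t_def)
      then have "t\<^sup>2 * (B h h + 1) = t * (- d)" by (simp add: power2_eq_square mult.assoc)
      then show ?thesis by simp
    qed
    also have "t * d = - (d\<^sup>2 / (B h h + 1))" by (simp add: t_def power2_eq_square)
    finally have "d\<^sup>2 / (B h h + 1) \<le> 0" by simp
    then have "d\<^sup>2 \<le> 0" using hh by (simp add: divide_le_0_iff)
    then show "B f h = l h" by (simp add: d_def)
  qed
  then show ?thesis using f by blast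
qed

text \<open>The abstract setting of a form \<open>D\<close> with domain \<open>F\<close> over a
  Hilbert-like space \<open>H\<close>. The operator L of the form never appears as a map; everything
  is phrased through weak solutions of (L - lam) f = g.\<close>

locale form_operator =
  H: semi_inner H ip + F: semi_inner F D
  for H F :: "('a \<Rightarrow> real) set" and ip D :: "('a \<Rightarrow> real) \<Rightarrow> ('a \<Rightarrow> real) \<Rightarrow> real" +
  assumes FH: "F \<subseteq> H"
begin

definition solv :: "real \<Rightarrow> ('a \<Rightarrow> real) \<Rightarrow> ('a \<Rightarrow> real) \<Rightarrow> bool" where
  "solv lam g f \<longleftrightarrow> f \<in> F \<and> (\<forall>h\<in>F. D f h - lam * ip f h = ip g h)"

text \<open>By linearity the bound applies to differences of solutions, so it contains uniqueness
  modulo functions of zero norm.\<close>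

definition res :: "real \<Rightarrow> bool" where
  "res lam \<longleftrightarrow> (\<forall>g\<in>H. \<exists>f. solv lam g f) \<and> (\<exists>C. \<forall>g\<in>H. \<forall>f. solv lam g f \<longrightarrow> ip f f \<le> C * ip g g)"

lemma FH': "f \<in> F \<Longrightarrow> f \<in> H" using FH by blast

lemma solv_F: "solv lam g f \<Longrightarrow> f \<in> F" by (simp add: solv_def)

lemma solv_eq: "solv lam g f \<Longrightarrow> h \<in> F \<Longrightarrow> D f h = lam * ip f h + ip g h" by (auto simp: solv_def)

lemma solv_lincomb:
  assumes "solv lam g f" "solv lam g' f'" "g \<in> H" "g' \<in> H"
  shows "solv lam (\<lambda>x. a * g x + b * g' x) (\<lambda>x. a * f x + b * f' x)"
  using assms solv_F[OF assms(1)] solv_F[OF assms(2)] unfolding solv_def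
  by (auto simp: F.lincomb F.bilinear H.bilinear FH' algebra_simps)

lemma solv_shift:
  assumes "solv lam g f" "g \<in> H"
  shows "solv (lam + c) (\<lambda>x. g x - c * f x) f"
  using assms H.bilinear[of g f _ 1 "- c"] unfolding solv_def by (auto simp: FH' algebra_simps)

lemma solv_symmetric:
  assumes "solv lam g u" "solv lam h w"
  shows "ip g w = ip h u"
  using solv_eq[OF assms(1) solv_F[OF assms(2)]] solv_eq[OF assms(2) solv_F[OF assms(1)]]
    F.sym[OF solv_F[OF assms(1)] solv_F[OF assms(2)]]
    H.sym[OF FH'[OF solv_F[OF assms(1)]] FH'[OF solv_F[OF assms(2)]]] by simp

text \<open>The resolvent of a self-adjoint operator is bounded by the inverse distance to the spectrum. If
  the norm \<open>M\<close> of \<open>S = (L - \<lambda>)\<^sup>-\<^sup>1\<close> exceeded \<open>1 / \<lambda>\<close>, then \<open>S\<^sup>2 - M\<^sup>2 = (S - M) (S + M)\<close> would be bounded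
  below, both factors being invertible because \<open>\<lambda> \<plusminus> 1 / M\<close> lies in the resolvent set.\<close>

lemma resolvent_norm_bound:
  assumes res: "\<And>\<mu>. 0 < \<mu> \<Longrightarrow> \<mu> < 2 * lam \<Longrightarrow> res \<mu>" and lam: "lam > 0"
    and g0: "g0 \<in> H" and f0: "solv lam g0 f0"
  shows "lam\<^sup>2 * ip f0 f0 \<le> ip g0 g0"
proof -
  have nn: "f \<in> F \<Longrightarrow> 0 \<le> ip f f" for f using H.nonneg FH' by blast
  have bnd: "\<exists>C\<ge>0. \<forall>g\<in>H. \<forall>f. solv \<mu> g f \<longrightarrow> ip f f \<le> C * ip g g" if mu: "0 < \<mu>" "\<mu> < 2 * lam" for \<mu>
  proof -
    obtain C where C: "\<And>g f. g \<in> H \<Longrightarrow> solv \<mu> g f \<Longrightarrow> ip f f \<le> C * ip g g"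
      using res[OF mu] unfolding res_def by blast
    have "ip f f \<le> max C 0 * ip g g" if "g \<in> H" "solv \<mu> g f" for g f
      using C[OF that] mult_right_mono[OF max.cobounded1 H.nonneg[OF that(1)], of C 0] by simp
    then show ?thesis by (intro exI[of _ "max C 0"]) auto
  qed
  define S where "S = {ip f f |f g. g \<in> H \<and> ip g g \<le> 1 \<and> solv lam g f}"
  \<comment> \<open>With T = (L - lam)^-1, this is the square of the operator norm of T.\<close>
  define q where "q = Sup S"
  obtain C where C: "C \<ge> 0" "\<And>g f. g \<in> H \<Longrightarrow> solv lam g f \<Longrightarrow> ip f f \<le> C * ip g g"
    using bnd[of lam] lam by auto
  have bdd: "bdd_above S"
  proof (rule bdd_aboveI[of _ C])
    fix t assume "t \<in> S"
    then obtain f g where "t = ip f f" "g \<in> H" "ip g g \<le> 1" "solv lam g f" by (auto simp: S_def)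
    then show "t \<le> C" using C(2)[of g f] mult_left_mono[of "ip g g" 1 C] C(1) by simp
  qed
  have le_q: "ip f f \<le> q * ip g g" if g: "g \<in> H" and f: "solv lam g f" for g f
  proof (cases "ip g g = 0")
    case True
    then show ?thesis using C(2)[OF g f] by simp
  next
    case False
    then have pos: "ip g g > 0" using H.nonneg[OF g] by simp
    define c where "c = 1 / sqrt (ip g g)"
    have c2: "c\<^sup>2 * ip g g = 1" using pos by (simp add: c_def power_divide)
    have "solv lam (\<lambda>x. c * g x) (\<lambda>x. c * f x)" using solv_lincomb[OF f f g g, of c 0] by simp
    then have "c\<^sup>2 * ip f f \<in> S" unfolding S_def mem_Collect_eq
      using c2 H.square_scale[OF g, of c] H.square_scale[OF FH'[OF solv_F[OF f]], of c] H.scale[OF g, of c]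
      by - (rule exI[of _ "\<lambda>x. c * f x"], rule exI[of _ "\<lambda>x. c * g x"], simp)
    then have "c\<^sup>2 * ip f f \<le> q" unfolding q_def by (rule cSup_upper[OF _ bdd])
    then show ?thesis using pos by (simp add: c_def power_divide divide_le_eq)
  qed
  have "q \<le> 1 / lam\<^sup>2"
  proof (rule ccontr)
    assume "\<not> q \<le> 1 / lam\<^sup>2"
    then have ql: "q > 1 / lam\<^sup>2" by simp
    moreover have "1 / lam\<^sup>2 > 0" using lam by simp
    ultimately have q: "q > 0" by (rule order.strict_trans[rotated])
    \<comment> \<open>The assumption on \<open>q\<close> says 1 / M < lam, which places lam + 1 / M
      and lam - 1 / M in the interval where \<open>res\<close> holds.\<close>
    define M where "M = sqrt q"
    have M: "M > 0" "M * M = q" "M\<^sup>2 = q" using q by (simp_all add: M_def)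
    have "1 / lam < M" unfolding M_def using ql lam by (intro real_less_rsqrt) (simp add: power_divide)
    then have Ml: "1 / M < lam" using lam M(1) by (simp add: field_simps)
    have "1 / M > 0" using M(1) by simp
    then have "0 < lam + 1 / M" "lam + 1 / M < 2 * lam" "0 < lam - 1 / M" "lam - 1 / M < 2 * lam"
      using Ml lam by linarith+
    note C12 = bnd[OF this(1,2)] bnd[OF this(3,4)]
    obtain C1 where C1: "C1 \<ge> 0" "\<And>g f. g \<in> H \<Longrightarrow> solv (lam + 1 / M) g f \<Longrightarrow> ip f f \<le> C1 * ip g g"
      using C12(1) by blast
    obtain C2 where C2: "C2 \<ge> 0" "\<And>g f. g \<in> H \<Longrightarrow> solv (lam - 1 / M) g f \<Longrightarrow> ip f f \<le> C2 * ip g g"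
      using C12(2) by blast
    define K where "K = (C2 / q) * ((2 * (C1 / q) + 2) / q)"
    have K: "K \<ge> 0" using C1(1) C2(1) q by (simp add: K_def)
    \<comment> \<open>Quantitative contradiction, with u = T g, w = T^2 g and e = (T^2 - M^2) g:
      invertibility of both factors bounds |T g|^2 by K |e|^2, while expanding |e|^2 shows that it
      is at most q (q - |T g|^2), small when g nearly attains the norm.\<close>
    have each: "ip u u \<le> K * (q * (q - ip u u))" if g: "g \<in> H" "ip g g \<le> 1" and u: "solv lam g u" for g u
    proof -
      note uF = solv_F[OF u] note uH = FH'[OF uF]
      obtain w where w: "solv lam u w" using res[of lam] lam uH unfolding res_def by auto
      note wF = solv_F[OF w] note wH = FH'[OF wF]
      define e where "e x = w x - q * g x" for x
      have eH: "e \<in> H" unfolding e_def using H.lincomb[OF wH g(1), of 1 "- q"] by simp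
      have wg: "ip w g = ip u u" using solv_symmetric[OF u w] H.sym[OF wH g(1)] by simp
      have "ip e e = ip w w - 2 * q * ip u u + q\<^sup>2 * ip g g"
        unfolding e_def using H.square_lincomb[OF wH g(1), of 1 "- q"] wg by simp
      also have "\<dots> \<le> q * ip u u - 2 * q * ip u u + q\<^sup>2 * 1"
        using le_q[OF uH w] g(2) by (intro add_mono diff_right_mono mult_left_mono) auto
      finally have ee: "ip e e \<le> q * (q - ip u u)" by (simp add: power2_eq_square algebra_simps)
      define v where "v x = u x + M * g x" for x
      have vH: "v \<in> H" unfolding v_def using H.lincomb[OF uH g(1), of 1 M] by simp
      define z where "z x = w x + M * u x" for x
      have z: "solv lam v z" unfolding v_def z_def using solv_lincomb[OF w u uH g(1), of 1 M] by simp
      note zF = solv_F[OF z] note zH = FH'[OF zF]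
      have vz: "v x = (z x - e x) / M" for x
        using M by (simp add: v_def z_def e_def field_simps)
      \<comment> \<open>For v = (T + M) g and z = T v one has (T - M) v = e. Rewritten with L this
        is (L - lam - 1 / M) z = - e / M, so \<open>z\<close>, and then \<open>v\<close>, is
        controlled by \<open>e\<close>.\<close>
      have "solv (lam + 1 / M) (\<lambda>x. v x - 1 / M * z x) z" by (rule solv_shift[OF z vH])
      moreover have "(\<lambda>x. v x - 1 / M * z x) = (\<lambda>x. (- 1 / M) * e x)"
        using M(1) by (auto simp: vz field_simps)
      ultimately have "solv (lam + 1 / M) (\<lambda>x. (- 1 / M) * e x) z" by simp
      from C1(2)[OF H.scale[OF eH] this] have "ip z z \<le> C1 * ((- 1 / M)\<^sup>2 * ip e e)"
        by (simp only: H.square_scale[OF eH])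
      then have zz: "ip z z \<le> (C1 / q) * ip e e" using M by (simp add: power_divide)
      have "ip v v = ip (\<lambda>x. (1 / M) * (z x - e x)) (\<lambda>x. (1 / M) * (z x - e x))"
        by (rule arg_cong2[where f=ip]; rule ext; simp add: vz)
      also have "\<dots> = (1 / M)\<^sup>2 * ip (\<lambda>x. z x - e x) (\<lambda>x. z x - e x)"
        by (rule H.square_scale[OF H.diff[OF zH eH]])
      also have "\<dots> \<le> (1 / M)\<^sup>2 * (2 * ip z z + 2 * ip e e)"
        by (intro mult_left_mono H.square_diff_le zH eH) simp
      also have "\<dots> \<le> (1 / M)\<^sup>2 * (2 * ((C1 / q) * ip e e) + 2 * ip e e)"
        using zz by (intro mult_left_mono add_mono) auto
      also have "\<dots> = ((2 * (C1 / q) + 2) / q) * ip e e" using M by (simp add: power_divide field_simps)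
      finally have vv: "ip v v \<le> ((2 * (C1 / q) + 2) / q) * ip e e" .
      \<comment> \<open>The second factor: (T + M) g = v reads (L - lam + 1 / M) u = v / M, so
        \<open>u\<close> is controlled by \<open>v\<close>.\<close>
      have "solv (lam + (- 1 / M)) (\<lambda>x. g x - (- 1 / M) * u x) u" by (rule solv_shift[OF u g(1)])
      moreover have "(\<lambda>x. g x - (- 1 / M) * u x) = (\<lambda>x. (1 / M) * v x)"
        using M(1) by (auto simp: v_def field_simps)
      ultimately have "solv (lam - 1 / M) (\<lambda>x. (1 / M) * v x) u" by simp
      from C2(2)[OF H.scale[OF vH] this] have "ip u u \<le> C2 * ((1 / M)\<^sup>2 * ip v v)"
        by (simp only: H.square_scale[OF vH])
      then have "ip u u \<le> (C2 / q) * ip v v" using M by (simp add: power_divide)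
      also have "\<dots> \<le> (C2 / q) * (((2 * (C1 / q) + 2) / q) * ip e e)"
        using vv C2(1) q by (intro mult_left_mono) auto
      also have "\<dots> = K * ip e e" by (simp add: K_def)
      also have "\<dots> \<le> K * (q * (q - ip u u))" using ee K by (intro mult_left_mono)
      finally show ?thesis .
    qed
    have "S \<noteq> {}"
    proof -
      have "solv lam (\<lambda>x. 0 * g0 x + 0 * g0 x) (\<lambda>x. 0 * f0 x + 0 * f0 x)" by (rule solv_lincomb[OF f0 f0 g0 g0])
      moreover have "ip (\<lambda>x. 0 * g0 x + 0 * g0 x) (\<lambda>x. 0 * g0 x + 0 * g0 x) = 0"
        using H.square_lincomb[OF g0 g0, of 0 0] by simp
      ultimately show ?thesis unfolding S_def using H.lincomb[OF g0 g0, of 0 0] by fastforce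
    qed
    \<comment> \<open>Solving the inequality of \<open>each\<close> for t bounds all of
      \<open>S\<close> by K q^2 / (1 + K q), which is strictly less than \<open>q\<close>.\<close>
    moreover have "t \<le> K * q\<^sup>2 / (1 + K * q)" if t: "t \<in> S" for t
    proof -
      obtain f g where "t = ip f f" "g \<in> H" "ip g g \<le> 1" "solv lam g f" using t by (auto simp: S_def)
      then have "t \<le> K * (q * (q - t))" using each by simp
      then have "t * (1 + K * q) \<le> K * q\<^sup>2" by (simp add: power2_eq_square algebra_simps)
      moreover have "0 < 1 + K * q" using K q by (simp add: add_pos_nonneg)
      ultimately show ?thesis by (simp add: pos_le_divide_eq)
    qed
    ultimately have "q \<le> K * q\<^sup>2 / (1 + K * q)" unfolding q_def by (rule cSup_least)
    moreover have "0 < 1 + K * q" using K q by (simp add: add_pos_nonneg)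
    ultimately have "q * (1 + K * q) \<le> K * q\<^sup>2" by (simp add: pos_le_divide_eq)
    then show False using q by (simp add: power2_eq_square algebra_simps)
  qed
  then have "q * ip g0 g0 \<le> (1 / lam\<^sup>2) * ip g0 g0" using H.nonneg[OF g0] by (rule mult_right_mono)
  then have "ip f0 f0 \<le> (1 / lam\<^sup>2) * ip g0 g0" using le_q[OF g0 f0] by simp
  then show ?thesis using lam by (simp add: field_simps)
qed

text \<open>The resolvent bound at the midpoint R / 2 of the gap, applied to (L - R/2) u = v - (R/2)
  u. Expanding the square cancels the terms in |u|^2 and leaves R <v, u> \<le> |v|^2, where <v, u> =
  D u u.\<close>

lemma spectral_gap_operator:
  assumes res: "\<And>\<mu>. 0 < \<mu> \<Longrightarrow> \<mu> < R \<Longrightarrow> res \<mu>" and R: "R > 0" and v: "v \<in> H" and u: "solv 0 v u"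
  shows "R * D u u \<le> ip v v"
proof -
  note uF = solv_F[OF u] note uH = FH'[OF uF]
  have "(R / 2)\<^sup>2 * ip u u \<le> ip (\<lambda>x. v x - R / 2 * u x) (\<lambda>x. v x - R / 2 * u x)"
    using res solv_shift[OF u v, of "R / 2"] R H.lincomb[OF v uH, of 1 "- (R / 2)"]
    by (intro resolvent_norm_bound) auto
  also have "\<dots> = ip v v - R * ip v u + (R / 2)\<^sup>2 * ip u u"
    using H.square_lincomb[OF v uH, of 1 "- (R / 2)"] by simp
  finally show ?thesis using solv_eq[OF u uF] by simp
qed

text \<open>For y = L z one has |y|^2 = D(z, y). Cauchy-Schwarz for \<open>D\<close> together with R
  D(z, z) \<le> |y|^2 cancels one factor |y|^2.\<close>

lemma spectral_gap_range:
  assumes res: "\<And>\<mu>. 0 < \<mu> \<Longrightarrow> \<mu> < R \<Longrightarrow> res \<mu>" and R: "R > 0" and y: "y \<in> F" and z: "solv 0 y z"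
  shows "R * ip y y \<le> D y y"
proof (cases "ip y y = 0")
  case True
  then show ?thesis using F.nonneg[OF y] by simp
next
  case False
  then have pos: "ip y y > 0" using H.nonneg[OF FH'[OF y]] by simp
  note zF = solv_F[OF z]
  have "(ip y y)\<^sup>2 = (D z y)\<^sup>2" using solv_eq[OF z y] by simp
  also have "\<dots> \<le> D z z * D y y" by (rule F.Cauchy_Schwarz[OF zF y])
  finally have "R * (ip y y)\<^sup>2 \<le> (R * D z z) * D y y" using R by simp
  also have "\<dots> \<le> ip y y * D y y"
    using spectral_gap_operator[OF res R FH'[OF y] z] F.nonneg[OF y] by (rule mult_right_mono)
  finally have "ip y y * (R * ip y y) \<le> ip y y * D y y" by (simp add: power2_eq_square algebra_simps)
  then show ?thesis using pos by simp
qed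

text \<open>Here \<open>w k = \<delta> (L + \<delta>)\<^sup>-\<^sup>1 f\<close> with \<open>\<delta> = 1 / (k + 1)\<close>, an approximation of the projection of \<open>f\<close> to the
  kernel of \<open>L\<close>; the differences \<open>f - w k\<close> and \<open>w k - w l\<close> lie in the range of \<open>L\<close>.\<close>

lemma kernel_approximation:
  assumes res: "\<And>\<mu>. \<mu> \<noteq> 0 \<Longrightarrow> \<mu> < R \<Longrightarrow> res \<mu>" and R: "R > 0" and f: "f \<in> F"
  obtains w where "\<And>k::nat. w k \<in> F"
    "\<And>k. R * D (w k) (w k) \<le> ip f f / (real k + 1)\<^sup>2"
    "\<And>k. R * ip (\<lambda>x. f x - w k x) (\<lambda>x. f x - w k x) \<le> D (\<lambda>x. f x - w k x) (\<lambda>x. f x - w k x)"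
    "\<And>k l. R * ip (\<lambda>x. w k x - w l x) (\<lambda>x. w k x - w l x) \<le> D (\<lambda>x. w k x - w l x) (\<lambda>x. w k x - w l x)"
proof -
  note fH = FH'[OF f]
  have pres: "\<And>\<mu>. 0 < \<mu> \<Longrightarrow> \<mu> < R \<Longrightarrow> res \<mu>" using res by simp
  define d where "d k = 1 / (real k + 1)" for k :: nat
  have d: "d k > 0" for k by (simp add: d_def)
  have "\<exists>u. solv (- d k) f u" for k
    using res[of "- d k"] d[of k] R fH unfolding res_def by auto
  then obtain u where u: "\<And>k. solv (- d k) f (u k)" by metis
  note uF = solv_F[OF u] note uH = FH'[OF uF]
  define w where "w k x = d k * u k x" for k x
  have wF: "w k \<in> F" for k unfolding w_def by (rule F.scale[OF uF])
  define y where "y k x = f x - w k x" for k x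
  have yF: "y k \<in> F" for k unfolding y_def by (rule F.diff[OF f wF])
  have Lu: "solv 0 (y k) (u k)" for k
    using solv_shift[OF u fH, of k "d k"] by (simp add: y_def[abs_def] w_def)
  \<comment> \<open>\<open>y k\<close> is L (L + d k)^-1 f, and this operator is a contraction
    because L is nonnegative. Combined with the gap it keeps the energy of \<open>u k\<close>
    bounded, so the factor (d k)^2 forces the energy of \<open>w k\<close> to 0.\<close>
  have yf: "ip (y k) (y k) \<le> ip f f" for k
  proof -
    have "D (u k) (u k) + d k * ip (u k) (u k) = ip f (u k)" using solv_eq[OF u uF] by simp
    then have "d k * ip (u k) (u k) \<le> ip f (u k)" using F.nonneg[OF uF[of k]] by simp
    then have "d k * (d k * ip (u k) (u k)) \<le> d k * ip f (u k)" using d[of k] by (intro mult_left_mono) auto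
    moreover have "0 \<le> d k * ip f (u k)"
      using calculation d[of k] H.nonneg[OF uH[of k]] by (meson mult_nonneg_nonneg order_less_imp_le order_trans)
    moreover have "ip (y k) (y k) = ip f f - 2 * (d k * ip f (u k)) + d k * (d k * ip (u k) (u k))"
      using H.square_lincomb[OF fH uH, of 1 "- d k" k] unfolding y_def w_def
      by (simp add: power2_eq_square algebra_simps)
    ultimately show ?thesis by simp
  qed
  show thesis
  proof (rule that[of w])
    show "w k \<in> F" for k by (rule wF)
    show "R * D (w k) (w k) \<le> ip f f / (real k + 1)\<^sup>2" for k
    proof -
      have "D (w k) (w k) = (d k)\<^sup>2 * D (u k) (u k)" unfolding w_def by (rule F.square_scale[OF uF])
      moreover have "R * D (u k) (u k) \<le> ip f f"
        using spectral_gap_operator[OF pres R FH'[OF yF] Lu, of k] yf[of k] by simp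
      ultimately have "R * D (w k) (w k) \<le> (d k)\<^sup>2 * ip f f"
        using mult_left_mono[of "R * D (u k) (u k)" "ip f f" "(d k)\<^sup>2"] by (simp add: algebra_simps)
      then show ?thesis by (simp add: d_def power_divide)
    qed
    show "R * ip (\<lambda>x. f x - w k x) (\<lambda>x. f x - w k x) \<le> D (\<lambda>x. f x - w k x) (\<lambda>x. f x - w k x)" for k
      using spectral_gap_range[OF pres R yF Lu, of k] by (simp add: y_def[abs_def])
    show "R * ip (\<lambda>x. w k x - w l x) (\<lambda>x. w k x - w l x) \<le> D (\<lambda>x. w k x - w l x) (\<lambda>x. w k x - w l x)" for k l
    proof -
      \<comment> \<open>The \<open>f\<close> terms cancel, so the difference of two approximations
        is again in the range of L and the gap inequality applies to it.\<close>
      have eq: "(\<lambda>x. w k x - w l x) = (\<lambda>x. 1 * y l x + (- 1) * y k x)" by (simp add: y_def)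
      have "solv 0 (\<lambda>x. 1 * y l x + (- 1) * y k x) (\<lambda>x. 1 * u l x + (- 1) * u k x)"
        by (rule solv_lincomb[OF Lu Lu FH'[OF yF] FH'[OF yF]])
      from spectral_gap_range[OF pres R F.lincomb[OF yF yF] this] show ?thesis unfolding eq .
    qed
  qed
qed

end

section \<open>The weighted eigenvalue problem\<close>

lemma H12_complete:
  fixes s :: "nat \<Rightarrow> real^'n \<Rightarrow> real"
  assumes W: "open W" "bounded W" and s: "\<And>k. H12 W (s k)"
    and cauchy: "\<And>e. e > 0 \<Longrightarrow> \<exists>N. \<forall>m\<ge>N. \<forall>k\<ge>N.
      Dform W (\<lambda>x. s m x - s k x) (\<lambda>x. s m x - s k x) + (\<integral>x. (s m x - s k x)\<^sup>2 \<partial>lebesgue_on W) < e"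
  obtains f where "H12 W f" "(\<lambda>k. Dform W (\<lambda>x. s k x - f x) (\<lambda>x. s k x - f x)) \<longlonglongrightarrow> 0"
    "(\<lambda>k. \<integral>x. (s k x - f x)\<^sup>2 \<partial>lebesgue_on W) \<longlonglongrightarrow> 0"
proof -
  note fin = finite_measure_lebesgue_on_open[OF W]
  let ?M = "lebesgue_on W"
  define G where "G k = wgrad W (s k)" for k
  have sG: "sobolev W (s k) (G k)" for k unfolding G_def by (rule sobolev_wgrad[OF s])
  have sq: "sq_int ?M (s k)" "sq_int ?M (\<lambda>x. G k x $ i)" for k i using sG by (auto simp: sobolev_def)
  have De: "Dform W (\<lambda>x. s m x - s k x) (\<lambda>x. s m x - s k x) = (\<integral>x. (norm (G m x - G k x))\<^sup>2 \<partial>?M)" for m k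
    using Dform_eq[OF W(1) sobolev_diff[OF W(1) sG sG] sobolev_diff[OF W(1) sG sG]]
    by (simp add: power2_norm_eq_inner)
  have c1: "\<exists>N. \<forall>m\<ge>N. \<forall>k\<ge>N. (\<integral>x. (s m x - s k x)\<^sup>2 \<partial>?M) < e"
    and c2: "\<exists>N. \<forall>m\<ge>N. \<forall>k\<ge>N. (\<integral>x. (norm (G m x - G k x))\<^sup>2 \<partial>?M) < e" if e: "e > 0" for e
  proof -
    obtain N where N: "\<And>m k. m \<ge> N \<Longrightarrow> k \<ge> N \<Longrightarrow> (\<integral>x. (norm (G m x - G k x))\<^sup>2 \<partial>?M) + (\<integral>x. (s m x - s k x)\<^sup>2 \<partial>?M) < e"
      using cauchy[OF e] unfolding De by blast
    have nn: "(\<integral>x. (norm (G m x - G k x))\<^sup>2 \<partial>?M) \<ge> 0" "(\<integral>x. (s m x - s k x)\<^sup>2 \<partial>?M) \<ge> 0" for m k by simp_all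
    have "(\<integral>x. (s m x - s k x)\<^sup>2 \<partial>?M) < e" "(\<integral>x. (norm (G m x - G k x))\<^sup>2 \<partial>?M) < e" if "m \<ge> N" "k \<ge> N" for m k
      using N[OF that] nn[of m k] by linarith+
    then show "\<exists>N. \<forall>m\<ge>N. \<forall>k\<ge>N. (\<integral>x. (s m x - s k x)\<^sup>2 \<partial>?M) < e"
      "\<exists>N. \<forall>m\<ge>N. \<forall>k\<ge>N. (\<integral>x. (norm (G m x - G k x))\<^sup>2 \<partial>?M) < e" by blast+
  qed
  obtain f where f: "sq_int ?M f" "(\<lambda>k. \<integral>x. (s k x - f x)\<^sup>2 \<partial>?M) \<longlonglongrightarrow> 0"
    by (rule sq_int_complete[OF fin sq(1) c1])
  obtain H where H: "\<And>i. sq_int ?M (\<lambda>x. H x $ i)" "\<And>i. (\<lambda>k. \<integral>x. (G k x $ i - H x $ i)\<^sup>2 \<partial>?M) \<longlonglongrightarrow> 0"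
    "(\<lambda>k. \<integral>x. (norm (G k x - H x))\<^sup>2 \<partial>?M) \<longlonglongrightarrow> 0"
    by (rule gradient_limit[OF fin sq(2) c2], assumption, rule that)
  have L1: "L1loc W u" if "sq_int ?M u" for u
    using that integrable_lebesgue_on_subset[OF sq_int_imp_integrable[OF fin that] _ compact_sets_lebesgue open_sets_lebesgue[OF W(1)]]
    by (simp add: L1loc_def sq_int_def)
  have lim: "(\<lambda>k. \<integral>x. \<bar>u k x - v x\<bar> \<partial>lebesgue_on K) \<longlonglongrightarrow> 0"
    if K: "compact K" "K \<subseteq> W" and u: "\<And>k. sq_int ?M (u k)" and v: "sq_int ?M v" and l: "(\<lambda>k. \<integral>x. (u k x - v x)\<^sup>2 \<partial>?M) \<longlonglongrightarrow> 0"
    for K and u :: "nat \<Rightarrow> real^'n \<Rightarrow> real" and v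
    by (rule L1_tendsto_subset[OF sq_int_imp_integrable[OF fin sq_int_diff[OF u v]] K(2)
          compact_sets_lebesgue[OF K(1)] open_sets_lebesgue[OF W(1)]
          L1_tendsto_of_L2_tendsto[OF fin sq_int_diff[OF u v] l]])
  have "weak_grad W f H"
  proof (rule weak_grad_limit[OF W(1)])
    show "weak_grad W (s k) (G k)" for k using sG by (simp add: sobolev_def)
    show "L1loc W f" "\<And>i. L1loc W (\<lambda>x. H x $ i)" by (intro L1 f H)+
    fix K :: "(real^'n) set" assume K: "compact K" "K \<subseteq> W"
    show "(\<lambda>k. \<integral>x. \<bar>s k x - f x\<bar> \<partial>lebesgue_on K) \<longlonglongrightarrow> 0" by (rule lim[OF K sq(1) f])
    show "(\<lambda>k. \<integral>x. \<bar>G k x $ i - H x $ i\<bar> \<partial>lebesgue_on K) \<longlonglongrightarrow> 0" for i by (rule lim[OF K sq(2) H(1,2)])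
  qed
  then have sf: "sobolev W f H" using f H by (simp add: sobolev_def)
  have "Dform W (\<lambda>x. s k x - f x) (\<lambda>x. s k x - f x) = (\<integral>x. (norm (G k x - H x))\<^sup>2 \<partial>?M)" for k
    using Dform_eq[OF W(1) sobolev_diff[OF W(1) sG sf] sobolev_diff[OF W(1) sG sf]]
    by (simp add: power2_norm_eq_inner)
  then show thesis using that[OF sobolev_imp_H12[OF sf]] H(3) f(2) by simp
qed

lemma H12_const:
  fixes W :: "(real^'n) set"
  assumes "open W" "bounded W"
  shows "H12 W (\<lambda>_. c)" "H12 W f \<Longrightarrow> Dform W f (\<lambda>_. c) = 0"
proof -
  have "weak_grad W (\<lambda>_. c) (\<lambda>x. \<chi> i. 0)"
    using weak_grad_C1[OF assms(1), of "\<lambda>_. c" "\<lambda>_ _. 0"] by simp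
  moreover have "(\<chi> i. 0) = (0 :: real^'n)" by (simp add: vec_eq_iff)
  ultimately have s: "sobolev W (\<lambda>_. c) (\<lambda>_. 0)"
    unfolding sobolev_def using sq_int_const[OF finite_measure_lebesgue_on_open[OF assms]] by simp
  show "H12 W (\<lambda>_. c)" by (rule sobolev_imp_H12[OF s])
  show "Dform W f (\<lambda>_. c) = 0" if "H12 W f" using Dform_eq[OF assms(1) sobolev_wgrad[OF that] s] by simp
qed

text \<open>A weight pinched between positive constants leaves the class of square integrable
  functions unchanged. This is what turns \<open>Fa\<close> into \<open>H12\<close>; the lower
  constant \<open>c1\<close> later enters the Poincare inequality.\<close>

lemma Gamma_density_facts:
  fixes a :: "real^'n \<Rightarrow> real"
  assumes W: "open W" and m: "continuous_on W (grad a)"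
    and w: "\<forall>x\<in>W. c1 \<le> (norm (grad a x))\<^sup>2 \<and> (norm (grad a x))\<^sup>2 \<le> c2" and c1: "0 < c1"
  shows "sq_int (Gamma W a) f \<longleftrightarrow> sq_int (lebesgue_on W) f"
    and "sq_int (lebesgue_on W) f \<Longrightarrow> c1 * (\<integral>x. (f x)\<^sup>2 \<partial>lebesgue_on W) \<le> (\<integral>x. (f x)\<^sup>2 \<partial>Gamma W a)"
proof -
  let ?w = "\<lambda>x. (norm (grad a x))\<^sup>2"
  have wm: "?w \<in> borel_measurable (lebesgue_on W)"
    using m by (intro continuous_imp_measurable_on_sets_lebesgue open_sets_lebesgue[OF W] continuous_intros)
  have iff: "integrable (Gamma W a) (\<lambda>x. (f x)\<^sup>2) \<longleftrightarrow> integrable (lebesgue_on W) (\<lambda>x. ?w x * (f x)\<^sup>2)"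
    if "f \<in> borel_measurable (lebesgue_on W)" for f
    unfolding Gamma_def using that wm by (subst integrable_density) auto
  have eq: "(\<integral>x. (f x)\<^sup>2 \<partial>Gamma W a) = (\<integral>x. ?w x * (f x)\<^sup>2 \<partial>lebesgue_on W)"
    if "f \<in> borel_measurable (lebesgue_on W)" for f
    unfolding Gamma_def using that wm by (subst integral_density) auto
  have meas: "f \<in> borel_measurable (Gamma W a) \<longleftrightarrow> f \<in> borel_measurable (lebesgue_on W)" for f :: "real^'n \<Rightarrow> real"
    by (simp add: Gamma_def)
  have b: "AE x in lebesgue_on W. c1 \<le> ?w x \<and> ?w x \<le> c2" using w by (intro AE_I2) simp
  have both: "integrable (lebesgue_on W) (\<lambda>x. ?w x * (f x)\<^sup>2) \<longleftrightarrow> integrable (lebesgue_on W) (\<lambda>x. (f x)\<^sup>2)"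
    if fm: "f \<in> borel_measurable (lebesgue_on W)" for f
  proof
    assume "integrable (lebesgue_on W) (\<lambda>x. ?w x * (f x)\<^sup>2)"
    from integrable_mult_right[OF this, of "1 / c1"]
    show "integrable (lebesgue_on W) (\<lambda>x. (f x)\<^sup>2)"
    proof (rule Bochner_Integration.integrable_bound)
      show "AE x in lebesgue_on W. norm ((f x)\<^sup>2) \<le> norm (1 / c1 * (?w x * (f x)\<^sup>2))"
        using b
      proof eventually_elim
        case (elim x)
        then have "c1 * (f x)\<^sup>2 \<le> ?w x * (f x)\<^sup>2" by (intro mult_right_mono) auto
        then show ?case using c1 by (simp add: field_simps)
      qed
    qed (use fm in measurable)
  next
    assume "integrable (lebesgue_on W) (\<lambda>x. (f x)\<^sup>2)"
    from integrable_mult_right[OF this, of c2]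
    show "integrable (lebesgue_on W) (\<lambda>x. ?w x * (f x)\<^sup>2)"
    proof (rule Bochner_Integration.integrable_bound)
      show "AE x in lebesgue_on W. norm (?w x * (f x)\<^sup>2) \<le> norm (c2 * (f x)\<^sup>2)"
        using b by eventually_elim (use c1 in \<open>auto simp: abs_mult intro!: mult_right_mono\<close>)
    qed (use fm wm in measurable)
  qed
  show iff': "sq_int (Gamma W a) f \<longleftrightarrow> sq_int (lebesgue_on W) f"
    using iff both by (auto simp: sq_int_def meas)
  show "c1 * (\<integral>x. (f x)\<^sup>2 \<partial>lebesgue_on W) \<le> (\<integral>x. (f x)\<^sup>2 \<partial>Gamma W a)" if f: "sq_int (lebesgue_on W) f"
  proof -
    have fm: "f \<in> borel_measurable (lebesgue_on W)" using f by (simp add: sq_int_def)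
    have "c1 * (\<integral>x. (f x)\<^sup>2 \<partial>lebesgue_on W) = (\<integral>x. c1 * (f x)\<^sup>2 \<partial>lebesgue_on W)" by simp
    also have "\<dots> \<le> (\<integral>x. ?w x * (f x)\<^sup>2 \<partial>lebesgue_on W)"
    proof (rule integral_mono_AE)
      show "integrable (lebesgue_on W) (\<lambda>x. c1 * (f x)\<^sup>2)" "integrable (lebesgue_on W) (\<lambda>x. ?w x * (f x)\<^sup>2)"
        using f both[OF fm] by (auto simp: sq_int_def)
      show "AE x in lebesgue_on W. c1 * (f x)\<^sup>2 \<le> ?w x * (f x)\<^sup>2"
        using b by eventually_elim (auto intro: mult_right_mono)
    qed
    finally show ?thesis unfolding eq[OF fm] .
  qed
qed

lemma L2G_eq_sq_int: "L2G W a f = sq_int (Gamma W a) f"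
  by (simp add: L2G_def sq_int_def)

lemma Fa_eq_H12:
  assumes "open W" "bounded W" "\<And>f. sq_int (Gamma W a) f \<longleftrightarrow> sq_int (lebesgue_on W) f"
  shows "Fa W a = {f. H12 W f}"
  using H12e_cases[OF assms(1,2)] by (auto simp: Fa_def L2G_eq_sq_int assms(3))

lemma form_operator_Gamma:
  assumes W: "open W" and eq: "\<And>f. sq_int (Gamma W a) f \<longleftrightarrow> sq_int (lebesgue_on W) f"
  shows "form_operator {f. sq_int (Gamma W a) f} {f. H12 W f} (ipG W a) (Dform W)"
proof -
  have "ipG W a = (\<lambda>f g. \<integral>x. f x * g x \<partial>Gamma W a)" by (simp add: ipG_def fun_eq_iff)
  then interpret H: semi_inner "{f. sq_int (Gamma W a) f}" "ipG W a" using semi_inner_sq_int by metis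
  interpret F: semi_inner "{f. H12 W f}" "Dform W" by (rule semi_inner_Dform[OF W])
  show ?thesis
    by unfold_locales (auto simp: eq H12_iff_sobolev sobolev_def)
qed

lemma mu1_ge: "(\<And>lam. lam < m \<Longrightarrow> lam \<noteq> 0 \<Longrightarrow> lam \<in> resolvent W a) \<Longrightarrow> ereal m \<le> mu1 W a"
  unfolding mu1_def spec_def by (intro INF_greatest) (force simp: not_less[symmetric])

lemma resolvent_of_mu1_ge: "ereal m \<le> mu1 W a \<Longrightarrow> lam < m \<Longrightarrow> lam \<noteq> 0 \<Longrightarrow> lam \<in> resolvent W a"
proof (rule ccontr)
  assume m: "ereal m \<le> mu1 W a" "lam < m" "lam \<noteq> 0" "lam \<notin> resolvent W a"
  then have "mu1 W a \<le> ereal lam" unfolding mu1_def spec_def by (intro INF_lower) auto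
  then have "ereal m \<le> ereal lam" using m(1) by (rule order_trans[rotated])
  then show False using m(2) by simp
qed

text \<open>The approximations \<open>w k\<close> of the kernel projection are Cauchy in energy,
  hence in L2 by the gap applied to their differences. Their limit has zero energy, so it is the
  constant \<open>c\<close>. The gap inequality for \<open>f - w k\<close> then passes to the limit,
  and \<open>c1\<close> converts the weighted norm into the plain one.\<close>

theorem poincare_of_resolvent:
  fixes a f :: "real^'n \<Rightarrow> real"
  assumes W: "open W" "bounded W" "connected W" and cont: "continuous_on W (grad a)"
    and w: "\<forall>x\<in>W. c1 \<le> (norm (grad a x))\<^sup>2 \<and> (norm (grad a x))\<^sup>2 \<le> c2" and c1: "0 < c1"
    and res: "\<And>lam. lam < R \<Longrightarrow> lam \<noteq> 0 \<Longrightarrow> lam \<in> resolvent W a" and R: "0 < R"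
    and f: "H12 W f"
  shows "\<exists>c. R * c1 * (\<integral>x. (f x - c)\<^sup>2 \<partial>lebesgue_on W) \<le> Dform W f f"
proof -
  note fin = finite_measure_lebesgue_on_open[OF W(1,2)]
  note G = Gamma_density_facts[OF W(1) cont w c1]
  note Fa = Fa_eq_H12[OF W(1,2) G(1)]
  interpret form_operator "{f. sq_int (Gamma W a) f}" "{f. H12 W f}" "ipG W a" "Dform W"
    by (rule form_operator_Gamma[OF W(1) G(1)])
  have solves: "solves W a lam g f \<longleftrightarrow> solv lam g f" for lam g f
    unfolding solves_def solv_def Fa by (auto simp: DirE2_eq_Dform[OF W(1,2)])
  have rs: "local.res lam" if "lam \<noteq> 0" "lam < R" for lam
  proof -
    have 1: "lam \<in> resolvent W a" using res that by blast
    show ?thesis unfolding res_def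
    proof
      show "\<forall>g\<in>{f. sq_int (Gamma W a) f}. \<exists>f. solv lam g f"
        using 1 unfolding resolvent_def L2G_eq_sq_int solves by blast
      obtain C where "\<And>g f. sq_int (Gamma W a) g \<Longrightarrow> solv lam g f \<Longrightarrow>
          (\<integral>x. (f x)\<^sup>2 \<partial>Gamma W a) \<le> C * (\<integral>x. (g x)\<^sup>2 \<partial>Gamma W a)"
        using 1 unfolding resolvent_def L2G_eq_sq_int solves by blast
      then show "\<exists>C. \<forall>g\<in>{f. sq_int (Gamma W a) f}. \<forall>f. solv lam g f \<longrightarrow> ipG W a f f \<le> C * ipG W a g g"
        by (intro exI[of _ C]) (simp add: ipG_def power2_eq_square)
    qed
  qed
  have fF: "f \<in> {f. H12 W f}" using f by simp
  obtain w where wF: "\<And>k::nat. H12 W (w k)"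
    and Dw: "\<And>k. R * Dform W (w k) (w k) \<le> ipG W a f f / (real k + 1)\<^sup>2"
    and fw: "\<And>k. R * ipG W a (\<lambda>x. f x - w k x) (\<lambda>x. f x - w k x) \<le> Dform W (\<lambda>x. f x - w k x) (\<lambda>x. f x - w k x)"
    and ww: "\<And>k l. R * ipG W a (\<lambda>x. w k x - w l x) (\<lambda>x. w k x - w l x) \<le> Dform W (\<lambda>x. w k x - w l x) (\<lambda>x. w k x - w l x)"
    by (rule kernel_approximation[OF rs R fF]) (auto intro: that)
  have wF': "w k \<in> {f. H12 W f}" for k using wF by simp
  have sqH: "sq_int (lebesgue_on W) u" if "H12 W u" for u using that by (auto simp: H12_iff_sobolev sobolev_def)
  have ip_ge: "c1 * (\<integral>x. (u x)\<^sup>2 \<partial>lebesgue_on W) \<le> ipG W a u u" if "H12 W u" for u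
    using G(2)[OF sqH[OF that]] by (simp add: ipG_def power2_eq_square)
  define A where "A = ipG W a f f / R"
  have A: "A \<ge> 0" unfolding A_def using H.nonneg[of f] FH' fF R by auto
  have Dw': "Dform W (w k) (w k) \<le> A / (real k + 1)\<^sup>2" for k
    using Dw[of k] R by (simp add: A_def field_simps)
  have "(\<lambda>k. A * ((1 / (real k + 1)) * (1 / (real k + 1)))) \<longlonglongrightarrow> A * (0 * 0)"
    using LIMSEQ_inverse_real_of_nat by (intro tendsto_intros) (simp_all add: inverse_eq_divide add.commute)
  then have tA: "(\<lambda>k. A / (real k + 1)\<^sup>2) \<longlonglongrightarrow> 0" by (simp add: power2_eq_square)
  have Dw0: "(\<lambda>k. Dform W (w k) (w k)) \<longlonglongrightarrow> 0"
    by (rule tendsto_sandwich[OF _ _ tendsto_const tA]) (use F.nonneg[OF wF'] Dw' in auto)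
  have "\<exists>N. \<forall>m\<ge>N. \<forall>k\<ge>N. Dform W (\<lambda>x. w m x - w k x) (\<lambda>x. w m x - w k x) + (\<integral>x. (w m x - w k x)\<^sup>2 \<partial>lebesgue_on W) < e"
    if e: "e > 0" for e
  proof -
    \<comment> \<open>The gap bounds the L2 part by the energy divided by \<open>R * c1\<close>, so
      energy plus L2 norm of a difference is at most \<open>B\<close> times its energy.\<close>
    define B where "B = 1 + 1 / (R * c1)"
    have B: "B > 0" using R c1 by (simp add: B_def add_pos_pos)
    have "e / (4 * B) > 0" using e B by simp
    from LIMSEQ_D[OF Dw0 this] obtain N where N: "\<And>k. k \<ge> N \<Longrightarrow> Dform W (w k) (w k) < e / (4 * B)"
      by (auto simp: abs_less_iff)
    have "Dform W (\<lambda>x. w m x - w k x) (\<lambda>x. w m x - w k x) + (\<integral>x. (w m x - w k x)\<^sup>2 \<partial>lebesgue_on W) < e"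
      if "m \<ge> N" "k \<ge> N" for m k
    proof -
      let ?D = "Dform W (\<lambda>x. w m x - w k x) (\<lambda>x. w m x - w k x)" and ?I = "\<integral>x. (w m x - w k x)\<^sup>2 \<partial>lebesgue_on W"
      have "H12 W (\<lambda>x. w m x - w k x)" using F.diff[OF wF' wF'] by simp
      then have "R * (c1 * ?I) \<le> R * ipG W a (\<lambda>x. w m x - w k x) (\<lambda>x. w m x - w k x)"
        using ip_ge R by (intro mult_left_mono) auto
      also have "\<dots> \<le> ?D" by (rule ww)
      finally have "?I \<le> ?D / (R * c1)" using R c1 by (simp add: field_simps)
      then have "?D + ?I \<le> B * ?D" by (simp add: B_def algebra_simps)
      also have "\<dots> \<le> B * (2 * Dform W (w m) (w m) + 2 * Dform W (w k) (w k))"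
        using F.square_diff_le[OF wF' wF', of m k] B by (intro mult_left_mono) auto
      also have "\<dots> < B * (2 * (e / (4 * B)) + 2 * (e / (4 * B)))"
        using N[OF that(1)] N[OF that(2)] B by (intro mult_strict_left_mono) auto
      also have "\<dots> = e" using B by (simp add: field_simps)
      finally show ?thesis .
    qed
    then show ?thesis by blast
  qed
  from H12_complete[OF W(1,2) wF this]
  obtain g where g: "H12 W g" "(\<lambda>k. Dform W (\<lambda>x. w k x - g x) (\<lambda>x. w k x - g x)) \<longlonglongrightarrow> 0"
    "(\<lambda>k. \<integral>x. (w k x - g x)\<^sup>2 \<partial>lebesgue_on W) \<longlonglongrightarrow> 0" by blast
  have gF: "g \<in> {f. H12 W f}" using g by simp
  have "Dform W g g \<le> 0"
  proof (rule LIMSEQ_le_const)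
    show "(\<lambda>k. 2 * Dform W (w k) (w k) + 2 * Dform W (\<lambda>x. w k x - g x) (\<lambda>x. w k x - g x)) \<longlonglongrightarrow> 0"
      using tendsto_add[OF tendsto_mult_right_zero[OF Dw0] tendsto_mult_right_zero[OF g(2)], of 2 2] by simp
    show "\<exists>N. \<forall>k\<ge>N. Dform W g g \<le> 2 * Dform W (w k) (w k) + 2 * Dform W (\<lambda>x. w k x - g x) (\<lambda>x. w k x - g x)"
    proof (intro exI allI impI)
      show "Dform W g g \<le> 2 * Dform W (w k) (w k) + 2 * Dform W (\<lambda>x. w k x - g x) (\<lambda>x. w k x - g x)" for k
        using F.square_diff_le[OF wF'[of k] F.diff[OF wF'[of k] gF]] by simp
    qed
  qed
  then have "Dform W g g = 0" using F.nonneg[OF gF] by simp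
  then have "(\<integral>x. (norm (wgrad W g x))\<^sup>2 \<partial>lebesgue_on W) = 0"
    by (simp add: Dform_def power2_norm_eq_inner)
  from zero_gradient_imp_constant[OF W(1,3) sobolev_wgrad[OF g(1)] this]
  obtain c where c: "AE x in lebesgue_on W. g x = c" by blast
  have "(\<integral>x. (f x - g x)\<^sup>2 \<partial>lebesgue_on W) = (\<integral>x. (f x - c)\<^sup>2 \<partial>lebesgue_on W)"
  proof (rule integral_cong_AE)
    show "AE x in lebesgue_on W. (f x - g x)\<^sup>2 = (f x - c)\<^sup>2" using c by eventually_elim simp
  qed (use sqH[OF f] sqH[OF g(1)] in \<open>auto simp: sq_int_def\<close>)
  moreover have "R * c1 * (\<integral>x. (f x - g x)\<^sup>2 \<partial>lebesgue_on W) \<le> Dform W f f"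
  proof -
    let ?q = "\<lambda>k. \<integral>x. (w k x - g x)\<^sup>2 \<partial>lebesgue_on W"
    let ?n = "\<integral>x. (f x - g x)\<^sup>2 \<partial>lebesgue_on W"
    interpret Q: semi_inner "{f. sq_int (lebesgue_on W) f}" "\<lambda>f g. \<integral>x. f x * g x \<partial>lebesgue_on W"
      by (rule semi_inner_sq_int)
    have sfg: "sq_int (lebesgue_on W) (\<lambda>x. f x - g x)" and swg: "sq_int (lebesgue_on W) (\<lambda>x. w k x - g x)" for k
      by (intro sq_int_diff sqH f g(1) wF)+
    have expand: "(\<integral>x. (f x - w k x)\<^sup>2 \<partial>lebesgue_on W)
        = ?n - 2 * (\<integral>x. (w k x - g x) * (f x - g x) \<partial>lebesgue_on W) + ?q k" for k
      using Q.square_diff[of "\<lambda>x. f x - g x" "\<lambda>x. w k x - g x"] sfg swg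
      by (simp add: power2_eq_square mult.commute)
    have cross: "(\<lambda>k. \<integral>x. (w k x - g x) * (f x - g x) \<partial>lebesgue_on W) \<longlonglongrightarrow> 0"
    proof (rule Lim_null_comparison)
      show "\<forall>\<^sub>F k in sequentially. norm (\<integral>x. (w k x - g x) * (f x - g x) \<partial>lebesgue_on W) \<le> sqrt (?q k * ?n)"
        using integral_Cauchy_Schwarz[OF swg sfg] by (intro always_eventually allI) (auto intro!: real_le_rsqrt)
      show "(\<lambda>k. sqrt (?q k * ?n)) \<longlonglongrightarrow> 0"
        using tendsto_real_sqrt[OF tendsto_mult_left_zero[OF g(3)]] by simp
    qed
    have l1: "(\<lambda>k. R * c1 * (\<integral>x. (f x - w k x)\<^sup>2 \<partial>lebesgue_on W)) \<longlonglongrightarrow> R * c1 * (?n - 2 * 0 + 0)"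
      unfolding expand by (intro tendsto_intros cross g(3))
    have crossD: "(\<lambda>k. Dform W (w k) f) \<longlonglongrightarrow> 0"
    proof (rule Lim_null_comparison)
      show "\<forall>\<^sub>F k in sequentially. norm (Dform W (w k) f) \<le> sqrt (Dform W (w k) (w k) * Dform W f f)"
        using F.Cauchy_Schwarz[OF wF' fF] by (intro always_eventually allI) (auto intro!: real_le_rsqrt)
      show "(\<lambda>k. sqrt (Dform W (w k) (w k) * Dform W f f)) \<longlonglongrightarrow> 0"
        using tendsto_real_sqrt[OF tendsto_mult_left_zero[OF Dw0]] by simp
    qed
    have expandD: "Dform W (\<lambda>x. f x - w k x) (\<lambda>x. f x - w k x) = Dform W f f - 2 * Dform W (w k) f + Dform W (w k) (w k)" for k
      using F.square_diff[OF fF wF', of k] F.sym[OF fF wF', of k] by simp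
    have l2: "(\<lambda>k. Dform W (\<lambda>x. f x - w k x) (\<lambda>x. f x - w k x)) \<longlonglongrightarrow> Dform W f f - 2 * 0 + 0"
      unfolding expandD by (intro tendsto_intros crossD Dw0)
    have "R * c1 * (\<integral>x. (f x - w k x)\<^sup>2 \<partial>lebesgue_on W) \<le> Dform W (\<lambda>x. f x - w k x) (\<lambda>x. f x - w k x)" for k
    proof -
      have dk: "H12 W (\<lambda>x. f x - w k x)" using F.diff[OF fF wF'] by simp
      have "R * (c1 * (\<integral>x. (f x - w k x)\<^sup>2 \<partial>lebesgue_on W)) \<le> R * ipG W a (\<lambda>x. f x - w k x) (\<lambda>x. f x - w k x)"
        by (rule mult_left_mono[OF ip_ge[OF dk]]) (use R in simp)
      from order_trans[OF this fw[of k]] show ?thesis by (simp only: mult.assoc)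
    qed
    from LIMSEQ_le[OF l1 l2] this show ?thesis by simp
  qed
  ultimately show ?thesis by auto
qed

lemma Gamma_eq_lebesgue_on:
  assumes "\<And>x. x \<in> W \<Longrightarrow> norm (grad a x) = 1"
  shows "Gamma W a = lebesgue_on W"
proof -
  have "(\<lambda>x. ennreal ((norm (grad a x))\<^sup>2)) \<in> borel_measurable (lebesgue_on W)"
    using assms by (subst measurable_cong[where g="\<lambda>_. 1"]) auto
  then have "Gamma W a = density (lebesgue_on W) (\<lambda>_. 1)"
    unfolding Gamma_def using assms by (intro density_cong AE_I2) auto
  then show ?thesis by (simp add: density_1)
qed

text \<open>Below 1 / P, where \<open>P\<close> is the Poincare constant of the ball, the form D -
  lam ip is coercive on functions of mean zero. Only the constants obstruct, and a rank-one term in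
  the mean repairs them; Riesz then produces the resolvent.\<close>

theorem mu1_ball_ge:
  fixes a :: "real^'n \<Rightarrow> real"
  assumes r: "0 < r" and grad: "\<And>x. x \<in> ball c r \<Longrightarrow> norm (grad a x) = 1"
  shows "ereal (1 / (2 ^ (CARD('n) + 1) * r\<^sup>2)) \<le> mu1 (ball c r) a"
proof (rule mu1_ge)
  fix lam :: real
  define P :: real where "P = 2 ^ (CARD('n) + 1) * r\<^sup>2"
  have P: "P > 0" using r by (simp add: P_def)
  assume "lam < 1 / (2 ^ (CARD('n) + 1) * r\<^sup>2)" and lam0: "lam \<noteq> 0"
  then have lamP: "lam * P < 1" using P by (simp only: P_def[symmetric] pos_less_divide_eq)
  let ?W = "ball c r"
  let ?M = "lebesgue_on ?W"
  have W: "open ?W" "bounded ?W" by auto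
  interpret fin: finite_measure ?M by (rule finite_measure_ball)
  have Gam: "Gamma ?W a = ?M" by (rule Gamma_eq_lebesgue_on) (rule grad)
  have Fa: "Fa ?W a = {f. H12 ?W f}" by (rule Fa_eq_H12[OF W]) (simp add: Gam)
  interpret D: semi_inner "{f. H12 ?W f}" "Dform ?W" by (rule semi_inner_Dform[OF W(1)])
  define ip where "ip f g = (\<integral>x. f x * g x \<partial>?M)" for f g :: "real^'n \<Rightarrow> real"
  interpret H: semi_inner "{f. sq_int ?M f}" ip
    unfolding ip_def using semi_inner_sq_int[of ?M] by simp
  have sqH: "sq_int ?M f" if "H12 ?W f" for f using that by (auto simp: H12_iff_sobolev sobolev_def)
  have solves: "solves ?W a lam g f \<longleftrightarrow> H12 ?W f \<and> (\<forall>h. H12 ?W h \<longrightarrow> Dform ?W f h - lam * ip f h = ip g h)" for g f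
    unfolding solves_def Fa ipG_def Gam ip_def by (auto simp: DirE2_eq_Dform[OF W])
  define v where "v = measure lebesgue ?W"
  have v: "v > 0" unfolding v_def by (rule ball_measure_pos[OF r])
  have spv: "measure ?M (space ?M) = v" unfolding v_def by (rule measure_lebesgue_on_space) simp
  have sq1: "sq_int ?M (\<lambda>_. k)" for k by (rule sq_int_const[OF fin.finite_measure_axioms])
  have ip11: "ip (\<lambda>_. 1) (\<lambda>_. 1) = v" using spv by (simp add: ip_def)
  define I where "I f = ip f (\<lambda>_. 1)" for f
  have I_le: "(I f)\<^sup>2 \<le> v * ip f f" if "sq_int ?M f" for f
    using H.Cauchy_Schwarz[of f "\<lambda>_. 1"] that sq1 ip11 by (simp add: I_def mult.commute)
  have I_lin: "I (\<lambda>x. s * f x + t * g x) = s * I f + t * I g" if "sq_int ?M f" "sq_int ?M g" for f g s t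
    unfolding I_def using that sq1 by (intro H.bilinear) auto
  have poin: "ip f f - (I f)\<^sup>2 / v \<le> P * Dform ?W f f" if f: "H12 ?W f" for f
    using poincare_ball[OF r, of c f "wgrad ?W f"] sobolev_wgrad[OF f]
    by (simp add: sobolev_def ip_def I_def v_def P_def Dform_def power2_eq_square[symmetric] power2_norm_eq_inner[symmetric])
  \<comment> \<open>For positive lam the unshifted form equals -lam v at the constant 1, and the
    added term 2 lam v turns this into lam v. For negative lam the form is already coercive.\<close>
  define \<tau> where "\<tau> = (if lam > 0 then 2 / v else 0)"
  have \<tau>0: "\<tau> \<ge> 0" using v by (simp add: \<tau>_def)
  have lam\<tau>: "lam * \<tau> \<ge> 0" using v by (simp add: \<tau>_def)
  define E where "E f h = Dform ?W f h - lam * ip f h + lam * \<tau> * I f * I h" for f h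
  obtain K where K: "K > 0" and coerc: "\<And>f. H12 ?W f \<Longrightarrow> Dform ?W f f + ip f f \<le> K * E f f"
  proof (cases "lam > 0")
    case True
    \<comment> \<open>From E f f \<ge> (1 - lam P) Df + lam m and |f|^2 \<le> P Df + m, with Df the
      energy and m the part of |f|^2 carried by the mean.\<close>
    define K where "K = (1 + P) / (1 - lam * P) + 1 / lam"
    have K: "K > 0" unfolding K_def using P lamP True by (intro add_pos_pos) auto
    show thesis
    proof (rule that[OF K])
      fix f assume f: "H12 ?W f"
      define Df where "Df = Dform ?W f f"
      define m where "m = (I f)\<^sup>2 / v"
      have Df: "Df \<ge> 0" unfolding Df_def using D.nonneg f by simp
      have m: "m \<ge> 0" using v by (simp add: m_def)
      have n: "ip f f \<le> P * Df + m" using poin[OF f] by (simp add: Df_def m_def)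
      have "E f f = Df - lam * ip f f + 2 * lam * m"
        using True v by (simp add: E_def \<tau>_def Df_def m_def power2_eq_square)
      moreover have "lam * ip f f \<le> lam * (P * Df + m)" using n True by (intro mult_left_mono) auto
      ultimately have E1: "(1 - lam * P) * Df + lam * m \<le> E f f" by (simp add: algebra_simps)
      have "(1 - lam * P) * Df \<le> E f f" "lam * m \<le> E f f"
        using E1 Df m True lamP mult_nonneg_nonneg[of "1 - lam * P" Df] mult_nonneg_nonneg[of lam m] by linarith+
      then have "Df \<le> E f f / (1 - lam * P)" "m \<le> E f f / lam"
        using True lamP by (simp_all add: pos_le_divide_eq mult.commute)
      then have "(1 + P) * Df + m \<le> (1 + P) * (E f f / (1 - lam * P)) + E f f / lam"
        using P by (intro add_mono mult_left_mono) auto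
      then have "(1 + P) * Df + m \<le> K * E f f" by (simp add: K_def algebra_simps)
      then show "Dform ?W f f + ip f f \<le> K * E f f" using n by (simp add: Df_def algebra_simps)
    qed
  next
    case False
    then have neg: "lam < 0" using lam0 by simp
    define K where "K = 1 + 1 / (- lam)"
    have K: "K > 0" unfolding K_def using neg by (intro add_pos_pos) auto
    show thesis
    proof (rule that[OF K])
      fix f assume f: "H12 ?W f"
      have nn: "Dform ?W f f \<ge> 0" "ip f f \<ge> 0" using D.nonneg[of f] H.nonneg[of f] f sqH by auto
      have "E f f = Dform ?W f f + (- lam) * ip f f" using False by (simp add: E_def \<tau>_def)
      moreover have "(- lam) * ip f f \<ge> 0" using nn neg by (intro mult_nonneg_nonneg) auto
      ultimately have 1: "Dform ?W f f \<le> E f f" and 2: "(- lam) * ip f f \<le> E f f" using nn by linarith+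
      have "0 < - lam" using neg by simp
      then have "ip f f \<le> E f f / (- lam)" using 2 by (simp only: pos_le_divide_eq mult.commute)
      with 1 have "Dform ?W f f + ip f f \<le> E f f + E f f / (- lam)" by linarith
      also have "\<dots> = K * E f f" by (simp add: K_def algebra_simps)
      finally show "Dform ?W f f + ip f f \<le> K * E f f" .
    qed
  qed
  have H12sq: "f \<in> {f. sq_int ?M f}" if "H12 ?W f" for f using sqH[OF that] by simp
  interpret E: semi_inner "{f. H12 ?W f}" E
  proof
    fix f g h and s t :: real assume f: "f \<in> {f. H12 ?W f}" and g: "g \<in> {f. H12 ?W f}"
    show "(\<lambda>x. s * f x + t * g x) \<in> {f. H12 ?W f}" by (rule D.lincomb[OF f g])
    have fH: "f \<in> {f. sq_int ?M f}" and gH: "g \<in> {f. sq_int ?M f}" using f g H12sq by auto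
    show "E f g = E g f" using D.sym[OF f g] H.sym[OF fH gH] by (simp add: E_def mult_ac)
    assume h: "h \<in> {f. H12 ?W f}"
    have hH: "h \<in> {f. sq_int ?M f}" using h H12sq by auto
    show "E (\<lambda>x. s * f x + t * g x) h = s * E f h + t * E g h"
      using D.bilinear[OF f g h] H.bilinear[OF fH gH hH] I_lin[of f g] fH gH by (simp add: E_def algebra_simps)
  next
    fix f assume "f \<in> {f. H12 ?W f}"
    then have f: "H12 ?W f" by simp
    have "0 \<le> Dform ?W f f + ip f f" using D.nonneg[of f] H.nonneg[of f] f sqH by auto
    then have "0 \<le> K * E f f" using coerc[OF f] by simp
    then show "0 \<le> E f f" using K by (simp add: zero_le_mult_iff)
  qed
  have E_upper: "E f f \<le> Dform ?W f f + (\<bar>lam\<bar> + lam * \<tau> * v) * ip f f" if f: "H12 ?W f" for f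
  proof -
    have nn: "ip f f \<ge> 0" using H.nonneg[of f] sqH[OF f] by simp
    have "- lam * ip f f \<le> \<bar>lam\<bar> * ip f f" using nn by (intro mult_right_mono) auto
    moreover have "lam * \<tau> * (I f)\<^sup>2 \<le> lam * \<tau> * (v * ip f f)"
      using I_le[OF sqH[OF f]] lam\<tau> by (rule mult_left_mono)
    ultimately show ?thesis by (simp add: E_def power2_eq_square algebra_simps)
  qed
  have E_complete: "\<exists>f\<in>{f. H12 ?W f}. (\<lambda>k. E (\<lambda>x. s k x - f x) (\<lambda>x. s k x - f x)) \<longlonglongrightarrow> 0"
    if s: "\<And>k::nat. s k \<in> {f. H12 ?W f}"
      and cau: "\<And>e. e > 0 \<Longrightarrow> \<exists>N. \<forall>m\<ge>N. \<forall>k\<ge>N. E (\<lambda>x. s m x - s k x) (\<lambda>x. s m x - s k x) < e" for s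
  proof -
    have s': "H12 ?W (s k)" for k using s by simp
    have diff: "H12 ?W (\<lambda>x. f x - g x)" if "H12 ?W f" "H12 ?W g" for f g using D.diff that by simp
    have cau': "\<exists>N. \<forall>m\<ge>N. \<forall>k\<ge>N. Dform ?W (\<lambda>x. s m x - s k x) (\<lambda>x. s m x - s k x) + (\<integral>x. (s m x - s k x)\<^sup>2 \<partial>?M) < e"
      if e: "e > 0" for e
    proof -
      obtain N where N: "\<And>m k. m \<ge> N \<Longrightarrow> k \<ge> N \<Longrightarrow> E (\<lambda>x. s m x - s k x) (\<lambda>x. s m x - s k x) < e / K"
        using cau[of "e / K"] e K by auto
      have "Dform ?W (\<lambda>x. s m x - s k x) (\<lambda>x. s m x - s k x) + (\<integral>x. (s m x - s k x)\<^sup>2 \<partial>?M) < e"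
        if "m \<ge> N" "k \<ge> N" for m k
        using coerc[OF diff[OF s' s'], of m k] N[OF that] K by (simp add: ip_def power2_eq_square pos_less_divide_eq mult.commute)
      then show ?thesis by blast
    qed
    obtain f where f: "H12 ?W f" and f1: "(\<lambda>k. Dform ?W (\<lambda>x. s k x - f x) (\<lambda>x. s k x - f x)) \<longlonglongrightarrow> 0"
      and f2: "(\<lambda>k. \<integral>x. (s k x - f x)\<^sup>2 \<partial>?M) \<longlonglongrightarrow> 0"
      by (rule H12_complete[OF W s' cau'], assumption, rule that)
    have f2': "(\<lambda>k. ip (\<lambda>x. s k x - f x) (\<lambda>x. s k x - f x)) \<longlonglongrightarrow> 0"
      using f2 by (simp add: ip_def power2_eq_square)
    have up: "(\<lambda>k. Dform ?W (\<lambda>x. s k x - f x) (\<lambda>x. s k x - f x) + (\<bar>lam\<bar> + lam * \<tau> * v) * ip (\<lambda>x. s k x - f x) (\<lambda>x. s k x - f x)) \<longlonglongrightarrow> 0"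
      using tendsto_add[OF f1 tendsto_mult_right_zero[OF f2']] by simp
    have "(\<lambda>k. E (\<lambda>x. s k x - f x) (\<lambda>x. s k x - f x)) \<longlonglongrightarrow> 0"
    proof (rule tendsto_sandwich[OF _ _ tendsto_const up]; intro always_eventually allI)
      show "0 \<le> E (\<lambda>x. s k x - f x) (\<lambda>x. s k x - f x)" for k using E.nonneg diff[OF s' f] by simp
      show "E (\<lambda>x. s k x - f x) (\<lambda>x. s k x - f x) \<le> Dform ?W (\<lambda>x. s k x - f x) (\<lambda>x. s k x - f x)
          + (\<bar>lam\<bar> + lam * \<tau> * v) * ip (\<lambda>x. s k x - f x) (\<lambda>x. s k x - f x)" for k
        by (rule E_upper[OF diff[OF s' f]])
    qed
    then show ?thesis using f by blast
  qed
  \<comment> \<open>The right side belonging to the shifted form: as lam I f = - I g for a solution,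
    the extra term on the left equals -\<tau> times I g times I h.\<close>
  define gg where "gg g x = 1 * g x + (- (\<tau> * I g)) * 1" for g :: "real^'n \<Rightarrow> real" and x
  have ggH: "gg g \<in> {f. sq_int ?M f}" if "sq_int ?M g" for g
    unfolding gg_def using that sq1 by (intro H.lincomb) auto
  have ip_gg: "ip (gg g) h = ip g h - \<tau> * I g * I h" if "sq_int ?M g" "sq_int ?M h" for g h
  proof -
    have "ip (gg g) h = 1 * ip g h + (- (\<tau> * I g)) * ip (\<lambda>_. 1) h"
      unfolding gg_def using that sq1 by (intro H.bilinear) auto
    also have "ip (\<lambda>_. 1) h = I h" unfolding I_def using that sq1 by (intro H.sym) auto
    finally show ?thesis by simp
  qed
  have one: "H12 ?W (\<lambda>_. 1)" by (rule H12_const(1)[OF W])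
  text \<open>The shift by \<open>\<tau> I\<close> makes the form coercive also on constants; testing with \<open>1\<close> shows that
    it does not change the equation.\<close>
  have mean: "lam * I f = - I g" if f: "H12 ?W f" and eq: "Dform ?W f (\<lambda>_. 1) - lam * ip f (\<lambda>_. 1) = ip g (\<lambda>_. 1)" for f g
    using eq H12_const(2)[OF W f, of 1] by (simp add: I_def)
  have solves_E: "\<forall>h. H12 ?W h \<longrightarrow> E f h = ip (gg g) h" if s: "solves ?W a lam g f" and g: "sq_int ?M g" for f g
  proof (intro allI impI)
    fix h assume h: "H12 ?W h"
    have f: "H12 ?W f" using s solves by simp
    have "lam * I f = - I g" using s one unfolding solves by (intro mean) auto
    then have "lam * \<tau> * I f * I h = - \<tau> * I g * I h" by (metis mult.assoc mult.commute mult_minus_left mult_minus_right)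
    moreover have "Dform ?W f h - lam * ip f h = ip g h" using s h by (simp add: solves)
    ultimately show "E f h = ip (gg g) h" using ip_gg[OF g sqH[OF h]] by (simp add: E_def)
  qed
  define C where "C = K\<^sup>2 * (2 + 2 * \<tau>\<^sup>2 * v\<^sup>2)"
  have bound: "ip f f \<le> C * ip g g" if s: "solves ?W a lam g f" and g: "sq_int ?M g" for f g
  proof -
    have f: "H12 ?W f" using s solves by simp
    have nn: "ip f f \<ge> 0" "Dform ?W f f \<ge> 0" "ip g g \<ge> 0" using D.nonneg[of f] H.nonneg[of f] H.nonneg[of g] f sqH g by auto
    have "ip f f \<le> K * E f f" using coerc[OF f] nn by simp
    also have "E f f = ip (gg g) f" using solves_E[OF s g] f by simp
    finally have "ip f f \<le> K * ip (gg g) f" .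
    then have "(ip f f)\<^sup>2 \<le> (K * ip (gg g) f)\<^sup>2" using nn by (intro power_mono) auto
    also have "\<dots> \<le> K\<^sup>2 * (ip (gg g) (gg g) * ip f f)"
      using H.Cauchy_Schwarz[OF ggH[OF g] H12sq[OF f]] by (simp add: power_mult_distrib mult_left_mono)
    finally have "ip f f * ip f f \<le> (K\<^sup>2 * ip (gg g) (gg g)) * ip f f" by (simp add: power2_eq_square mult_ac)
    \<comment> \<open>Cancelling one factor \<open>ip f f\<close> needs it to be nonzero; otherwise
      the right side is nonnegative anyway.\<close>
    then have 1: "ip f f \<le> K\<^sup>2 * ip (gg g) (gg g)"
      using nn(1) H.nonneg[OF ggH[OF g]] by (cases "ip f f = 0") auto
    have "ip (gg g) (gg g) = ip g g - 2 * \<tau> * (I g)\<^sup>2 + \<tau>\<^sup>2 * (I g)\<^sup>2 * v"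
      unfolding gg_def using H.square_lincomb[of g "\<lambda>_. 1" 1 "- (\<tau> * I g)"] g sq1 ip11
      by (simp add: I_def power2_eq_square algebra_simps)
    also have "\<dots> \<le> ip g g + \<tau>\<^sup>2 * v * (v * ip g g)"
    proof -
      have "(\<tau>\<^sup>2 * v) * (I g)\<^sup>2 \<le> (\<tau>\<^sup>2 * v) * (v * ip g g)" using v by (intro mult_left_mono I_le[OF g]) simp
      moreover have "\<tau>\<^sup>2 * (I g)\<^sup>2 * v = (\<tau>\<^sup>2 * v) * (I g)\<^sup>2" by simp
      moreover have "0 \<le> 2 * \<tau> * (I g)\<^sup>2" using \<tau>0 by simp
      ultimately show ?thesis by linarith
    qed
    also have "\<dots> \<le> (2 + 2 * \<tau>\<^sup>2 * v\<^sup>2) * ip g g"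
    proof -
      have "0 \<le> (\<tau>\<^sup>2 * v\<^sup>2) * ip g g" using nn(3) by simp
      moreover have "\<tau>\<^sup>2 * v * (v * ip g g) = (\<tau>\<^sup>2 * v\<^sup>2) * ip g g" by (simp add: power2_eq_square)
      moreover have "(2 + 2 * \<tau>\<^sup>2 * v\<^sup>2) * ip g g = 2 * ip g g + 2 * ((\<tau>\<^sup>2 * v\<^sup>2) * ip g g)" by (simp add: algebra_simps)
      ultimately show ?thesis using nn(3) by linarith
    qed
    finally have "K\<^sup>2 * ip (gg g) (gg g) \<le> K\<^sup>2 * ((2 + 2 * \<tau>\<^sup>2 * v\<^sup>2) * ip g g)" by (intro mult_left_mono) auto
    then show ?thesis using 1 by (simp add: C_def mult.assoc)
  qed
  have exist: "\<exists>f. solves ?W a lam g f" if g: "sq_int ?M g" for g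
  proof -
    have "\<exists>f\<in>{f. H12 ?W f}. \<forall>h\<in>{f. H12 ?W f}. E f h = ip (gg g) h"
    proof (rule E.riesz[OF _ E_complete])
      show "{f. H12 ?W f} \<noteq> {}" using one by blast
      show "0 \<le> ip (gg g) (gg g) * K" using H.nonneg[OF ggH[OF g]] K by simp
      show "ip (gg g) (\<lambda>x. s * f x + t * h x) = s * ip (gg g) f + t * ip (gg g) h"
        if "f \<in> {f. H12 ?W f}" "h \<in> {f. H12 ?W f}" for f h s t
        using that ggH[OF g] H12sq by (intro H.bilinear_right) auto
      show "(ip (gg g) f)\<^sup>2 \<le> ip (gg g) (gg g) * K * E f f" if "f \<in> {f. H12 ?W f}" for f
      proof -
        have f: "H12 ?W f" using that by simp
        have "(ip (gg g) f)\<^sup>2 \<le> ip (gg g) (gg g) * ip f f" by (rule H.Cauchy_Schwarz[OF ggH[OF g] H12sq[OF f]])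
        also have "\<dots> \<le> ip (gg g) (gg g) * (K * E f f)"
          using coerc[OF f] D.nonneg[of f] f H.nonneg[OF ggH[OF g]] by (intro mult_left_mono) auto
        finally show ?thesis by (simp add: mult.assoc)
      qed
    qed
    then obtain f where f: "H12 ?W f" and eq: "\<And>h. H12 ?W h \<Longrightarrow> E f h = ip (gg g) h" by blast
    \<comment> \<open>Testing with 1 gives (\<tau> v - 1) (lam I f + I g) = 0, and \<tau> v is 0 or
      2, so the second factor vanishes and the shift drops out.\<close>
    have "- lam * I f + lam * \<tau> * I f * v = I g - \<tau> * I g * v"
      using eq[OF one] H12_const(2)[OF W f, of 1] ip_gg[OF g sq1[of 1]] ip11 by (simp add: E_def I_def)
    then have m: "lam * I f = - I g" using v by (auto simp: \<tau>_def split: if_splits)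
    have "Dform ?W f h - lam * ip f h = ip g h" if h: "H12 ?W h" for h
    proof -
      have "lam * \<tau> * I f * I h = - \<tau> * I g * I h" using m by (metis mult.assoc mult.commute mult_minus_left mult_minus_right)
      then show ?thesis using eq[OF h] ip_gg[OF g sqH[OF h]] by (simp add: E_def)
    qed
    then show ?thesis using f by (auto simp: solves)
  qed
  show "lam \<in> resolvent ?W a"
    unfolding resolvent_def mem_Collect_eq L2G_eq_sq_int Gam
  proof (intro conjI allI impI)
    show "\<exists>f. solves ?W a lam g f" if "sq_int ?M g" for g by (rule exist[OF that])
    show "\<exists>C. \<forall>g f. sq_int ?M g \<and> solves ?W a lam g f \<longrightarrow> (\<integral>x. (f x)\<^sup>2 \<partial>?M) \<le> C * (\<integral>x. (g x)\<^sup>2 \<partial>?M)"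
      using bound by (intro exI[of _ C]) (auto simp: ip_def power2_eq_square)
    fix g f1 f2 assume s: "sq_int ?M g \<and> solves ?W a lam g f1 \<and> solves ?W a lam g f2"
    have f12: "f1 \<in> {f. H12 ?W f}" "f2 \<in> {f. H12 ?W f}" using s solves by auto
    note f12H = H12sq[OF CollectD[OF f12(1)]] H12sq[OF CollectD[OF f12(2)]]
    have "solves ?W a lam (\<lambda>_. 0) (\<lambda>x. f1 x - f2 x)"
      unfolding solves
    proof (intro conjI allI impI)
      show "H12 ?W (\<lambda>x. f1 x - f2 x)" using D.diff[OF f12] by simp
      fix h assume h: "H12 ?W h"
      then have hF: "h \<in> {f. H12 ?W f}" by simp
      have "Dform ?W f1 h - lam * ip f1 h = ip g h" "Dform ?W f2 h - lam * ip f2 h = ip g h"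
        using s h solves by auto
      moreover have "ip (\<lambda>_. 0) h = 0" by (simp add: ip_def)
      ultimately show "Dform ?W (\<lambda>x. f1 x - f2 x) h - lam * ip (\<lambda>x. f1 x - f2 x) h = ip (\<lambda>_. 0) h"
        unfolding D.diff_left[OF f12 hF] H.diff_left[OF f12H H12sq[OF h]] right_diff_distrib
        by linarith
    qed
    from bound[OF this sq1] have "(\<integral>x. (f1 x - f2 x)\<^sup>2 \<partial>?M) \<le> 0" by (simp add: ip_def power2_eq_square)
    then have "(\<integral>x. (f1 x - f2 x)\<^sup>2 \<partial>?M) = 0" by (simp add: order_antisym)
    moreover have "sq_int ?M (\<lambda>x. f1 x - f2 x)" using sq_int_diff f12H by blast
    ultimately have "AE x in ?M. (f1 x - f2 x)\<^sup>2 = 0"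
      by (subst (asm) integral_nonneg_eq_0_iff_AE) (auto simp: sq_int_def)
    then show "AE x in ?M. f1 x = f2 x" by eventually_elim simp
  qed
qed

section \<open>Volume distortion and matrices\<close>

text \<open>The change of variables theorems of the library need a well-ordered index type; every finite type
  has a well-ordered copy.\<close>

typedef 'a wo = "UNIV :: 'a set" by auto

instantiation wo :: (finite) "{finite, wellorder}"
begin

definition less_eq_wo :: "'a wo \<Rightarrow> 'a wo \<Rightarrow> bool" where
  "less_eq_wo x y \<longleftrightarrow> to_nat (Rep_wo x) \<le> to_nat (Rep_wo y)"

definition less_wo :: "'a wo \<Rightarrow> 'a wo \<Rightarrow> bool" where
  "less_wo x y \<longleftrightarrow> to_nat (Rep_wo x) < to_nat (Rep_wo y)"

instance
proof
  show "finite (UNIV :: 'a wo set)"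
    by (rule finite_imageD[of Rep_wo]) (auto simp: inj_on_def Rep_wo_inject)
  fix x y z :: "'a wo" and P
  show "(x < y) = (x \<le> y \<and> \<not> y \<le> x)" "x \<le> x" "x \<le> y \<Longrightarrow> y \<le> z \<Longrightarrow> x \<le> z" "x \<le> y \<or> y \<le> x"
    by (auto simp: less_eq_wo_def less_wo_def)
  show "x \<le> y \<Longrightarrow> y \<le> x \<Longrightarrow> x = y"
    by (simp add: less_eq_wo_def Rep_wo_inject)
  show "P x" if step: "\<And>x :: 'a wo. (\<And>y. y < x \<Longrightarrow> P y) \<Longrightarrow> P x"
    by (rule measure_induct_rule[where f="\<lambda>x. to_nat (Rep_wo x)"], rule step) (simp add: less_wo_def)
qed

end

definition to_wo :: "real^'n \<Rightarrow> real^'n wo" where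
  "to_wo x = (\<chi> i. x $ Rep_wo i)"

definition of_wo :: "real^'n wo \<Rightarrow> real^'n" where
  "of_wo y = (\<chi> j. y $ Abs_wo j)"

definition mat_wo :: "real^'n^'n \<Rightarrow> real^'n wo^'n wo" where
  "mat_wo A = (\<chi> i j. A $ Rep_wo i $ Rep_wo j)"

lemma of_to_wo [simp]: "of_wo (to_wo x) = x" and to_of_wo [simp]: "to_wo (of_wo y) = y"
  unfolding to_wo_def of_wo_def by (simp_all add: Abs_wo_inverse Rep_wo_inverse)

lemma linear_to_wo: "linear to_wo" and linear_of_wo: "linear of_wo"
  by (auto intro!: linearI simp: to_wo_def of_wo_def vec_eq_iff)

lemma bij_Rep_wo: "bij_betw Rep_wo (UNIV :: 'n wo set) UNIV"
  by (intro bij_betw_byWitness[of _ Abs_wo]) (auto simp: Abs_wo_inverse Rep_wo_inverse)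

lemma prod_Basis_vec:
  fixes f :: "real^'n \<Rightarrow> real"
  shows "(\<Prod>b\<in>Basis. f b) = (\<Prod>i\<in>UNIV. f (axis i 1))"
proof -
  have B: "(Basis :: (real^'n) set) = range (\<lambda>i. axis i 1)" by (auto simp: Basis_vec_def)
  have "inj (\<lambda>i :: 'n. axis i (1::real))" by (auto simp: inj_on_def axis_eq_axis)
  then show ?thesis unfolding B by (simp add: prod.reindex)
qed

text \<open>Reindexing coordinates carries boxes to boxes with the same side lengths, and box
  volumes characterise Lebesgue measure.\<close>

lemma distr_to_wo: "distr lborel borel (to_wo :: real^'n \<Rightarrow> real^'n wo) = lborel"
proof (rule lborel_eqI[symmetric])
  have m: "(to_wo :: real^'n \<Rightarrow> real^'n wo) \<in> borel_measurable borel"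
    using linear_to_wo by (intro borel_measurable_continuous_onI linear_continuous_on) (simp add: linear_conv_bounded_linear)
  fix l u :: "real^'n wo" assume lu: "\<And>b. b \<in> Basis \<Longrightarrow> l \<bullet> b \<le> u \<bullet> b"
  have lu': "l $ i \<le> u $ i" for i using lu[of "axis i 1"] by (auto simp: inner_axis Basis_vec_def)
  have "to_wo -` box l u = box (of_wo l :: real^'n) (of_wo u)"
  proof (intro set_eqI iffI)
    fix x :: "real^'n"
    show "x \<in> box (of_wo l) (of_wo u)" if "x \<in> to_wo -` box l u"
    proof -
      have "l $ Abs_wo j < x $ Rep_wo (Abs_wo j) \<and> x $ Rep_wo (Abs_wo j) < u $ Abs_wo j" for j
        using that by (auto simp: mem_box_cart to_wo_def)
      then show ?thesis by (simp add: mem_box_cart of_wo_def Abs_wo_inverse)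
    qed
    show "x \<in> to_wo -` box l u" if "x \<in> box (of_wo l) (of_wo u)"
    proof -
      have "l $ Abs_wo (Rep_wo i) < x $ Rep_wo i \<and> x $ Rep_wo i < u $ Abs_wo (Rep_wo i)" for i
        using that by (auto simp: mem_box_cart of_wo_def)
      then show ?thesis by (simp add: mem_box_cart to_wo_def Rep_wo_inverse)
    qed
  qed
  then have "emeasure (distr lborel borel (to_wo :: real^'n \<Rightarrow> real^'n wo)) (box l u) = emeasure lborel (box (of_wo l :: real^'n) (of_wo u))"
    using m by (subst emeasure_distr) auto
  also have "\<dots> = (\<Prod>b\<in>Basis. (of_wo u - of_wo l :: real^'n) \<bullet> b)"
  proof (rule emeasure_lborel_box)
    fix b :: "real^'n" assume "b \<in> Basis"
    then obtain j where "b = axis j 1" by (auto simp: Basis_vec_def)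
    then show "of_wo l \<bullet> b \<le> of_wo u \<bullet> b" using lu' by (simp add: inner_axis of_wo_def)
  qed
  also have "(\<Prod>b\<in>Basis. (of_wo u - of_wo l :: real^'n) \<bullet> b) = (\<Prod>j\<in>UNIV. u $ Abs_wo j - l $ Abs_wo j)"
    by (subst prod_Basis_vec) (simp add: inner_axis of_wo_def)
  also have "\<dots> = (\<Prod>i\<in>UNIV. u $ Abs_wo (Rep_wo i) - l $ Abs_wo (Rep_wo i))"
    using prod.reindex_bij_betw[OF bij_Rep_wo, of "\<lambda>j. u $ Abs_wo j - l $ Abs_wo j"] by simp
  also have "\<dots> = (\<Prod>b\<in>Basis. (u - l) \<bullet> b)"
    by (subst prod_Basis_vec) (simp add: inner_axis Rep_wo_inverse)
  finally show "emeasure (distr lborel borel (to_wo :: real^'n \<Rightarrow> real^'n wo)) (box l u) = ennreal (\<Prod>b\<in>Basis. (u - l) \<bullet> b)" .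
qed simp

lemma open_to_wo_image:
  fixes S :: "(real^'n) set"
  assumes "open S"
  shows "to_wo ` S = of_wo -` S" and "open (to_wo ` S)" and "measure lebesgue (to_wo ` S) = measure lebesgue S"
proof -
  show eq: "to_wo ` S = of_wo -` S" by (force simp: image_iff intro: bexI[of _ "of_wo _"])
  show op: "open (to_wo ` S)" unfolding eq
    using linear_of_wo assms by (intro open_vimage linear_continuous_on) (simp_all add: linear_conv_bounded_linear)
  have m: "(to_wo :: real^'n \<Rightarrow> real^'n wo) \<in> borel_measurable borel"
    using linear_to_wo by (intro borel_measurable_continuous_onI linear_continuous_on) (simp add: linear_conv_bounded_linear)
  have v: "to_wo -` to_wo ` S = S" by (auto simp: inj_image_mem_iff inj_on_def dest: arg_cong[of _ _ of_wo])
  have "measure lebesgue (to_wo ` S) = measure lborel (to_wo ` S)" using op by simp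
  also have "\<dots> = measure (distr lborel borel to_wo) (to_wo ` S)" by (simp add: distr_to_wo)
  also have "\<dots> = measure lborel S" using m op v by (subst measure_distr) auto
  also have "\<dots> = measure lebesgue S" using assms by simp
  finally show "measure lebesgue (to_wo ` S) = measure lebesgue S" .
qed

text \<open>Vanishing is compared through invertibility: \<open>mat_wo\<close> is a bijection
  respecting products and the identity. This avoids reindexing permutations and their signs in the
  determinant.\<close>

lemma det_mat_wo_eq_0:
  fixes A :: "real^'n^'n"
  shows "det (mat_wo A) = 0 \<longleftrightarrow> det A = 0"
proof -
  have mult: "mat_wo (A ** B) = mat_wo A ** mat_wo B" for A B :: "real^'n^'n"
    using sum.reindex_bij_betw[OF bij_Rep_wo, of "\<lambda>k. A $ _ $ k * B $ k $ _"]
    by (simp add: mat_wo_def matrix_matrix_mult_def vec_eq_iff)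
  have one: "mat_wo (mat 1 :: real^'n^'n) = mat 1"
    by (simp add: mat_wo_def mat_def vec_eq_iff Rep_wo_inject)
  have surj: "\<exists>B. mat_wo B = C" for C :: "real^'n wo^'n wo"
    by (rule exI[of _ "\<chi> i j. C $ Abs_wo i $ Abs_wo j"]) (simp add: mat_wo_def vec_eq_iff Rep_wo_inverse)
  have inj: "B = C" if "mat_wo B = mat_wo C" for B C :: "real^'n^'n"
  proof (subst vec_eq_iff, subst vec_eq_iff, intro allI)
    fix i j
    have "mat_wo B $ Abs_wo i $ Abs_wo j = mat_wo C $ Abs_wo i $ Abs_wo j" using that by simp
    then show "B $ i $ j = C $ i $ j" by (simp add: mat_wo_def Abs_wo_inverse)
  qed
  have "invertible (mat_wo A) \<longleftrightarrow> invertible A"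
  proof
    assume "invertible (mat_wo A)"
    then obtain C where C: "mat_wo A ** C = mat 1" "C ** mat_wo A = mat 1" by (auto simp: invertible_def)
    obtain B where B: "mat_wo B = C" using surj by blast
    have "A ** B = mat 1" "B ** A = mat 1" using C inj by (auto simp: B[symmetric] mult[symmetric] one[symmetric])
    then show "invertible A" by (auto simp: invertible_def)
  next
    assume "invertible A"
    then obtain B where "A ** B = mat 1" "B ** A = mat 1" by (auto simp: invertible_def)
    then have "mat_wo A ** mat_wo B = mat 1" "mat_wo B ** mat_wo A = mat 1" by (simp_all add: mult[symmetric] one)
    then show "invertible (mat_wo A)" by (auto simp: invertible_def)
  qed
  then show ?thesis by (simp add: invertible_det_nz)
qed

section \<open>Volumes of images and a determinant bound by compactness\<close>

lemma continuous_on_det_entries: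
  fixes A :: "'a::topological_space \<Rightarrow> real^'n^'n"
  assumes "\<And>i j. continuous_on S (\<lambda>x. A x $ i $ j)"
  shows "continuous_on S (\<lambda>x. det (A x))"
  unfolding det_def by (intro continuous_intros assms)

lemma measure_image_bounds_wo:
  fixes F :: "real^'m::{finite,wellorder} \<Rightarrow> real^'m::{finite,wellorder}"
  assumes S: "open S" "bounded S"
    and der: "\<And>x. x \<in> S \<Longrightarrow> (F has_derivative F' x) (at x)" and inj: "inj_on F S"
    and cont: "continuous_on S (\<lambda>x. det (matrix (F' x)))"
    and bnd: "\<And>x. x \<in> S \<Longrightarrow> a \<le> \<bar>det (matrix (F' x))\<bar> \<and> \<bar>det (matrix (F' x))\<bar> \<le> b"
  shows "a * measure lebesgue S \<le> measure lebesgue (F ` S)" and "measure lebesgue (F ` S) \<le> b * measure lebesgue S"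
proof -
  let ?M = "lebesgue_on S" and ?J = "\<lambda>x. \<bar>det (matrix (F' x))\<bar>"
  interpret finite_measure ?M by (rule finite_measure_lebesgue_on_open[OF S])
  have m: "?J \<in> borel_measurable ?M"
    using cont by (intro continuous_imp_measurable_on_sets_lebesgue open_sets_lebesgue[OF S(1)] continuous_intros)
  have i: "integrable ?M ?J"
    by (rule integrable_const_bound[where B=b, OF _ m]) (use bnd in \<open>auto intro: AE_I2\<close>)
  define I where "I = (\<integral>x. ?J x \<partial>?M)"
  have "(?J has_integral I) S" unfolding I_def
    by (rule has_integral_integral_lebesgue_on[OF i open_sets_lebesgue[OF S(1)]])
  then have "measure lebesgue (F ` S) = I"
    using has_measure_differentiable_image[OF open_sets_lebesgue[OF S(1)] has_derivative_at_withinI[OF der] inj, of I] by blast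
  moreover have sp: "measure ?M S = measure lebesgue S"
    using measure_lebesgue_on_space[OF open_sets_lebesgue[OF S(1)]] by simp
  moreover have "a * measure lebesgue S = (\<integral>x. a \<partial>?M)" "b * measure lebesgue S = (\<integral>x. b \<partial>?M)"
    by (simp_all add: sp)
  moreover have "(\<integral>x. a \<partial>?M) \<le> I" unfolding I_def by (rule integral_mono_AE[OF _ i]) (use bnd in \<open>auto intro: AE_I2\<close>)
  moreover have "I \<le> (\<integral>x. b \<partial>?M)" unfolding I_def by (rule integral_mono_AE[OF i]) (use bnd in \<open>auto intro: AE_I2\<close>)
  ultimately show "a * measure lebesgue S \<le> measure lebesgue (F ` S)" "measure lebesgue (F ` S) \<le> b * measure lebesgue S"
    by (simp_all add: mult.commute)
qed

text \<open>The change of variables is carried out for the map conjugated by the volume preserving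
  reindexing. The Jacobian stays in reindexed form, since the applications need only its continuity
  and where it vanishes.\<close>

lemma measure_image_bounds:
  fixes f :: "real^'n \<Rightarrow> real^'n"
  assumes S: "open S" "bounded S" and fS: "open (f ` S)"
    and der: "\<And>x. x \<in> S \<Longrightarrow> (f has_derivative f' x) (at x)" and inj: "inj_on f S"
    and cont: "\<And>v. continuous_on S (\<lambda>x. f' x v)"
    and bnd: "\<And>x. x \<in> S \<Longrightarrow> a \<le> \<bar>det (mat_wo (matrix (f' x)))\<bar> \<and> \<bar>det (mat_wo (matrix (f' x)))\<bar> \<le> b"
  shows "a * measure lebesgue S \<le> measure lebesgue (f ` S)" and "measure lebesgue (f ` S) \<le> b * measure lebesgue S"
proof -
  define F where "F = to_wo \<circ> f \<circ> (of_wo :: _ \<Rightarrow> real^'n)"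
  define F' where "F' y = to_wo \<circ> f' (of_wo y) \<circ> (of_wo :: _ \<Rightarrow> real^'n)" for y
  let ?S = "to_wo ` S"
  have axis: "of_wo (axis i 1) = (axis (Rep_wo i) 1 :: real^'n)" for i
    by (auto simp: of_wo_def axis_def vec_eq_iff Abs_wo_inverse Rep_wo_inverse)
  have mat: "matrix (F' y) = mat_wo (matrix (f' (of_wo y)))" for y
    by (simp add: matrix_def F'_def mat_wo_def vec_eq_iff axis to_wo_def)
  have bl: "bounded_linear (to_wo :: real^'n \<Rightarrow> _)" "bounded_linear (of_wo :: _ \<Rightarrow> real^'n)"
    using linear_to_wo linear_of_wo by (simp_all add: linear_conv_bounded_linear)
  have bS: "bounded ?S" by (rule bounded_linear_image[OF S(2) bl(1)])
  have dF: "(F has_derivative F' y) (at y)" if "y \<in> ?S" for y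
  proof -
    have "of_wo y \<in> S" using that by auto
    from has_derivative_compose[OF bounded_linear.has_derivative[OF bl(2) has_derivative_ident] der[OF this]]
    have "((\<lambda>y. f (of_wo y)) has_derivative (\<lambda>h. f' (of_wo y) (of_wo h))) (at y)" .
    from bounded_linear.has_derivative[OF bl(1) this] show ?thesis by (simp add: F_def F'_def o_def)
  qed
  have iF: "inj_on F ?S"
  proof (rule inj_onI)
    fix x y assume xy: "x \<in> ?S" "y \<in> ?S" "F x = F y"
    then have "f (of_wo x) = f (of_wo y)" unfolding F_def o_def by (metis of_to_wo)
    then have "(of_wo x :: real^'n) = of_wo y" using inj xy by (auto dest!: inj_onD)
    then show "x = y" by (metis to_of_wo)
  qed
  have cF: "continuous_on ?S (\<lambda>y. det (matrix (F' y)))"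
    unfolding mat
  proof (rule continuous_on_det_entries)
    fix i j
    have "continuous_on ?S (\<lambda>y. f' (of_wo y) (axis (Rep_wo j) 1) $ Rep_wo i)"
      by (intro continuous_intros continuous_on_compose2[OF cont[of "axis (Rep_wo j) 1"] linear_continuous_on[OF bl(2)]]) auto
    then show "continuous_on ?S (\<lambda>y. mat_wo (matrix (f' (of_wo y))) $ i $ j)"
      by (simp add: mat_wo_def matrix_def)
  qed
  have bF: "a \<le> \<bar>det (matrix (F' y))\<bar> \<and> \<bar>det (matrix (F' y))\<bar> \<le> b" if "y \<in> ?S" for y
    using bnd[of "of_wo y"] that by (auto simp: mat)
  have img: "F ` ?S = to_wo ` (f ` S)" by (auto simp: F_def image_iff)
  note * = measure_image_bounds_wo[OF open_to_wo_image(2)[OF S(1)] bS dF iF cF bF]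
  show "a * measure lebesgue S \<le> measure lebesgue (f ` S)" "measure lebesgue (f ` S) \<le> b * measure lebesgue S"
    using * unfolding img open_to_wo_image(3)[OF S(1)] open_to_wo_image(3)[OF fS] by auto
qed

text \<open>Scale to norm one. The assumption keeps all |z A| above a fixed \<eta>, so the scaled
  matrices lie in a compact set of invertible ones, where |det| has a positive minimum
  \<open>d\<close>. Homogeneity of degree n brings the bound back to \<open>A\<close>.\<close>

lemma det_lower_bound_of_distortion:
  assumes "C \<ge> 0"
  obtains K where "\<And>A :: real^'n^'n. (\<And>u z. norm u = 1 \<Longrightarrow> norm z = 1 \<Longrightarrow> norm (u v* A) \<le> C * norm (z v* A))
    \<Longrightarrow> onorm (\<lambda>x. A *v x) \<le> K * \<bar>det A\<bar> powr (1 / real CARD('n))"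
proof -
  let ?n = "real CARD('n)"
  have n: "?n > 0" by simp
  \<comment> \<open>The norm of \<open>A\<close> is at most the sum of its n row norms, each at most
    C |z A|; \<open>C + 1\<close> keeps the denominator positive when C = 0.\<close>
  define \<eta> where "\<eta> = 1 / (?n * (C + 1))"
  have \<eta>: "\<eta> > 0" using assms n by (simp add: \<eta>_def)
  define \<K> where "\<K> = {A :: real^'n^'n. norm A = 1} \<inter> (\<Inter>z\<in>{z. norm z = 1}. {A. \<eta> \<le> norm (z v* A)})"
  have cl: "closed {A :: real^'n^'n. \<eta> \<le> norm (z v* A)}" for z
  proof -
    have "continuous_on UNIV (\<lambda>A :: real^'n^'n. z v* A)"
      unfolding vector_matrix_mult_def by (intro continuous_intros)
    then show ?thesis by (intro closed_Collect_le continuous_intros)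
  qed
  have comp: "compact \<K>"
  proof -
    have "closed {A :: real^'n^'n. norm A = 1}" by (intro closed_Collect_eq continuous_intros)
    then have "closed \<K>" unfolding \<K>_def using cl by (intro closed_Int closed_INT) auto
    moreover have "bounded \<K>" by (rule boundedI[of _ 1]) (auto simp: \<K>_def)
    ultimately show ?thesis by (simp add: compact_eq_bounded_closed)
  qed
  have det0: "det A \<noteq> 0" if "A \<in> \<K>" for A
  proof
    assume "det A = 0"
    then have "\<not> invertible (transpose A)" by (simp add: invertible_det_nz det_transpose)
    then obtain z where z: "z \<noteq> 0" "transpose A *v z = 0"
      using invertible_left_inverse matrix_left_invertible_ker by metis
    define z' where "z' = (1 / norm z) *\<^sub>R z"
    have "norm z' = 1" using z by (simp add: z'_def)
    moreover have "transpose A *v z' = 0" unfolding z'_def using z by (simp add: matrix_vector_mult_scaleR del: transpose_matrix_vector)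
    ultimately show False using that \<eta> by (force simp: \<K>_def)
  qed
  have dc: "continuous_on \<K> (\<lambda>A. \<bar>det A\<bar>)"
    by (intro continuous_intros continuous_on_det_entries)
  obtain d where d: "d > 0" "\<And>A. A \<in> \<K> \<Longrightarrow> d \<le> \<bar>det A\<bar>"
  proof (cases "\<K> = {}")
    case True
    then show thesis using that[of 1] by auto
  next
    case False
    from continuous_attains_inf[OF comp False dc] obtain A where "A \<in> \<K>" "\<And>B. B \<in> \<K> \<Longrightarrow> \<bar>det A\<bar> \<le> \<bar>det B\<bar>" by blast
    then show thesis using that[of "\<bar>det A\<bar>"] det0 by auto
  qed
  define K where "K = ?n * ?n * (1 / d) powr (1 / ?n)"
  show thesis
  proof (rule that)
    fix A :: "real^'n^'n"
    assume distortion: "\<And>u z. norm u = 1 \<Longrightarrow> norm z = 1 \<Longrightarrow> norm (u v* A) \<le> C * norm (z v* A)"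
    have "onorm (\<lambda>x. A *v x) \<le> (\<Sum>i\<in>UNIV. \<Sum>j\<in>UNIV. \<bar>A $ i $ j\<bar>)" by (rule onorm_le_matrix_component_sum)
    also have "\<dots> \<le> (\<Sum>i\<in>(UNIV::'n set). \<Sum>j\<in>(UNIV::'n set). norm A)"
    proof (intro sum_mono)
      show "\<bar>A $ i $ j\<bar> \<le> norm A" for i j
        using component_le_norm_cart[of "A $ i" j] Finite_Cartesian_Product.norm_nth_le[of A i] by linarith
    qed
    finally have on: "onorm (\<lambda>x. A *v x) \<le> ?n * ?n * norm A" by simp
    have "norm A \<le> (1 / d) powr (1 / ?n) * \<bar>det A\<bar> powr (1 / ?n)"
    proof (cases "A = 0")
      case False
      define B where "B = (1 / norm A) *\<^sub>R A"
      have "B \<in> \<K>" unfolding \<K>_def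
      proof (intro IntI INT_I CollectI)
        show "norm B = 1" using False by (simp add: B_def)
        fix z :: "real^'n" assume "z \<in> {z. norm z = 1}"
        then have z: "norm z = 1" by simp
        have row: "axis i 1 v* A = A $ i" for i
          by (simp add: vector_matrix_mult_def axis_def vec_eq_iff if_distrib[of "\<lambda>x. x * _"] cong: if_cong)
        have "norm A \<le> (\<Sum>i\<in>UNIV. norm (A $ i))" unfolding norm_vec_def by (rule L2_set_le_sum) simp
        also have "\<dots> \<le> (\<Sum>i\<in>(UNIV::'n set). C * norm (z v* A))"
          using distortion[OF _ z] by (intro sum_mono) (simp add: row[symmetric])
        also have "\<dots> \<le> ?n * ((C + 1) * norm (z v* A))" by (simp add: mult_left_mono distrib_right)
        finally have "\<eta> * norm A \<le> norm (z v* A)"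
          using assms n by (simp add: \<eta>_def pos_divide_le_eq mult_ac)
        then have "\<eta> \<le> norm (z v* A) / norm A" using False by (simp add: pos_le_divide_eq)
        also have "\<dots> = norm (z v* B)"
        proof -
          have "z v* B = (1 / norm A) *\<^sub>R (z v* A)"
            by (simp add: B_def vector_matrix_mult_def vec_eq_iff sum_distrib_left mult_ac)
          then show ?thesis using False by simp
        qed
        finally show "\<eta> \<le> norm (z v* B)" .
      qed
      then have dB: "d \<le> \<bar>det B\<bar>" by (rule d)
      have "det A = norm A ^ CARD('n) * det B"
      proof -
        have "A = (\<chi> i. norm A *s (B $ i))" using False by (simp add: B_def vec_eq_iff)
        then have "det A = det (\<chi> i. norm A *s (B $ i))" by simp
        also have "\<dots> = prod (\<lambda>_. norm A) (UNIV :: 'n set) * det (\<chi> i. B $ i)" by (rule det_rows_mul)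
        finally show ?thesis by (simp add: vec_nth_inverse)
      qed
      then have "\<bar>det A\<bar> = norm A ^ CARD('n) * \<bar>det B\<bar>" by (simp add: abs_mult)
      then have "norm A ^ CARD('n) * d \<le> \<bar>det A\<bar>" using dB by (simp add: mult_left_mono)
      then have le: "norm A ^ CARD('n) \<le> (1 / d) * \<bar>det A\<bar>" using d(1) by (simp add: field_simps)
      have "norm A = (norm A ^ CARD('n)) powr (1 / ?n)"
        using False by (simp add: powr_realpow[symmetric] powr_powr)
      also have "\<dots> \<le> ((1 / d) * \<bar>det A\<bar>) powr (1 / ?n)" using le by (intro powr_mono2) auto
      also have "\<dots> = (1 / d) powr (1 / ?n) * \<bar>det A\<bar> powr (1 / ?n)" by (rule powr_mult)
      finally show ?thesis .
    qed simp
    then have "?n * ?n * norm A \<le> ?n * ?n * ((1 / d) powr (1 / ?n) * \<bar>det A\<bar> powr (1 / ?n))"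
      by (intro mult_left_mono) auto
    from order_trans[OF on this] show "onorm (\<lambda>x. A *v x) \<le> K * \<bar>det A\<bar> powr (1 / ?n)"
      by (simp only: K_def mult.assoc)
  qed
qed

section \<open>Distortion from spectral bounds\<close>

lemma open_image_of_inverse:
  assumes "inj_on \<gamma> V" "open (\<gamma> ` V)" "continuous_on (\<gamma> ` V) (inv_into V \<gamma>)" "open T" "T \<subseteq> V"
  shows "open (\<gamma> ` T)"
proof -
  have "\<gamma> ` T = inv_into V \<gamma> -` T \<inter> \<gamma> ` V"
    using assms(1,5) by (auto simp: inv_into_f_f subset_iff)
  moreover have "open (inv_into V \<gamma> -` T \<inter> \<gamma> ` V)"
    using continuous_on_open_vimage[OF assms(2)] assms(3,4) by blast
  ultimately show ?thesis by simp
qed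

lemma continuous_on_C1_derivative:
  fixes f' :: "'a::euclidean_space \<Rightarrow> 'b::euclidean_space \<Rightarrow>\<^sub>L 'c::euclidean_space"
  assumes "continuous_on S f'"
  shows "continuous_on S (\<lambda>x. blinfun_apply (f' x) v)"
  using assms by (intro continuous_intros)

text \<open>If the Jacobian vanished near \<open>x\<close>, the image of a neighbourhood would have
  measure zero by the volume estimate, but local invertibility makes this image open and
  nonempty.\<close>

lemma regular_points_dense:
  fixes \<gamma> :: "real^'n \<Rightarrow> real^'n"
  assumes inv: "locally_invertible U \<gamma>"
    and der: "\<And>x. x \<in> U \<Longrightarrow> (\<gamma> has_derivative blinfun_apply (\<gamma>' x)) (at x)" and cont: "continuous_on U \<gamma>'"
    and x: "x \<in> U" and N: "open N" "x \<in> N"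
  shows "\<exists>y\<in>N \<inter> U. det (matrix (\<gamma>' y)) \<noteq> 0"
proof (rule ccontr)
  assume "\<not> ?thesis"
  then have z: "\<And>y. y \<in> N \<Longrightarrow> y \<in> U \<Longrightarrow> det (matrix (\<gamma>' y)) = 0" by blast
  obtain V where V: "open V" "x \<in> V" "V \<subseteq> U" "open (\<gamma> ` V)" "inj_on \<gamma> V" "continuous_on (\<gamma> ` V) (inv_into V \<gamma>)"
    using inv x unfolding locally_invertible_def by blast
  define T0 where "T0 = V \<inter> N \<inter> ball x 1"
  \<comment> \<open>Cutting down so that the image is bounded makes its measure finite and hence
    comparable with that of a ball inside it.\<close>
  define T where "T = \<gamma> -` ball (\<gamma> x) 1 \<inter> T0"
  have T0: "open T0" "T0 \<subseteq> U" using V N by (auto simp: T0_def)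
  have "continuous_on T0 \<gamma>"
    using der T0(2) by (intro continuous_at_imp_continuous_on ballI has_derivative_continuous) auto
  then have "open T" unfolding T_def using continuous_on_open_vimage[OF T0(1)] open_ball by blast
  then have T: "open T" "bounded T" "x \<in> T" "T \<subseteq> V" "T \<subseteq> N"
    using V N by (auto simp: T_def T0_def intro: bounded_subset[OF bounded_ball[of x 1]])
  have op: "open (\<gamma> ` T)" by (rule open_image_of_inverse[OF V(5,4,6) T(1,4)])
  have "measure lebesgue (\<gamma> ` T) \<le> 0 * measure lebesgue T"
  proof (rule measure_image_bounds(2)[OF T(1,2) op, where a=0])
    show "(\<gamma> has_derivative blinfun_apply (\<gamma>' y)) (at y)" if "y \<in> T" for y using that T(4) V(3) der by blast
    show "inj_on \<gamma> T" using V(5) T(4) inj_on_subset by blast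
    show "continuous_on T (\<lambda>x. blinfun_apply (\<gamma>' x) v)" for v
      using continuous_on_subset[OF cont] T(4) V(3) by (intro continuous_on_C1_derivative) auto
    show "0 \<le> \<bar>det (mat_wo (matrix (\<gamma>' y)))\<bar> \<and> \<bar>det (mat_wo (matrix (\<gamma>' y)))\<bar> \<le> 0" if "y \<in> T" for y
      using z[of y] that T(4,5) V(3) det_mat_wo_eq_0[of "matrix (\<gamma>' y)"] by auto
  qed
  then have m: "measure lebesgue (\<gamma> ` T) \<le> 0" by simp
  have xT: "\<gamma> x \<in> \<gamma> ` T" using T(3) by simp
  obtain r where r: "r > 0" "ball (\<gamma> x) r \<subseteq> \<gamma> ` T" using openE[OF op xT] .
  have "\<gamma> ` T \<subseteq> ball (\<gamma> x) 1" by (auto simp: T_def)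
  then have "\<gamma> ` T \<in> lmeasurable"
    using bounded_subset[OF bounded_ball] op by (intro bounded_set_imp_lmeasurable) auto
  then have "measure lebesgue (ball (\<gamma> x) r) \<le> measure lebesgue (\<gamma> ` T)"
    using r(2) by (intro measure_mono_fmeasurable) auto
  then show False using m ball_measure_pos[OF r(1), of "\<gamma> x"] by linarith
qed

lemma has_derivative_inner_map:
  fixes \<gamma> :: "real^'n \<Rightarrow> real^'n"
  assumes "(\<gamma> has_derivative L) (at x)"
  shows "((\<lambda>x. w \<bullet> \<gamma> x) has_derivative (\<lambda>h. w \<bullet> L h)) (at x)"
  using has_derivative_inner_right[OF assms] .

lemma vector_matrix_derivative:
  fixes L :: "real^'n \<Rightarrow> real^'n"
  shows "w v* matrix L = (\<chi> i. w \<bullet> L (axis i 1))"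
  by (simp add: vec_eq_iff vector_matrix_mult_def matrix_def inner_vec_def mult.commute)

lemma grad_inner_map:
  fixes \<gamma> :: "real^'n \<Rightarrow> real^'n"
  assumes "(\<gamma> has_derivative L) (at x)"
  shows "grad (\<lambda>x. w \<bullet> \<gamma> x) x = w v* matrix L"
  unfolding grad_def vector_matrix_derivative
  unfolding frechet_derivative_at[OF has_derivative_inner_map[OF assms, of w], symmetric] by (rule refl)

text \<open>\<open>t\<close> stands for a value of \<open>mu1\<close>, which may be infinite when
  there is no nonzero spectrum.\<close>

lemma ereal_le_mult_cancel:
  fixes t :: ereal
  assumes "ereal m \<le> ereal k * t" "0 < m" "0 < k"
  shows "ereal (m / k) \<le> t"
  using assms by (cases t) (auto simp: field_simps)

text \<open>The image of \<open>A\<close> is a small ball of radius \<open>l\<close>, whose spectral gap is of order \<open>1 / l\<^sup>2\<close>. Comparing with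
  the test function \<open>z \<bullet> \<gamma>\<close> for the weight of \<open>u \<bullet> \<gamma>\<close> on \<open>A\<close>, all volumes cancel up to dimensional factors.\<close>

lemma distortion_at_regular_point:
  fixes \<gamma> :: "real^'n \<Rightarrow> real^'n"
  assumes U: "open U" and inv: "locally_invertible U \<gamma>"
    and der: "\<And>x. x \<in> U \<Longrightarrow> (\<gamma> has_derivative blinfun_apply (\<gamma>' x)) (at x)" and cont: "continuous_on U \<gamma>'"
    and K: "0 < K"
    and hyp: "\<And>A a. rel_compact_subdomain A U \<Longrightarrow> C1_on (\<gamma> ` U) a \<Longrightarrow> nowhere_constant (\<gamma> ` U) a \<Longrightarrow>
        mu1 (\<gamma> ` A) a \<le> ereal (K\<^sup>2) * mu1 A (a \<circ> \<gamma>)"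
    and x0: "x0 \<in> U" "det (matrix (\<gamma>' x0)) \<noteq> 0" and u: "norm u = 1" and z: "norm z = 1"
  shows "(norm (u v* matrix (\<gamma>' x0)))\<^sup>2 \<le> (256 * 4 ^ CARD('n) * 2 ^ (CARD('n) + 1) * K\<^sup>2) * (norm (z v* matrix (\<gamma>' x0)))\<^sup>2"
proof -
  define g where "g w x = w v* matrix (\<gamma>' x)" for w x
  have gc: "continuous_on U (g w)" for w
    unfolding g_def vector_matrix_derivative by (intro continuous_intros cont)
  have g_nz: "g w x0 \<noteq> 0" if "norm w = 1" for w
  proof
    assume "g w x0 = 0"
    then have "transpose (matrix (\<gamma>' x0)) *v w = 0" by (simp add: g_def)
    moreover have "invertible (transpose (matrix (\<gamma>' x0)))" using x0(2) by (simp add: invertible_det_nz det_transpose)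
    ultimately have "w = 0" using invertible_left_inverse matrix_left_invertible_ker by metis
    then show False using that by simp
  qed
  define \<alpha> where "\<alpha> = (norm (g u x0))\<^sup>2"
  define \<beta> where "\<beta> = (norm (g z x0))\<^sup>2"
  \<comment> \<open>The reindexed Jacobian is used because the volume estimates are stated for it;
    what matters is that it is positive at the regular point and nearly constant close by, after
    which it cancels.\<close>
  define J where "J x = \<bar>det (mat_wo (matrix (\<gamma>' x)))\<bar>" for x
  define \<kappa> where "\<kappa> = J x0"
  have pos: "\<alpha> > 0" "\<beta> > 0" "\<kappa> > 0"
    using g_nz u z x0(2) det_mat_wo_eq_0 by (auto simp: \<alpha>_def \<beta>_def \<kappa>_def J_def)
  have Jc: "continuous_on U J" unfolding J_def
    by (intro continuous_intros continuous_on_det_entries) (simp add: mat_wo_def matrix_def, intro continuous_intros cont)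
  obtain V where V: "open V" "x0 \<in> V" "V \<subseteq> U" "open (\<gamma> ` V)" "inj_on \<gamma> V" "continuous_on (\<gamma> ` V) (inv_into V \<gamma>)"
    using inv x0(1) unfolding locally_invertible_def by blast
  have ev: "\<forall>\<^sub>F x in nhds x0. \<alpha> / 2 < (norm (g u x))\<^sup>2 \<and> (norm (g u x))\<^sup>2 < 2 * \<alpha> \<and> (norm (g z x))\<^sup>2 < 2 * \<beta> \<and> \<kappa> / 2 < J x \<and> J x < 2 * \<kappa> \<and> x \<in> V"
  proof -
    have t: "(h \<longlongrightarrow> h x0) (nhds x0)" if "continuous_on U h" for h :: "real^'n \<Rightarrow> real"
      using that x0(1) U by (simp add: continuous_on_eq_continuous_at isCont_def tendsto_at_iff_tendsto_nhds)
    have tu: "((\<lambda>x. (norm (g u x))\<^sup>2) \<longlongrightarrow> \<alpha>) (nhds x0)" and tz: "((\<lambda>x. (norm (g z x))\<^sup>2) \<longlongrightarrow> \<beta>) (nhds x0)" and tJ: "(J \<longlongrightarrow> \<kappa>) (nhds x0)"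
      unfolding \<alpha>_def \<beta>_def \<kappa>_def by (intro t continuous_intros gc Jc)+
    have lt: "\<alpha> / 2 < \<alpha>" "\<alpha> < 2 * \<alpha>" "\<beta> < 2 * \<beta>" "\<kappa> / 2 < \<kappa>" "\<kappa> < 2 * \<kappa>" using pos by auto
    have "\<forall>\<^sub>F x in nhds x0. \<alpha> / 2 < (norm (g u x))\<^sup>2" "\<forall>\<^sub>F x in nhds x0. (norm (g u x))\<^sup>2 < 2 * \<alpha>"
      "\<forall>\<^sub>F x in nhds x0. (norm (g z x))\<^sup>2 < 2 * \<beta>" "\<forall>\<^sub>F x in nhds x0. \<kappa> / 2 < J x" "\<forall>\<^sub>F x in nhds x0. J x < 2 * \<kappa>"
      by (rule order_tendstoD[OF tu] order_tendstoD[OF tz] order_tendstoD[OF tJ]; rule lt)+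
    moreover have "\<forall>\<^sub>F x in nhds x0. x \<in> V" using V(1,2) by (rule eventually_nhds_in_open)
    ultimately show ?thesis by eventually_elim blast
  qed
  then obtain \<rho>0 where \<rho>0: "\<rho>0 > 0" "\<And>x. dist x x0 < \<rho>0 \<Longrightarrow> \<alpha> / 2 < (norm (g u x))\<^sup>2 \<and> (norm (g u x))\<^sup>2 < 2 * \<alpha> \<and>
      (norm (g z x))\<^sup>2 < 2 * \<beta> \<and> \<kappa> / 2 < J x \<and> J x < 2 * \<kappa> \<and> x \<in> V"
    unfolding eventually_nhds_metric by blast
  \<comment> \<open>Half the radius, so that the estimates hold on the closed ball and the closure
    of \<open>A\<close> stays inside \<open>U\<close>.\<close>
  define \<rho> where "\<rho> = \<rho>0 / 2"
  have \<rho>: "\<rho> > 0" using \<rho>0 by (simp add: \<rho>_def)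
  define V1 where "V1 = ball x0 \<rho>"
  have near: "\<alpha> / 2 \<le> (norm (g u x))\<^sup>2 \<and> (norm (g u x))\<^sup>2 \<le> 2 * \<alpha> \<and>
      (norm (g z x))\<^sup>2 \<le> 2 * \<beta> \<and> \<kappa> / 2 \<le> J x \<and> J x \<le> 2 * \<kappa> \<and> x \<in> V" if "x \<in> cball x0 \<rho>" for x
    using \<rho>0(2)[of x] that \<rho> by (simp add: \<rho>_def dist_commute less_imp_le)
  have cV: "cball x0 \<rho> \<subseteq> V" using near by blast
  then have V1V: "V1 \<subseteq> V" "open V1" using ball_subset_cball by (auto simp: V1_def)
  have opV1: "open (\<gamma> ` V1)" by (rule open_image_of_inverse[OF V(5,4,6) V1V(2,1)])
  define y0 where "y0 = \<gamma> x0"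
  have y0V: "y0 \<in> \<gamma> ` V1" using \<rho> by (auto simp: y0_def V1_def)
  obtain l where l: "l > 0" "ball y0 l \<subseteq> \<gamma> ` V1" using openE[OF opV1 y0V] .
  \<comment> \<open>The local inverse applied to sets; inside the ball of radius \<open>l\<close> it
    gives open preimages contained in \<open>V1\<close>.\<close>
  define P where "P S = inv_into V \<gamma> ` S" for S
  have P: "P S \<subseteq> V1" "\<gamma> ` P S = S" if "S \<subseteq> ball y0 l" for S
  proof -
    have S: "S \<subseteq> \<gamma> ` V1" using that l by blast
    show "P S \<subseteq> V1"
    proof
      fix x assume "x \<in> P S"
      then obtain y where "y \<in> S" "x = inv_into V \<gamma> y" by (auto simp: P_def)
      moreover obtain x' where "x' \<in> V1" "y = \<gamma> x'" using S \<open>y \<in> S\<close> by blast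
      ultimately show "x \<in> V1" using V1V(1) V(5) by (auto simp: inv_into_f_f subset_iff)
    qed
    show "\<gamma> ` P S = S"
    proof -
      have "\<gamma> (inv_into V \<gamma> y) = y" if "y \<in> S" for y
        using S that V1V(1) by (intro f_inv_into_f) blast
      then show ?thesis by (force simp: P_def image_iff)
    qed
  qed
  have Popen: "open (P S)" if S: "S \<subseteq> ball y0 l" "open S" for S
  proof -
    have eq: "P S = \<gamma> -` S \<inter> V1"
    proof
      show "P S \<subseteq> \<gamma> -` S \<inter> V1" using P[OF S(1)] by blast
      show "\<gamma> -` S \<inter> V1 \<subseteq> P S"
      proof
        fix x assume x: "x \<in> \<gamma> -` S \<inter> V1"
        then have "inv_into V \<gamma> (\<gamma> x) = x" using V1V(1) V(5) by (intro inv_into_f_f) auto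
        then show "x \<in> P S" using x unfolding P_def by (metis IntE imageI vimageD)
      qed
    qed
    have "continuous_on V1 \<gamma>"
      using der V1V(1) V(3) by (intro continuous_at_imp_continuous_on ballI has_derivative_continuous) auto
    then show ?thesis unfolding eq using continuous_on_open_vimage[OF V1V(2)] S(2) by blast
  qed
  define Q where "Q = ball y0 l"
  define A where "A = P Q"
  have A: "A \<subseteq> V1" "\<gamma> ` A = Q" "open A" unfolding A_def by (intro P Popen; simp add: Q_def)+
  have AU: "A \<subseteq> U" using A(1) V1V(1) V(3) by blast
  have Ac: "connected A"
  proof -
    have "Q \<subseteq> \<gamma> ` V" using l(2) V1V(1) by (auto simp: Q_def)
    then show ?thesis unfolding A_def P_def
      using continuous_on_subset[OF V(6)] by (intro connected_continuous_image) (auto simp: Q_def)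
  qed
  have Ab: "bounded A" using A(1) bounded_subset[OF bounded_ball] by (auto simp: V1_def)
  have "closure A \<subseteq> cball x0 \<rho>" using A(1) ball_subset_cball by (intro closure_minimal) (auto simp: V1_def)
  then have rel: "rel_compact_subdomain A U"
    using A(3) Ac Ab cV V(3) unfolding rel_compact_subdomain_def domain_def by auto
  \<comment> \<open>Its gradient is the unit vector \<open>u\<close>, so \<open>Gamma\<close> is
    Lebesgue measure on the image side, while on \<open>A\<close> the weight becomes the squared
    norm of \<open>g u\<close>.\<close>
  define a where "a y = u \<bullet> y" for y
  have ad: "(a has_derivative (\<lambda>h. u \<bullet> h)) (at y)" for y
    unfolding a_def by (rule has_derivative_inner_right) simp
  have ga: "grad a y = u" for y
    unfolding grad_def using frechet_derivative_at[OF ad[of y], symmetric]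
    by (simp add: vec_eq_iff inner_axis)
  have aC1: "C1_on (\<gamma> ` U) a"
    unfolding C1_on_def
  proof (intro exI conjI ballI)
    show "(a has_derivative blinfun_apply (blinfun_inner_right u)) (at y)" for y using ad by simp
  qed (intro continuous_intros)
  have aN: "nowhere_constant (\<gamma> ` U) a"
  proof -
    have opU: "open (\<gamma> ` U)"
      unfolding open_subopen[of "\<gamma> ` U"]
    proof
      fix y assume "y \<in> \<gamma> ` U"
      then obtain x where x: "x \<in> U" "y = \<gamma> x" by blast
      then obtain W where "open (\<gamma> ` W)" "x \<in> W" "W \<subseteq> U" using inv unfolding locally_invertible_def by blast
      then show "\<exists>T. open T \<and> y \<in> T \<and> T \<subseteq> \<gamma> ` U" using x by blast
    qed
    have G: "Gamma (\<gamma> ` U) a = lebesgue_on (\<gamma> ` U)" by (rule Gamma_eq_lebesgue_on) (simp add: ga u)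
    have "emeasure (Gamma (\<gamma> ` U) a) (ball y e \<inter> \<gamma> ` U) > 0" if y: "y \<in> \<gamma> ` U" and e: "e > 0" for y e
    proof -
      have o: "open (ball y e \<inter> \<gamma> ` U)" using opU by auto
      have yo: "y \<in> ball y e \<inter> \<gamma> ` U" using y e by simp
      obtain r where r: "r > 0" "ball y r \<subseteq> ball y e \<inter> \<gamma> ` U" using openE[OF o yo] .
      have "0 < emeasure lebesgue (ball y r)" using ball_measure_pos[OF r(1), of y]
        by (simp add: measure_def enn2real_positive_iff)
      also have "\<dots> \<le> emeasure lebesgue (ball y e \<inter> \<gamma> ` U)" using r(2) o by (intro emeasure_mono open_sets_lebesgue)
      also have "\<dots> = emeasure (Gamma (\<gamma> ` U) a) (ball y e \<inter> \<gamma> ` U)"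
        unfolding G using opU o by (subst emeasure_restrict_space) (auto simp: open_sets_lebesgue)
      finally show ?thesis .
    qed
    then show ?thesis unfolding nowhere_constant_def by blast
  qed
  \<comment> \<open>The lower bound for \<open>mu1\<close> on the ball of radius \<open>l\<close>,
    divided by the distortion constant of the hypothesis.\<close>
  define R where "R = 1 / (2 ^ (CARD('n) + 1) * l\<^sup>2) / K\<^sup>2"
  have R: "R > 0" using l K by (simp add: R_def)
  have "ereal (1 / (2 ^ (CARD('n) + 1) * l\<^sup>2)) \<le> mu1 (\<gamma> ` A) a"
    unfolding A(2) Q_def by (rule mu1_ball_ge[OF l(1)]) (simp add: ga u)
  also have "\<dots> \<le> ereal (K\<^sup>2) * mu1 A (a \<circ> \<gamma>)" by (rule hyp[OF rel aC1 aN])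
  finally have RA0: "ereal (1 / (2 ^ (CARD('n) + 1) * l\<^sup>2)) \<le> ereal (K\<^sup>2) * mu1 A (a \<circ> \<gamma>)" .
  have RA: "ereal R \<le> mu1 A (a \<circ> \<gamma>)"
    unfolding R_def by (rule ereal_le_mult_cancel[OF RA0]) (use l K in simp_all)
  define b where "b = a \<circ> \<gamma>"
  have bx: "b = (\<lambda>x. u \<bullet> \<gamma> x)" by (simp add: b_def a_def fun_eq_iff)
  have gb: "grad b x = g u x" if "x \<in> A" for x
    unfolding bx g_def using that AU by (intro grad_inner_map der) auto
  have nearA: "x \<in> A \<Longrightarrow> \<alpha> / 2 \<le> (norm (g u x))\<^sup>2 \<and> (norm (g u x))\<^sup>2 \<le> 2 * \<alpha> \<and>
      (norm (g z x))\<^sup>2 \<le> 2 * \<beta> \<and> \<kappa> / 2 \<le> J x \<and> J x \<le> 2 * \<kappa>" for x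
    using near[of x] A(1) ball_subset_cball[of x0 \<rho>] by (auto simp: V1_def)
  have gbc: "continuous_on A (grad b)"
    using continuous_on_subset[OF gc AU] gb by (subst continuous_on_cong[OF refl gb]) auto
  define f where "f x = z \<bullet> \<gamma> x" for x
  have fd: "(f has_derivative (\<lambda>h. z \<bullet> \<gamma>' x h)) (at x)" if "x \<in> A" for x
    unfolding f_def using that AU by (intro has_derivative_inner_map der) auto
  have fw: "weak_grad A f (g z)"
  proof -
    have "weak_grad A f (\<lambda>x. \<chi> i. z \<bullet> \<gamma>' x (axis i 1))"
      using continuous_on_subset[OF cont AU] by (intro weak_grad_C1 A(3) fd continuous_intros)
    then show ?thesis by (simp add: g_def[abs_def] vector_matrix_derivative)
  qed
  note fin = finite_measure_lebesgue_on_open[OF A(3) Ab]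
  have sq_bounded: "sq_int (lebesgue_on A) h" if h: "continuous_on A h" "\<And>x. x \<in> A \<Longrightarrow> (h x)\<^sup>2 \<le> B" for h :: "real^'n \<Rightarrow> real" and B
  proof -
    have m: "h \<in> borel_measurable (lebesgue_on A)"
      by (rule continuous_imp_measurable_on_sets_lebesgue[OF h(1) open_sets_lebesgue[OF A(3)]])
    have "integrable (lebesgue_on A) (\<lambda>x. (h x)\<^sup>2)"
      by (rule finite_measure.integrable_const_bound[OF fin, where B=B]) (use h(2) m in \<open>auto intro: AE_I2\<close>)
    then show ?thesis using m by (simp add: sq_int_def)
  qed
  have sf: "sobolev A f (g z)"
    unfolding sobolev_def
  proof (intro conjI allI fw)
    have fc: "continuous_on A f" by (intro continuous_at_imp_continuous_on ballI has_derivative_continuous[OF fd])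
    show "sq_int (lebesgue_on A) f"
    proof (rule sq_bounded[OF fc])
      fix x assume "x \<in> A"
      then have "\<gamma> x \<in> ball y0 l" using A(2) by (auto simp: Q_def)
      then have "norm (\<gamma> x) \<le> norm y0 + l" using norm_triangle_sub[of "\<gamma> x" y0] by (simp add: dist_norm norm_minus_commute)
      moreover have "\<bar>f x\<bar> \<le> norm (\<gamma> x)" using Cauchy_Schwarz_ineq2[of z "\<gamma> x"] z by (simp add: f_def)
      ultimately have "\<bar>f x\<bar> \<le> norm y0 + l" by simp
      then show "(f x)\<^sup>2 \<le> (norm y0 + l)\<^sup>2" by (metis abs_ge_zero power2_abs power_mono)
    qed
    show "sq_int (lebesgue_on A) (\<lambda>x. g z x $ i)" for i
    proof (rule sq_bounded[where B="2 * \<beta>"])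
      show "continuous_on A (\<lambda>x. g z x $ i)" using continuous_on_subset[OF gc AU] by (intro continuous_intros)
      fix x assume "x \<in> A"
      then have "(norm (g z x))\<^sup>2 \<le> 2 * \<beta>" using nearA by blast
      moreover have "(g z x $ i)\<^sup>2 \<le> (norm (g z x))\<^sup>2"
        using component_le_norm_cart[of "g z x" i] by (metis abs_ge_zero power2_abs power_mono)
      ultimately show "(g z x $ i)\<^sup>2 \<le> 2 * \<beta>" by simp
    qed
  qed
  have w: "\<forall>x\<in>A. \<alpha> / 2 \<le> (norm (grad b x))\<^sup>2 \<and> (norm (grad b x))\<^sup>2 \<le> 2 * \<alpha>"
    using nearA gb by simp
  have "\<exists>c. R * (\<alpha> / 2) * (\<integral>x. (f x - c)\<^sup>2 \<partial>lebesgue_on A) \<le> Dform A f f"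
    by (rule poincare_of_resolvent[OF A(3) Ab Ac gbc w _ resolvent_of_mu1_ge[OF RA[folded b_def]] R sobolev_imp_H12[OF sf]])
      (use pos in auto)
  then obtain c where c: "R * (\<alpha> / 2) * (\<integral>x. (f x - c)\<^sup>2 \<partial>lebesgue_on A) \<le> Dform A f f" by blast
  define mA where "mA = measure lebesgue A"
  define q where "q = measure lebesgue Q"
  have q: "q > 0" unfolding q_def Q_def by (rule ball_measure_pos[OF l(1)])
  have vol: "\<kappa> / 2 * measure lebesgue (P S) \<le> measure lebesgue S" "measure lebesgue S \<le> 2 * \<kappa> * measure lebesgue (P S)"
    if S: "S \<subseteq> Q" "open S" for S
  proof -
    have S': "S \<subseteq> ball y0 l" using S by (simp add: Q_def)
    have PS: "P S \<subseteq> V1" "P S \<subseteq> U" using P(1)[OF S'] V1V(1) V(3) by blast+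
    have nearP: "\<kappa> / 2 \<le> J x \<and> J x \<le> 2 * \<kappa>" if "x \<in> P S" for x
      using near[of x] that PS(1) ball_subset_cball[of x0 \<rho>] by (auto simp: V1_def)
    have bP: "bounded (P S)" using PS(1) bounded_subset[OF bounded_ball] by (auto simp: V1_def)
    have iP: "inj_on \<gamma> (P S)" using PS(1) V1V(1) V(5) inj_on_subset by blast
    have oP: "open (\<gamma> ` P S)" unfolding P(2)[OF S'] by (rule S(2))
    have dP: "(\<gamma> has_derivative blinfun_apply (\<gamma>' x)) (at x)" if "x \<in> P S" for x using PS(2) that der by blast
    have cP: "continuous_on (P S) (\<lambda>x. \<gamma>' x v)" for v
      by (intro continuous_on_C1_derivative continuous_on_subset[OF cont PS(2)])
    show "\<kappa> / 2 * measure lebesgue (P S) \<le> measure lebesgue S" "measure lebesgue S \<le> 2 * \<kappa> * measure lebesgue (P S)"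
      using measure_image_bounds[OF Popen[OF S' S(2)] bP oP dP iP cP nearP[unfolded J_def]]
      unfolding P(2)[OF S'] by blast+
  qed
  have mA: "\<kappa> / 2 * mA \<le> q" unfolding mA_def q_def A_def using vol(1)[of Q] by (simp add: Q_def)
  have D_upper: "Dform A f f \<le> 2 * \<beta> * mA"
  proof -
    have "Dform A f f = (\<integral>x. (norm (g z x))\<^sup>2 \<partial>lebesgue_on A)"
      using Dform_eq[OF A(3) sf sf] by (simp add: power2_norm_eq_inner)
    also have "\<dots> \<le> (\<integral>x. 2 * \<beta> \<partial>lebesgue_on A)"
    proof (rule integral_mono_AE)
      show "integrable (lebesgue_on A) (\<lambda>x. (norm (g z x))\<^sup>2)"
        unfolding power2_norm_eq_inner using sf by (intro sq_int_vec_inner) (auto simp: sobolev_def)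
      show "integrable (lebesgue_on A) (\<lambda>x. 2 * \<beta>)" by (rule finite_measure.integrable_const[OF fin])
    qed (use nearA in \<open>auto intro: AE_I2\<close>)
    also have "\<dots> = 2 * \<beta> * mA"
      using measure_lebesgue_on_space[OF open_sets_lebesgue[OF A(3)]] by (simp add: mA_def)
    finally show ?thesis .
  qed
  \<comment> \<open>Moving the centre by l / 2 along \<plusminus>z, away from the level
    \<open>c\<close>, keeps z \<bullet> y at distance at least l / 4 from \<open>c\<close> on the
    ball of radius l / 4 around \<open>y1\<close>. So \<open>f\<close> misses \<open>c\<close>
    there, whatever constant Poincare produced.\<close>
  define y1 where "y1 = (if c \<le> z \<bullet> y0 then y0 + (l / 2) *\<^sub>R z else y0 - (l / 2) *\<^sub>R z)"
  define S where "S = ball y1 (l / 4)"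
  have y1: "dist y0 y1 = l / 2" using l z by (auto simp: y1_def dist_norm)
  have SQ: "S \<subseteq> Q"
  proof
    fix y assume "y \<in> S"
    then show "y \<in> Q" using dist_triangle[of y0 y y1] y1 l by (simp add: S_def Q_def)
  qed
  have far: "(l / 4)\<^sup>2 \<le> (f x - c)\<^sup>2" if x: "x \<in> P S" for x
  proof -
    have "\<gamma> x \<in> S" using x P(2)[of S] SQ by (auto simp: Q_def)
    then have "norm (\<gamma> x - y1) < l / 4" by (simp add: S_def dist_norm norm_minus_commute)
    then have 1: "\<bar>z \<bullet> (\<gamma> x - y1)\<bar> \<le> l / 4" using Cauchy_Schwarz_ineq2[of z "\<gamma> x - y1"] z by simp
    have zz: "z \<bullet> z = 1" using z by (simp add: dot_square_norm)
    have fx: "f x = z \<bullet> (\<gamma> x - y1) + z \<bullet> y1" by (simp add: f_def inner_diff_right)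
    have "l / 4 \<le> \<bar>f x - c\<bar>"
    proof (cases "c \<le> z \<bullet> y0")
      case True
      then have "z \<bullet> y1 = z \<bullet> y0 + l / 2" by (simp add: y1_def inner_add_right zz)
      then show ?thesis using 1 fx True l by linarith
    next
      case False
      then have "z \<bullet> y1 = z \<bullet> y0 - l / 2" by (simp add: y1_def inner_diff_right zz)
      then show ?thesis using 1 fx False l by linarith
    qed
    then have "(l / 4)\<^sup>2 \<le> \<bar>f x - c\<bar>\<^sup>2" using l by (intro power_mono) auto
    then show ?thesis by simp
  qed
  have PSA: "P S \<subseteq> A" unfolding A_def P_def using SQ by blast
  have PSo: "open (P S)" using Popen[of S] SQ by (simp add: Q_def S_def)
  define mP where "mP = measure lebesgue (P S)"
  have lower: "(l / 4)\<^sup>2 * mP \<le> (\<integral>x. (f x - c)\<^sup>2 \<partial>lebesgue_on A)"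
  proof -
    have bP: "bounded (P S)" using PSA Ab bounded_subset by blast
    have "(l / 4)\<^sup>2 * mP = (\<integral>x. (l / 4)\<^sup>2 \<partial>lebesgue_on (P S))"
      using measure_lebesgue_on_space[OF open_sets_lebesgue[OF PSo]] by (simp add: mP_def)
    also have "\<dots> \<le> (\<integral>x. (f x - c)\<^sup>2 \<partial>lebesgue_on A)"
    proof (rule integral_mono_lebesgue_on_AE)
      have "sq_int (lebesgue_on A) (\<lambda>x. f x - c)" using sf by (intro sq_int_diff sq_int_const fin) (simp add: sobolev_def)
      then show "integrable (lebesgue_on A) (\<lambda>x. (f x - c)\<^sup>2)" by (simp add: sq_int_def)
    qed (use far PSA open_sets_lebesgue[OF PSo] open_sets_lebesgue[OF A(3)] in \<open>auto intro: AE_I2\<close>)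
    finally show ?thesis .
  qed
  have mS: "measure lebesgue S = q / 4 ^ CARD('n)"
    using l by (simp add: S_def q_def Q_def content_ball power_divide)
  have mP: "q / 4 ^ CARD('n) \<le> 2 * \<kappa> * mP" using vol(2)[OF SQ] mS by (simp add: mP_def S_def)
  have "R * (\<alpha> / 2) * ((l / 4)\<^sup>2 * mP) \<le> 2 * \<beta> * mA"
    by (rule order_trans[OF mult_left_mono[OF lower] order_trans[OF c D_upper]]) (use R pos in simp)
  \<comment> \<open>Multiplying by 2 \<kappa> turns volumes in \<open>A\<close> into volumes in the
    image: 2 \<kappa> mP \<ge> q / 4^n and 2 \<kappa> mA \<le> 4 q, so that \<open>q\<close>
    cancels.\<close>
  then have "R * (\<alpha> / 2) * (l / 4)\<^sup>2 * (2 * \<kappa> * mP) \<le> 2 * \<beta> * (2 * \<kappa> * mA)"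
    using mult_left_mono[of "R * (\<alpha> / 2) * ((l / 4)\<^sup>2 * mP)" "2 * \<beta> * mA" "2 * \<kappa>"] pos by (simp add: mult_ac)
  moreover have "R * (\<alpha> / 2) * (l / 4)\<^sup>2 * (q / 4 ^ CARD('n)) \<le> R * (\<alpha> / 2) * (l / 4)\<^sup>2 * (2 * \<kappa> * mP)"
    using mP R pos by (intro mult_left_mono) auto
  moreover have "2 * \<beta> * (2 * \<kappa> * mA) \<le> 2 * \<beta> * (4 * q)" using mA pos by (intro mult_left_mono) auto
  ultimately have "R * (\<alpha> / 2) * (l / 4)\<^sup>2 * (q / 4 ^ CARD('n)) \<le> 2 * \<beta> * (4 * q)" by linarith
  then have "(R * (\<alpha> / 2) * (l / 4)\<^sup>2 / 4 ^ CARD('n)) * q \<le> (8 * \<beta>) * q" by (simp add: mult_ac)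
  then have main: "R * (\<alpha> / 2) * (l / 4)\<^sup>2 / 4 ^ CARD('n) \<le> 8 * \<beta>" using q by (rule mult_right_le_imp_le)
  define N :: real where "N = 4 ^ CARD('n)"
  define N2 :: real where "N2 = 2 ^ (CARD('n) + 1)"
  have N: "N > 0" "N2 > 0" by (simp_all add: N_def N2_def)
  \<comment> \<open>The powers of \<open>l\<close> cancel; 32 = 2 * 16 comes from \<alpha> / 2 and
    (l / 4)^2, and with the factor 8 on the right this gives 256.\<close>
  have "R * (\<alpha> / 2) * (l / 4)\<^sup>2 / N = \<alpha> / (32 * N * N2 * K\<^sup>2)"
    unfolding R_def N2_def[symmetric] using l K N by (simp add: field_simps power2_eq_square)
  then have "\<alpha> \<le> 8 * \<beta> * (32 * N * N2 * K\<^sup>2)"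
    using main N K unfolding N_def[symmetric] by (simp add: pos_divide_le_eq)
  then have "\<alpha> \<le> (256 * N * N2 * K\<^sup>2) * \<beta>" by (simp add: mult_ac)
  then show ?thesis by (simp add: \<alpha>_def \<beta>_def g_def N_def N2_def)
qed

text \<open>The comparison of |u \<gamma>'| and |z \<gamma>'| extends from regular points to all of
  \<open>U\<close>, because both sides are continuous and regular points are dense. The matrix lemma
  then converts it into the pointwise distortion inequality, with a constant independent of the
  point.\<close>

lemma bounded_distortion_of_spectral_bound:
  fixes U :: "(real^'n) set" and \<gamma> :: "real^'n \<Rightarrow> real^'n"
  assumes U: "domain U" and C1: "C1_on U \<gamma>" and inv: "locally_invertible U \<gamma>"
    and sign: "(\<forall>x\<in>U. jac \<gamma> x \<ge> 0) \<or> (\<forall>x\<in>U. jac \<gamma> x \<le> 0)"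
    and K: "0 < K"
    and hyp: "\<And>A a. rel_compact_subdomain A U \<Longrightarrow> C1_on (\<gamma> ` U) a \<Longrightarrow> nowhere_constant (\<gamma> ` U) a \<Longrightarrow>
        mu1 (\<gamma> ` A) a \<le> ereal (K\<^sup>2) * mu1 A (a \<circ> \<gamma>)"
  shows "bounded_distortion U \<gamma>"
proof -
  have oU: "open U" using U by (simp add: domain_def)
  obtain \<gamma>' where der: "\<And>x. x \<in> U \<Longrightarrow> (\<gamma> has_derivative blinfun_apply (\<gamma>' x)) (at x)" and cont: "continuous_on U \<gamma>'"
    using C1 unfolding C1_on_def by blast
  define Q where "Q = 256 * 4 ^ CARD('n) * 2 ^ (CARD('n) + 1) * K\<^sup>2"
  have Q: "Q \<ge> 0" by (simp add: Q_def)
  have sq: "(norm (u v* matrix (\<gamma>' x)))\<^sup>2 \<le> Q * (norm (z v* matrix (\<gamma>' x)))\<^sup>2"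
    if x: "x \<in> U" and u: "norm u = 1" and z: "norm z = 1" for x u z
  proof (rule ccontr)
    assume neg: "\<not> ?thesis"
    \<comment> \<open>Where the inequality fails, \<open>h\<close> is positive; this set is open, so
      it would contain a regular point.\<close>
    define h where "h y = (norm (u v* matrix (\<gamma>' y)))\<^sup>2 - Q * (norm (z v* matrix (\<gamma>' y)))\<^sup>2" for y
    have "continuous_on U h"
      unfolding h_def vector_matrix_derivative by (intro continuous_intros cont)
    then have o: "open (h -` {0<..} \<inter> U)" using continuous_on_open_vimage[OF oU] open_greaterThan by blast
    have xN: "x \<in> h -` {0<..} \<inter> U" using x neg by (simp add: h_def)
    have "\<exists>y\<in>(h -` {0<..} \<inter> U) \<inter> U. det (matrix (\<gamma>' y)) \<noteq> 0"
      by (rule regular_points_dense[OF inv der cont x o xN])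
    then obtain y where y: "y \<in> h -` {0<..} \<inter> U" "y \<in> U" "det (matrix (\<gamma>' y)) \<noteq> 0" by auto
    have "h y \<le> 0"
      using distortion_at_regular_point[OF oU inv der cont K hyp y(2,3) u z] by (simp add: h_def Q_def)
    then show False using y(1) by simp
  qed
  have dist: "norm (u v* matrix (\<gamma>' x)) \<le> sqrt Q * norm (z v* matrix (\<gamma>' x))"
    if "x \<in> U" "norm u = 1" "norm z = 1" for x u z
  proof (rule power2_le_imp_le)
    show "(norm (u v* matrix (\<gamma>' x)))\<^sup>2 \<le> (sqrt Q * norm (z v* matrix (\<gamma>' x)))\<^sup>2"
      unfolding power_mult_distrib real_sqrt_pow2[OF Q] by (rule sq[OF that])
    show "0 \<le> sqrt Q * norm (z v* matrix (\<gamma>' x))" using Q by (intro mult_nonneg_nonneg) simp_all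
  qed
  obtain K' where K': "\<And>A :: real^'n^'n. (\<And>u z. norm u = 1 \<Longrightarrow> norm z = 1 \<Longrightarrow> norm (u v* A) \<le> sqrt Q * norm (z v* A))
    \<Longrightarrow> onorm (\<lambda>x. A *v x) \<le> K' * \<bar>det A\<bar> powr (1 / real CARD('n))"
    using det_lower_bound_of_distortion[of "sqrt Q"] Q by auto
  have entries: "continuous_on U (\<lambda>x. matrix (\<gamma>' x) $ i $ j)" for i j
    unfolding matrix_def by (simp, intro continuous_intros cont)
  have jac: "jac \<gamma> x = det (matrix (\<gamma>' x))" if "x \<in> U" for x
    unfolding jac_def using frechet_derivative_at[OF der[OF that]] by simp
  show ?thesis
    unfolding bounded_distortion_def
  proof (intro exI[of _ "\<lambda>x. matrix (\<gamma>' x)"] conjI allI)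
    show "weak_grad U (\<lambda>x. \<gamma> x $ i) (\<lambda>x. matrix (\<gamma>' x) $ i)" for i
    proof -
      have "weak_grad U (\<lambda>x. \<gamma> x $ i) (\<lambda>x. \<chi> j. \<gamma>' x (axis j 1) $ i)"
      proof (rule weak_grad_C1[OF oU])
        show "((\<lambda>x. \<gamma> x $ i) has_derivative (\<lambda>h. \<gamma>' x h $ i)) (at x)" if "x \<in> U" for x
          by (rule bounded_linear.has_derivative[OF bounded_linear_vec_nth der[OF that]])
        show "continuous_on U (\<lambda>x. \<gamma>' x (axis j 1) $ i)" for j by (intro continuous_intros cont)
      qed
      then show ?thesis by (simp add: matrix_def)
    qed
    show "L1loc U (\<lambda>x. det (matrix (\<gamma>' x)))"
      by (intro L1loc_continuous oU continuous_on_det_entries entries)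
    show "(AE x in lebesgue_on U. det (matrix (\<gamma>' x)) \<ge> 0) \<or> (AE x in lebesgue_on U. det (matrix (\<gamma>' x)) \<le> 0)"
      using sign by (auto simp: jac intro: AE_I2)
    show "\<exists>K'. AE x in lebesgue_on U. onorm (\<lambda>v. matrix (\<gamma>' x) *v v) \<le> K' * \<bar>det (matrix (\<gamma>' x))\<bar> powr (1 / real CARD('n))"
      using dist by (intro exI[of _ K'] AE_I2 K') simp
  qed
qed

text \<open>Continuity of the local inverses makes the map open, and an open injective map has a
  continuous inverse on its image.\<close>

lemma homeomorphism_of_locally_invertible:
  fixes \<gamma> :: "'a::topological_space \<Rightarrow> 'b::topological_space"
  assumes U: "open U" and cont: "continuous_on U \<gamma>" and inv: "locally_invertible U \<gamma>" and inj: "inj_on \<gamma> U"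
  shows "homeomorphism U (\<gamma> ` U) \<gamma> (inv_into U \<gamma>)"
proof (rule homeomorphismI)
  have op: "open (\<gamma> ` T)" if T: "open T" "T \<subseteq> U" for T
    unfolding open_subopen[of "\<gamma> ` T"]
  proof
    fix y assume "y \<in> \<gamma> ` T"
    then obtain x where x: "x \<in> T" "y = \<gamma> x" by blast
    then obtain V where V: "open V" "x \<in> V" "V \<subseteq> U" "open (\<gamma> ` V)" "inj_on \<gamma> V" "continuous_on (\<gamma> ` V) (inv_into V \<gamma>)"
      using inv T(2) unfolding locally_invertible_def by blast
    have "inv_into V \<gamma> -` T \<inter> \<gamma> ` V \<subseteq> \<gamma> ` T" using V(5) by (auto simp: inv_into_f_f)
    moreover have "open (inv_into V \<gamma> -` T \<inter> \<gamma> ` V)" using continuous_on_open_vimage[OF V(4)] V(6) T(1) by blast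
    moreover have "y \<in> inv_into V \<gamma> -` T \<inter> \<gamma> ` V" using x V(2,5) by (simp add: inv_into_f_f)
    ultimately show "\<exists>S. open S \<and> y \<in> S \<and> S \<subseteq> \<gamma> ` T" by blast
  qed
  have "open (\<gamma> ` U)" using op[OF U] by simp
  show "continuous_on (\<gamma> ` U) (inv_into U \<gamma>)"
    unfolding continuous_on_open_vimage[OF \<open>open (\<gamma> ` U)\<close>]
  proof (intro allI impI)
    fix B :: "'a set" assume "open B"
    moreover have "inv_into U \<gamma> -` B \<inter> \<gamma> ` U = \<gamma> ` (B \<inter> U)" using inj by (auto simp: inv_into_f_f)
    ultimately show "open (inv_into U \<gamma> -` B \<inter> \<gamma> ` U)" using op[of "B \<inter> U"] U by auto
  qed
qed (use cont inj in \<open>auto simp: inv_into_f_f\<close>)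

theorem mainTheorem19:
  fixes U :: "(real^'n) set" and \<gamma> :: "real^'n \<Rightarrow> real^'n"
  assumes "CARD('n) \<ge> 2"
    and "domain U"
    and "C1_on U \<gamma>"
    and "locally_invertible U \<gamma>"
    and "(\<forall>x\<in>U. jac \<gamma> x \<ge> 0) \<or> (\<forall>x\<in>U. jac \<gamma> x \<le> 0)"
  shows "((\<exists>K>0. \<forall>A a. rel_compact_subdomain A U \<and> C1_on (\<gamma> ` U) a \<and> nowhere_constant (\<gamma> ` U) a \<longrightarrow>
              mu1 (\<gamma> ` A) a \<le> ereal (K\<^sup>2) * mu1 A (a \<circ> \<gamma>))
           \<longrightarrow> bounded_distortion U \<gamma>)
       \<and> (inj_on \<gamma> U \<and>
          (\<exists>K>0. \<forall>A a. rel_compact_subdomain A U \<and> C1_on (\<gamma> ` U) a \<and> nowhere_constant (\<gamma> ` U) a \<longrightarrow>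
              ereal (1 / K\<^sup>2) * mu1 (\<gamma> ` A) a \<le> mu1 A (a \<circ> \<gamma>) \<and>
              mu1 A (a \<circ> \<gamma>) \<le> ereal (K\<^sup>2) * mu1 (\<gamma> ` A) a)
           \<longrightarrow> quasiconformal U \<gamma>)"
proof (intro conjI impI; (elim conjE)?; elim exE conjE)
  fix K :: real
  assume K: "0 < K"
    and "\<forall>A a. rel_compact_subdomain A U \<and> C1_on (\<gamma> ` U) a \<and> nowhere_constant (\<gamma> ` U) a \<longrightarrow>
              mu1 (\<gamma> ` A) a \<le> ereal (K\<^sup>2) * mu1 A (a \<circ> \<gamma>)"
  then show "bounded_distortion U \<gamma>"
    by (intro bounded_distortion_of_spectral_bound[OF assms(2-5) K]) auto
next
  fix K :: real
  assume inj: "inj_on \<gamma> U" and K: "0 < K"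
    and hyp: "\<forall>A a. rel_compact_subdomain A U \<and> C1_on (\<gamma> ` U) a \<and> nowhere_constant (\<gamma> ` U) a \<longrightarrow>
              ereal (1 / K\<^sup>2) * mu1 (\<gamma> ` A) a \<le> mu1 A (a \<circ> \<gamma>) \<and>
              mu1 A (a \<circ> \<gamma>) \<le> ereal (K\<^sup>2) * mu1 (\<gamma> ` A) a"
  \<comment> \<open>Multiplying by \<open>K\<^sup>2\<close> turns the lower inequality of (ii) into
    the hypothesis of (i); the case distinction covers infinite values of
    \<open>mu1\<close>.\<close>
  have flip: "s \<le> ereal (K\<^sup>2) * t" if "ereal (1 / K\<^sup>2) * s \<le> t" for s t
    using that K by (cases s; cases t) (auto simp: field_simps)
  have "bounded_distortion U \<gamma>"
    using hyp by (intro bounded_distortion_of_spectral_bound[OF assms(2-5) K] flip) auto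
  moreover have "continuous_on U \<gamma>"
    using assms(3) unfolding C1_on_def by (metis continuous_at_imp_continuous_on has_derivative_continuous)
  then have "homeomorphism U (\<gamma> ` U) \<gamma> (inv_into U \<gamma>)"
    using assms(2,4) inj by (intro homeomorphism_of_locally_invertible) (auto simp: domain_def)
  ultimately show "quasiconformal U \<gamma>" unfolding quasiconformal_def by blast
qed

end
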